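(* If a Borel graph $G$ is locally a square lattice, then either $\perp_G$ admits a Borel 2-coloring, or there is a Borel conformal map from $\mathbb{S}_0$ to $G$.
   Context: A graph on $X$ is a symmetric irreflexive subset of $X^2$; its elements are (directed) edges, and $-(e_0,e_1)=(e_1,e_0)$. A graph is locally a square lattice if each of its connected components is isomorphic to the Cayley graph of $\mathbb{Z}^2$ with the usual generators $(\pm1,0),(0,\pm1)$. A straight line in a graph is a directed path such that no other path of the same or shorter length has the same endpoints. A rectangle is a simple directed cycle that can be divided into 4 straight lines. Directed edges $e,e'$ are parallel, $e\,\|\,e'$, if they lie on some straight line together or if $-e$ and $e'$ are on opposite sides of a rectangle; they are anti-parallel if $(-e)\,\|\,e'$; they are perpendicular if they are in the same component and are neither parallel nor anti-parallel. $\perp_G$ is the graph whose vertex set is $G$ (the set of directed edges) and in which two elements are adjacent iff they are perpendicular. A Borel 2-coloring is a Borel map to $\{0,1\}$ giving adjacent vertices different values. If $H$ and $G$ are graphs, on $X$ and $Y$ respectively, which are locally square lattices, a map $f:X\to Y$ is a conformal map from $H$ to $G$ if for any vertices $x,y$ of $H$: $x,y$ are on a (common) straight line iff $f(x),f(y)$ are on a (common) straight line. Let $s_0=\emptyset$ and $s_n=0^{n-1}1$ for $n>0$. $\mathcal{L}$ is the graph on $2^\omega$ in which $x,y$ are adjacent iff for some $z\in 2^\omega$ and $n\in\omega$, $\{x,y\}=\{s_n\,0\,z,\ s_n\,1\,z\}$, where juxtaposition of sequences denotes concatenation; $d_{\mathcal{L}}$ is its graph distance. $X_{\mathbb{S}_0}$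 is the set of classes $[x,y]=\{(x,y),(y,x)\}$ of pairs $x,y\in 2^\omega$ with $d_{\mathcal{L}}(x,y)$ odd (in particular, $x,y$ in the same component of $\mathcal{L}$), with the quotient Borel structure. $\mathbb{S}_0$ is the graph on $X_{\mathbb{S}_0}$ in which two points are adjacent iff they can be written as $[x,y]$ and $[a,b]$ with either $x=a$ and $d_{\mathcal{L}}(y,b)=2$, or $y=b$ and $d_{\mathcal{L}}(x,a)=2$. Here $\mathbb{S}_0$ is regarded as locally a square lattice, so that the notion of conformal map applies to it. *)

theory Defs
  imports "HOL-Analysis.Analysis" "HOL-Library.Omega_Words_Fun"
begin

section \<open>Standard Borel spaces and Borel graphs\<close>

text \<open>A Borel space is represented by a measure, of which only the carrier and the
  \<open>\<sigma>\<close>-algebra are used; it is standard if the latter is generated by some Polish topology.\<close>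

definition standard_borel :: "'a measure \<Rightarrow> bool" where
  "standard_borel M \<longleftrightarrow> (\<exists>T. completely_metrizable_space T \<and> second_countable T \<and>
     topspace T = space M \<and> sets M = sigma_sets (space M) {U. openin T U})"

definition graph_on :: "'a set \<Rightarrow> 'a rel \<Rightarrow> bool" where
  "graph_on X G \<longleftrightarrow> G \<subseteq> X \<times> X \<and> sym G \<and> irrefl G"

definition borel_graph :: "'a measure \<Rightarrow> 'a rel \<Rightarrow> bool" where
  "borel_graph M G \<longleftrightarrow> graph_on (space M) G \<and> G \<in> sets (M \<Otimes>\<^sub>M M)"

definition borel_two_coloring :: "'v measure \<Rightarrow> 'v rel \<Rightarrow> ('v \<Rightarrow> nat) \<Rightarrow> bool" where
  "borel_two_coloring N P c \<longleftrightarrow>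
     c \<in> N \<rightarrow>\<^sub>M count_space {0, 1} \<and> (\<forall>(u, v) \<in> P. c u \<noteq> c v)"


section \<open>Square lattices\<close>

definition component :: "'a rel \<Rightarrow> 'a \<Rightarrow> 'a set" where
  "component G x = {y. (x, y) \<in> G\<^sup>*}"

definition cayley_graph :: "'g::group_add set \<Rightarrow> 'g rel" where
  "cayley_graph S = {(g, g + s) |g s. s \<in> S}"

definition square_lattice :: "(int \<times> int) rel" where
  "square_lattice = cayley_graph {(1, 0), (-1, 0), (0, 1), (0, -1)}"

definition locally_square_lattice :: "'a set \<Rightarrow> 'a rel \<Rightarrow> bool" where
  "locally_square_lattice X G \<longleftrightarrow> (\<forall>x \<in> X. \<exists>\<phi> :: 'a \<Rightarrow> int \<times> int.
     bij_betw \<phi> (component G x) UNIV \<and>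
     (\<forall>u \<in> component G x. \<forall>v \<in> component G x.
        (u, v) \<in> G \<longleftrightarrow> (\<phi> u, \<phi> v) \<in> square_lattice))"


section \<open>Straight lines, rectangles, and perpendicular edges\<close>

text \<open>Directed paths are given by their nonempty lists of successive vertices.\<close>

definition is_path :: "'a rel \<Rightarrow> 'a list \<Rightarrow> bool" where
  "is_path G p \<longleftrightarrow> p \<noteq> [] \<and> successively (\<lambda>u v. (u, v) \<in> G) p"

definition path_edges :: "'a list \<Rightarrow> ('a \<times> 'a) set" where
  "path_edges p = set (zip p (tl p))"

text \<open>Repeated vertices need not be excluded here: deleting a loop from a path would yield a
  shorter one with the same endpoints, so straight lines are simple.\<close>

definition straight_line :: "'a rel \<Rightarrow> 'a list \<Rightarrow> bool" where
  "straight_line G p \<longleftrightarrow> is_path G p \<and>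
     (\<forall>q. is_path G q \<and> hd q = hd p \<and> last q = last p \<and> length q \<le> length p \<longrightarrow> q = p)"

definition collinear_in :: "'a rel \<Rightarrow> 'a \<Rightarrow> 'a \<Rightarrow> bool" where
  "collinear_in G x y \<longleftrightarrow> (\<exists>p. straight_line G p \<and> x \<in> set p \<and> y \<in> set p)"

text \<open>A rectangle is given by its sides, in cyclic order. Each side has at least one edge, and
  shares with the next one only their common corner.\<close>

definition rectangle :: "'a rel \<Rightarrow> 'a list \<Rightarrow> 'a list \<Rightarrow> 'a list \<Rightarrow> 'a list \<Rightarrow> bool" where
  "rectangle G p\<^sub>0 p\<^sub>1 p\<^sub>2 p\<^sub>3 \<longleftrightarrow>
     (\<forall>p \<in> {p\<^sub>0, p\<^sub>1, p\<^sub>2, p\<^sub>3}. straight_line G p \<and> 2 \<le> length p) \<and>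
     last p\<^sub>0 = hd p\<^sub>1 \<and> last p\<^sub>1 = hd p\<^sub>2 \<and> last p\<^sub>2 = hd p\<^sub>3 \<and> last p\<^sub>3 = hd p\<^sub>0 \<and>
     distinct (butlast p\<^sub>0 @ butlast p\<^sub>1 @ butlast p\<^sub>2 @ butlast p\<^sub>3)"

text \<open>The other choices of two opposite sides are covered by cyclically permuting the sides.\<close>

definition opposite :: "'a rel \<Rightarrow> 'a \<times> 'a \<Rightarrow> 'a \<times> 'a \<Rightarrow> bool" where
  "opposite G e e' \<longleftrightarrow> (\<exists>p\<^sub>0 p\<^sub>1 p\<^sub>2 p\<^sub>3. rectangle G p\<^sub>0 p\<^sub>1 p\<^sub>2 p\<^sub>3 \<and>
     e \<in> path_edges p\<^sub>0 \<and> e' \<in> path_edges p\<^sub>2)"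

text \<open>The edge written \<open>-e\<close> in the literature is \<open>prod.swap e\<close>.\<close>

definition parallel_edges :: "'a rel \<Rightarrow> 'a \<times> 'a \<Rightarrow> 'a \<times> 'a \<Rightarrow> bool" where
  "parallel_edges G e e' \<longleftrightarrow>
     (\<exists>p. straight_line G p \<and> e \<in> path_edges p \<and> e' \<in> path_edges p) \<or>
     opposite G (prod.swap e) e'"

definition antiparallel_edges :: "'a rel \<Rightarrow> 'a \<times> 'a \<Rightarrow> 'a \<times> 'a \<Rightarrow> bool" where
  "antiparallel_edges G e e' \<longleftrightarrow> parallel_edges G (prod.swap e) e'"

definition perp_graph :: "'a rel \<Rightarrow> ('a \<times> 'a) rel" where
  "perp_graph G = {(e, e'). e \<in> G \<and> e' \<in> G \<and> fst e' \<in> component G (fst e) \<and>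
     \<not> parallel_edges G e e' \<and> \<not> antiparallel_edges G e e'}"


section \<open>Conformal maps\<close>

text \<open>The defining condition makes sense for arbitrary graphs, so it is not restricted to those
  which are locally square lattices. This matters for the graph \<open>S0_graph\<close> below: the
  \<open>L_graph\<close>-component of the constant sequence \<open>0\<close> is a one-ended ray, so one component of
  \<open>S0_graph\<close> is a quadrant of the square lattice rather than all of it.\<close>

definition conformal_map :: "'a set \<Rightarrow> 'a rel \<Rightarrow> 'b set \<Rightarrow> 'b rel \<Rightarrow> ('a \<Rightarrow> 'b) \<Rightarrow> bool" where
  "conformal_map X H Y G f \<longleftrightarrow> f \<in> X \<rightarrow> Y \<and>
     (\<forall>x \<in> X. \<forall>y \<in> X. collinear_in H x y \<longleftrightarrow> collinear_in G (f x) (f y))"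


section \<open>The graph \<open>S\<^sub>0\<close>\<close>

text \<open>The infimum is \<open>\<infinity>\<close> when the two points lie in different components.\<close>

definition graph_dist :: "'a rel \<Rightarrow> 'a \<Rightarrow> 'a \<Rightarrow> enat" where
  "graph_dist G x y = (INF n \<in> {n. (x, y) \<in> G ^^ n}. enat n)"

text \<open>Points of the Cantor space are functions from \<open>nat\<close> to \<open>bool\<close>, with \<open>False\<close> and \<open>True\<close>
  in place of \<open>0\<close> and \<open>1\<close>; \<open>borel\<close> refers to the product topology.\<close>

fun s_word :: "nat \<Rightarrow> bool list" where
  "s_word 0 = []"
| "s_word (Suc n) = replicate n False @ [True]"

definition L_graph :: "(nat \<Rightarrow> bool) rel" where
  "L_graph = {(x, y). \<exists>z n.
     {x, y} = {s_word n \<frown> [False] \<frown> z, s_word n \<frown> [True] \<frown> z}}"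

definition odd_pairs :: "((nat \<Rightarrow> bool) \<times> (nat \<Rightarrow> bool)) set" where
  "odd_pairs = {(x, y). \<exists>n. odd n \<and> graph_dist L_graph x y = enat n}"

definition unordered :: "'a \<times> 'a \<Rightarrow> ('a \<times> 'a) set" where
  "unordered p = {p, prod.swap p}"

type_synonym S0_vertex = "((nat \<Rightarrow> bool) \<times> (nat \<Rightarrow> bool)) set"

definition S0_vertices :: "S0_vertex set" where
  "S0_vertices = unordered ` odd_pairs"

definition S0_space :: "S0_vertex measure" where
  "S0_space = sigma S0_vertices {A. A \<subseteq> S0_vertices \<and>
     unordered -` A \<inter> odd_pairs \<in> sets (restrict_space borel odd_pairs)}"

definition S0_graph :: "S0_vertex rel" where
  "S0_graph = {(unordered (x, y), unordered (a, b)) |x y a b.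
     (x, y) \<in> odd_pairs \<and> (a, b) \<in> odd_pairs \<and>
     (x = a \<and> graph_dist L_graph y b = 2 \<or> y = b \<and> graph_dist L_graph x a = 2)}"

lemma space_S0_space [simp]: "space S0_space = S0_vertices"
  unfolding S0_space_def by (rule space_measure_of) auto

lemma sets_S0_space:
  "sets S0_space = {A. A \<subseteq> S0_vertices \<and>
     unordered -` A \<inter> odd_pairs \<in> sets (restrict_space borel odd_pairs)}"
  (is "_ = ?Q")
proof -
  let ?R = "restrict_space borel odd_pairs"
  have R: "space ?R = odd_pairs"
    by (simp add: space_restrict_space)
  have "sigma_algebra S0_vertices ?Q"
    unfolding sigma_algebra_iff2
  proof (intro conjI ballI allI impI)
    show "?Q \<subseteq> Pow S0_vertices" by auto
    show "{} \<in> ?Q" by simp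
  next
    fix A assume A: "A \<in> ?Q"
    have "unordered -` (S0_vertices - A) \<inter> odd_pairs = space ?R - unordered -` A \<inter> odd_pairs"
      unfolding R by (auto simp: S0_vertices_def)
    with A show "S0_vertices - A \<in> ?Q"
      using sets.compl_sets [of "unordered -` A \<inter> odd_pairs" ?R] by auto
  next
    fix A :: "nat \<Rightarrow> S0_vertex set" assume A: "range A \<subseteq> ?Q"
    have "(\<Union>i. unordered -` A i \<inter> odd_pairs) \<in> sets ?R"
      using A by (intro sets.countable_UN) auto
    moreover have "unordered -` (\<Union>i. A i) \<inter> odd_pairs = (\<Union>i. unordered -` A i \<inter> odd_pairs)"
      by auto
    ultimately show "(\<Union>i. A i) \<in> ?Q"
      using A by auto
  qed
  then show ?thesis
    unfolding S0_space_def by (simp add: sigma_algebra.sets_measure_of_eq)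
qed

end

theory Submission
  imports Defs
begin

text \<open>
  The perpendicularity graph is two-colorable in a Borel way iff one of the two directions of each
  component can be selected in a Borel way. Call a Borel set of vertices small if this can be done on
  the components that it meets; the small sets form a \<open>\<sigma>\<close>-ideal. If a set \<open>A\<close> is not small, then for
  every \<open>D\<close> there is a move, relative to Borel frames of the components, by more than \<open>D\<close> in both
  coordinates, such that the points of \<open>A\<close> that it moves into \<open>A\<close> while exchanging the directions of
  the frame are again not small: otherwise \<open>A\<close> would be finite in one direction or contained in a
  strip on each component, and either would select a direction. Iterating this gives a continuous map
  \<open>f\<close> on the Cantor space such that changing one digit of \<open>a\<close> exchanges the direction of the line
  through \<open>f a\<close>, and distinct points have distinct lines. Since the \<open>L_graph\<close> is made of such
  changes, mapping \<open>[x, y]\<close> to the intersection of the lines through \<open>f x\<close> and \<open>f y\<close> is a conformal map.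

  Borel frames exist because the vertices with a neighbour in a given Borel set form a Borel set, by
  Lusin separation. Limits are controlled by coding vertices as points of a closed subset of the Baire
  space in such a way that the relevant countably many Borel sets become clopen.
\<close>

section \<open>Codes of standard Borel spaces\<close>

text \<open>The obstacle is that \<open>hz\<close>, the direction of a frame, comes from charts
  chosen separately on each component and need not be Borel; a Borel \<open>hz\<close> would already
  give the coloring. What is Borel is whatever can be read off from the graph, in particular whether
  a move keeps the direction. So the Borel sets below are defined through the moves
  \<open>mv p\<close>, and the charts only serve to reason about them. The parity built into
  \<open>odd_pairs\<close> has this reason: each edge of \<open>L_graph\<close> exchanges the
  direction, so the lines of two points at odd distance are perpendicular and meet in exactly one
  vertex. Two such vertices are collinear only if they share one of these lines, provided that
  distinct points never have the same line. The large moves secure this: since the direction of a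
  line is not known in advance, points have to differ in both coordinates. Being distinct does not
  pass to limits, so the digits that witness it are fixed during the construction.\<close>

definition fclosed :: "('i \<Rightarrow> nat) set \<Rightarrow> bool" where
  "fclosed K \<longleftrightarrow> (\<forall>a. (\<forall>F. finite F \<longrightarrow> (\<exists>b\<in>K. \<forall>i\<in>F. b i = a i)) \<longrightarrow> a \<in> K)"

lemma fclosedI:
  assumes "\<And>a. (\<And>F. finite F \<Longrightarrow> \<exists>b\<in>K. \<forall>i\<in>F. b i = a i) \<Longrightarrow> a \<in> K"
  shows "fclosed K"
  using assms by (auto simp: fclosed_def)

lemma fclosedD:
  assumes "fclosed K" "\<And>F. finite F \<Longrightarrow> \<exists>b\<in>K. \<forall>i\<in>F. b i = a i"
  shows "a \<in> K"
  using assms by (auto simp: fclosed_def)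

lemma fclosed_reindex:
  fixes r :: "'j \<Rightarrow> 'i"
  assumes "fclosed K"
  shows "fclosed {b. (\<lambda>i. b (r i)) \<in> K}"
proof (rule fclosedI)
  fix a assume a: "\<And>F. finite F \<Longrightarrow> \<exists>b\<in>{b. (\<lambda>i. b (r i)) \<in> K}. \<forall>i\<in>F. b i = a i"
  have "(\<lambda>i. a (r i)) \<in> K"
  proof (rule fclosedD [OF assms])
    fix F :: "'j set" assume "finite F"
    then have "finite (r ` F)" by (rule finite_imageI)
    from a [OF this] obtain b where "(\<lambda>i. b (r i)) \<in> K" "\<forall>i\<in>r ` F. b i = a i"
      by blast
    then show "\<exists>b\<in>K. \<forall>i\<in>F. b i = a (r i)"
      by (intro bexI [where x = "\<lambda>i. b (r i)"]) simp_all
  qed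
  then show "a \<in> {b. (\<lambda>i. b (r i)) \<in> K}" by simp
qed

lemma fclosed_INT:
  assumes "\<And>n. n \<in> I \<Longrightarrow> fclosed (K n)"
  shows "fclosed (\<Inter>n\<in>I. K n)"
proof (rule fclosedI)
  fix a assume a: "\<And>F. finite F \<Longrightarrow> \<exists>b\<in>(\<Inter>n\<in>I. K n). \<forall>i\<in>F. b i = a i"
  have "a \<in> K n" if "n \<in> I" for n
    by (rule fclosedD [OF assms [OF that]]) (use a that in fast)
  then show "a \<in> (\<Inter>n\<in>I. K n)" by auto
qed

lemma fclosed_Int: "fclosed K \<Longrightarrow> fclosed L \<Longrightarrow> fclosed (K \<inter> L)"
  using fclosed_INT [of "{True, False}" "\<lambda>b. if b then K else L"] by (auto simp: Int_commute)

lemma fclosed_eq: "fclosed {b. b i = b j}"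
proof (rule fclosedI)
  fix a assume a: "\<And>F. finite F \<Longrightarrow> \<exists>b\<in>{b. b i = b j}. \<forall>i\<in>F. b i = a i"
  show "a \<in> {b. b i = b j}" using a [of "{i, j}"] by auto
qed

lemma fclosed_digit: "fclosed {b. P (b i)}"
proof (rule fclosedI)
  fix a assume a: "\<And>F. finite F \<Longrightarrow> \<exists>b\<in>{b. P (b i)}. \<forall>i\<in>F. b i = a i"
  show "a \<in> {b. P (b i)}" using a [of "{i}"] by auto
qed

text \<open>A code turns a standard Borel space into a closed subset of the Baire space, with the
  \<open>\<sigma>\<close>-algebra generated by the digits.\<close>

definition is_code :: "'a measure \<Rightarrow> ('a \<Rightarrow> 'i \<Rightarrow> nat) \<Rightarrow> bool" where
  "is_code M k \<longleftrightarrow> inj_on k (space M) \<and> fclosed (k ` space M) \<and>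
     sets M = sigma_sets (space M) {{x \<in> space M. k x i = j} |i j. True}"

lemma is_code_digit:
  assumes "is_code M k"
  shows "(\<lambda>x. k x i) \<in> M \<rightarrow>\<^sub>M count_space UNIV"
proof -
  have "{x \<in> space M. k x i = j} \<in> sets M" for j
    using assms unfolding is_code_def by (auto intro: sigma_sets.Basic)
  then show ?thesis
    by (subst measurable_count_space_eq2_countable) (auto simp: vimage_def Int_def conj_commute)
qed

text \<open>Completeness in the form in which it is used: a limit is prescribed digit by digit, and
  only finitely many digits at a time have to be realized.\<close>

lemma is_code_approx:
  assumes "is_code M k" "\<And>F. finite F \<Longrightarrow> \<exists>x\<in>space M. \<forall>i\<in>F. k x i = a i"
  shows "\<exists>x\<in>space M. k x = a"
proof -
  have "a \<in> k ` space M"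
    by (rule fclosedD) (use assms in \<open>auto simp: is_code_def\<close>)
  then show ?thesis by auto
qed

lemma is_code_eq_iff:
  "is_code M k \<Longrightarrow> x \<in> space M \<Longrightarrow> y \<in> space M \<Longrightarrow> k x = k y \<longleftrightarrow> x = y"
  by (auto simp: is_code_def inj_on_def)

lemma measurable_into_code:
  assumes k: "is_code M k" and f: "\<And>x. x \<in> space N \<Longrightarrow> f x \<in> space M"
    and d: "\<And>i. (\<lambda>x. k (f x) i) \<in> N \<rightarrow>\<^sub>M count_space UNIV"
  shows "f \<in> N \<rightarrow>\<^sub>M M"
proof (rule measurable_sigma_sets)
  show "sets M = sigma_sets (space M) {{x \<in> space M. k x i = j} |i j. True}"
    using k by (simp add: is_code_def)
  fix A assume "A \<in> {{x \<in> space M. k x i = j} |i j. True}"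
  then obtain i j where A: "A = {x \<in> space M. k x i = j}" by auto
  have "f -` A \<inter> space N = (\<lambda>x. k (f x) i) -` {j} \<inter> space N"
    using f by (auto simp: A)
  then show "f -` A \<inter> space N \<in> sets N"
    using measurable_sets [OF d, of "{j}" i] by simp
qed (use f in auto)

text \<open>Codes are assembled over sums and products of index types; this returns to
  sequences.\<close>

lemma fclosed_to_nat:
  fixes K :: "('i::countable \<Rightarrow> nat) set"
  assumes "fclosed K"
  shows "fclosed ((\<lambda>b n. b (from_nat n)) ` K)"
proof (rule fclosedI)
  fix a :: "nat \<Rightarrow> nat"
  assume a: "\<And>F. finite F \<Longrightarrow> \<exists>b\<in>(\<lambda>b n. b (from_nat n)) ` K. \<forall>i\<in>F. b i = a i"
  have "(\<lambda>i. a (to_nat i)) \<in> K"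
  proof (rule fclosedD [OF assms])
    fix F :: "'i set" assume "finite F"
    then show "\<exists>b\<in>K. \<forall>i\<in>F. b i = a (to_nat i)"
      using a [of "to_nat ` F"] by auto
  qed
  \<comment> \<open>Several \<open>n\<close> may name the same index under \<open>from_nat\<close>,
    so membership in the image also requires \<open>a\<close> to be constant on them.\<close>
  moreover have "a (to_nat (from_nat n :: 'i)) = a n" for n
    using a [of "{n, to_nat (from_nat n :: 'i)}"] by auto
  ultimately show "a \<in> (\<lambda>b n. b (from_nat n)) ` K"
    by (intro image_eqI [where x = "\<lambda>i. a (to_nat i)"]) auto
qed

lemma is_code_to_nat:
  fixes k :: "'a \<Rightarrow> 'i::countable \<Rightarrow> nat"
  assumes "is_code M k"
  shows "is_code M (\<lambda>x n. k x (from_nat n))"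
proof -
  have 1: "fclosed ((\<lambda>x n. k x (from_nat n)) ` space M)"
    using fclosed_to_nat [of "k ` space M"] assms by (simp add: is_code_def image_image)
  have 2: "inj_on (\<lambda>x n. k x (from_nat n)) (space M)"
  proof (rule inj_onI)
    fix x y assume xy: "x \<in> space M" "y \<in> space M"
      "(\<lambda>n. k x (from_nat n)) = (\<lambda>n. k y (from_nat n))"
    have "k x i = k y i" for i
      using fun_cong [OF xy(3), of "to_nat i"] by simp
    then have "k x = k y" by (rule ext)
    then show "x = y" using xy assms by (simp add: is_code_def inj_on_def)
  qed
  have "{f i j |i j. True} = {f (from_nat n) j |n j. True}" for f :: "'i \<Rightarrow> nat \<Rightarrow> 'a set"
  proof (intro set_eqI iffI)
    fix A assume "A \<in> {f i j |i j. True}"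
    then obtain i j where "A = f i j" by auto
    then have "A = f (from_nat (to_nat i)) j" by simp
    then show "A \<in> {f (from_nat n) j |n j. True}" by blast
  qed blast
  from this [of "\<lambda>i j. {x \<in> space M. k x i = j}"] assms 1 2 show ?thesis
    by (simp only: is_code_def simp_thms)
qed

text \<open>A Borel set can be made clopen by refining the topology without adding Borel sets; the
  digits \<open>l\<close> are the refinement, and the first of them decides membership in
  \<open>U\<close>. The proof is by induction on \<open>U\<close>, keeping the combined range closed
  at each step.\<close>

lemma refine_code:
  assumes k: "is_code M k" and U: "U \<in> sets M"
  shows "\<exists>l :: 'a \<Rightarrow> nat \<Rightarrow> nat. (\<forall>i. (\<lambda>x. l x i) \<in> M \<rightarrow>\<^sub>M count_space UNIV) \<and>
    fclosed ((\<lambda>x. case_sum (k x) (l x)) ` space M) \<and> (\<forall>x\<in>space M. x \<in> U \<longleftrightarrow> l x 0 \<noteq> 0)"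
    (is "\<exists>l. ?P U l")
proof -
  let ?X = "space M"
  note [measurable] = is_code_digit [OF k]
  have *: "\<exists>x\<in>?X. k x = a \<circ> Inl \<and> l x = a \<circ> Inr"
    if "fclosed ((\<lambda>x. case_sum (k x) (l x)) ` ?X)"
      "\<And>F. finite F \<Longrightarrow> \<exists>x\<in>?X. \<forall>i\<in>F. case_sum (k x) (l x) i = a i" for l :: "'a \<Rightarrow> nat \<Rightarrow> nat" and a
  proof -
    have "a \<in> (\<lambda>x. case_sum (k x) (l x)) ` ?X"
      by (rule fclosedD [OF that(1)]) (use that(2) in auto)
    then show ?thesis by (auto simp: fun_eq_iff)
  qed
  \<comment> \<open>A set given by one digit needs no new information: the answer is repeated as
    every digit of \<open>l\<close>. A constant \<open>Q\<close> covers the empty set.\<close>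
  have digit: "\<exists>l. ?P {x \<in> ?X. Q (k x i)} l" for Q and i
  proof (intro exI [of _ "\<lambda>x n. of_bool (Q (k x i))"] conjI allI)
    show "fclosed ((\<lambda>x. case_sum (k x) (\<lambda>n::nat. of_bool (Q (k x i)) :: nat)) ` ?X)"
    proof (rule fclosedI)
      fix a
      assume "\<And>F. finite F \<Longrightarrow> \<exists>b\<in>(\<lambda>x. case_sum (k x) (\<lambda>n::nat. of_bool (Q (k x i)))) ` ?X. \<forall>m\<in>F. b m = a m"
      then have a: "\<And>F. finite F \<Longrightarrow> \<exists>x\<in>?X. \<forall>m\<in>F. case_sum (k x) (\<lambda>n::nat. of_bool (Q (k x i))) m = a m"
        by blast
      have "\<exists>x\<in>?X. k x = a \<circ> Inl"
      proof (rule is_code_approx [OF k])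
        fix F :: "'b set" assume "finite F"
        then show "\<exists>x\<in>?X. \<forall>i\<in>F. k x i = (a \<circ> Inl) i" using a [of "Inl ` F"] by auto
      qed
      then obtain x where x: "x \<in> ?X" "k x = a \<circ> Inl" by auto
      have "a (Inr n) = of_bool (Q (k x i))" for n
        using a [of "{Inl i, Inr n}"] x by auto
      with x show "a \<in> (\<lambda>x. case_sum (k x) (\<lambda>n. of_bool (Q (k x i)))) ` ?X"
        by (intro image_eqI [where x = x]) (auto simp: fun_eq_iff split: sum.split)
    qed
  qed auto
  have "U \<in> sigma_sets ?X {{x \<in> ?X. k x i = j} |i j. True}"
    using k U by (simp add: is_code_def)
  then show ?thesis
  proof induction
    case (Basic U)
    then show ?case using digit by auto
  next
    case Empty
    show ?case using digit [of "\<lambda>_. False"] by simp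
  next
    case (Compl U)
    then obtain l where l: "?P U l" by blast
    \<comment> \<open>The reversed answer is put in front; the old digits stay, because they confirm
      it.\<close>
    define l' where "l' x = case_nat (of_bool (l x 0 = 0)) (l x)" for x
    have "?P (?X - U) l'"
    proof (intro conjI allI)
      show "(\<lambda>x. l' x i) \<in> M \<rightarrow>\<^sub>M count_space UNIV" for i
      proof (cases i)
        case 0
        have "(\<lambda>x. of_bool (l x 0 = 0) :: nat) \<in> M \<rightarrow>\<^sub>M count_space UNIV"
          by (rule measurable_compose [where f = "\<lambda>x. l x 0"]) (use l in auto)
        with 0 show ?thesis by (simp add: l'_def)
      next
        case (Suc n)
        with l show ?thesis by (simp add: l'_def)
      qed
      show "fclosed ((\<lambda>x. case_sum (k x) (l' x)) ` ?X)"
      proof (rule fclosedI)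
        fix a
        assume "\<And>F. finite F \<Longrightarrow> \<exists>b\<in>(\<lambda>x. case_sum (k x) (l' x)) ` ?X. \<forall>m\<in>F. b m = a m"
        then have a: "\<And>F. finite F \<Longrightarrow> \<exists>x\<in>?X. \<forall>m\<in>F. case_sum (k x) (l' x) m = a m"
          by blast
        define r :: "'b + nat \<Rightarrow> 'b + nat" where "r = case_sum Inl (Inr \<circ> Suc)"
        have r: "case_sum (k x) (l x) i = case_sum (k x) (l' x) (r i)" for x i
          by (auto simp: r_def l'_def split: sum.split)
        have "\<exists>x\<in>?X. k x = (a \<circ> r) \<circ> Inl \<and> l x = (a \<circ> r) \<circ> Inr"
        proof (rule *)
          fix F :: "('b + nat) set" assume "finite F"
          then show "\<exists>x\<in>?X. \<forall>i\<in>F. case_sum (k x) (l x) i = (a \<circ> r) i" 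
            using a [of "r ` F"] by (auto simp: r)
        qed (use l in auto)
        then obtain x where x: "x \<in> ?X" "k x = a \<circ> Inl" "l x = a \<circ> Inr \<circ> Suc"
          by (auto simp: r_def fun_eq_iff)
        have "a (Inr 0) = of_bool (l x 0 = 0)"
          using a [of "{Inr 0, Inr 1}"] x by (auto simp: l'_def)
        with x show "a \<in> (\<lambda>x. case_sum (k x) (l' x)) ` ?X"
          by (intro image_eqI [where x = x]) (auto simp: fun_eq_iff l'_def split: sum.split nat.split)
      qed
      show "\<forall>x\<in>?X. x \<in> ?X - U \<longleftrightarrow> l' x 0 \<noteq> 0"
        using l by (auto simp: l'_def)
    qed
    then show ?case by blast
  next
    case (Union U)
    then have "\<forall>n. \<exists>l. ?P (U n) l" by blast
    from choice [OF this] obtain l where "\<forall>n. ?P (U n) (l n)" ..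
    then have l: "?P (U n) (l n)" for n by (rule spec)
    have Us: "U n \<in> sets M" for n
      using Union.hyps k by (simp add: is_code_def)
    \<comment> \<open>Recording the least index rather than a mere yes keeps the range closed:
      points could otherwise leave each \<open>U n\<close> in turn, and their limit would be in none
      of them although the digit says yes. The remaining digits are those of all the
      \<open>l n\<close>.\<close>
    define l' where "l' x = case_nat (if x \<in> (\<Union>n. U n) then Suc (LEAST n. x \<in> U n) else 0)
       (\<lambda>m. l (fst (prod_decode m)) x (snd (prod_decode m)))" for x
    have l'0: "l' x 0 = (if x \<in> (\<Union>n. U n) then Suc (LEAST n. x \<in> U n) else 0)" for x
      by (simp add: l'_def)
    have l'S: "l n x m = l' x (Suc (prod_encode (n, m)))" for n x m
      by (simp add: l'_def)
    have "?P (\<Union>n. U n) l'"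
    proof (intro conjI allI)
      show "(\<lambda>x. l' x i) \<in> M \<rightarrow>\<^sub>M count_space UNIV" for i
      proof (cases i)
        case 0
        have [measurable]: "Measurable.pred M (\<lambda>x. x \<in> U n)" for n
          using Us [of n] by simp
        have "(\<lambda>x. if \<exists>n. x \<in> U n then Suc (LEAST n. x \<in> U n) else 0) \<in> M \<rightarrow>\<^sub>M count_space UNIV"
          by measurable
        with 0 show ?thesis by (simp add: l'_def)
      next
        case (Suc n)
        with l show ?thesis by (simp add: l'_def)
      qed
      show "fclosed ((\<lambda>x. case_sum (k x) (l' x)) ` ?X)"
      proof (rule fclosedI)
        fix a
        assume "\<And>F. finite F \<Longrightarrow> \<exists>b\<in>(\<lambda>x. case_sum (k x) (l' x)) ` ?X. \<forall>m\<in>F. b m = a m"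
        then have a: "\<And>F. finite F \<Longrightarrow> \<exists>x\<in>?X. \<forall>m\<in>F. case_sum (k x) (l' x) m = a m"
          by blast
        define r :: "nat \<Rightarrow> 'b + nat \<Rightarrow> 'b + nat"
          where "r n = case_sum Inl (\<lambda>m. Inr (Suc (prod_encode (n, m))))" for n
        have r: "case_sum (k x) (l n x) i = case_sum (k x) (l' x) (r n i)" for x i n
          by (auto simp: r_def l'S split: sum.split)
        have "\<exists>x\<in>?X. k x = (a \<circ> r n) \<circ> Inl \<and> l n x = (a \<circ> r n) \<circ> Inr" for n
        proof (rule *)
          fix F :: "('b + nat) set" assume "finite F"
          then show "\<exists>x\<in>?X. \<forall>i\<in>F. case_sum (k x) (l n x) i = (a \<circ> r n) i" 
            using a [of "r n ` F"] by (auto simp: r)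
        qed (use l in auto)
        then have ex: "\<exists>x\<in>?X. k x = a \<circ> Inl \<and> l n x = (a \<circ> r n) \<circ> Inr" for n
          by (simp add: r_def comp_def)
        then obtain x where x: "x \<in> ?X" "k x = a \<circ> Inl" by blast
        have lx: "l n x = (a \<circ> r n) \<circ> Inr" for n
        proof -
          obtain y where "y \<in> ?X" "k y = a \<circ> Inl" "l n y = (a \<circ> r n) \<circ> Inr" using ex by blast
          with x k show ?thesis by (metis is_code_eq_iff)
        qed
        have agree: "x \<in> U n \<longleftrightarrow> y \<in> U n"
          if "y \<in> ?X" "case_sum (k y) (l' y) (r n (Inr 0)) = a (r n (Inr 0))" for y n
        proof -
          have "l n y 0 = l n x 0" using that by (simp add: lx r_def l'_def)
          then show ?thesis using l [of n] that x by metis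
        qed
        have "a (Inr 0) = l' x 0"
        proof (cases "a (Inr 0)")
          case 0
          have "x \<notin> U n" for n
          proof -
            obtain y where y: "y \<in> ?X" "l' y 0 = 0" "case_sum (k y) (l' y) (r n (Inr 0)) = a (r n (Inr 0))"
              using a [of "{Inr 0, r n (Inr 0)}"] 0 by auto
            then have "y \<notin> U n" by (auto simp: l'0 split: if_splits)
            with agree y show ?thesis by blast
          qed
          with 0 show ?thesis by (simp add: l'0)
        next
          case (Suc n)
          obtain y where y: "y \<in> ?X" "l' y 0 = Suc n"
            "\<And>m. m \<le> n \<Longrightarrow> case_sum (k y) (l' y) (r m (Inr 0)) = a (r m (Inr 0))"
            using a [of "{Inr 0} \<union> (\<lambda>m. r m (Inr 0)) ` {..n}"] Suc by auto
          from y(2) have yU: "y \<in> (\<Union>n. U n)" and n: "n = (LEAST n. y \<in> U n)"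
            by (auto simp: l'0 split: if_splits)
          have "y \<in> U n" unfolding n using yU by (auto intro: LeastI)
          then have xn: "x \<in> U n" using agree [OF y(1) y(3) [of n]] by simp
          have "(LEAST n. x \<in> U n) = n"
          proof (rule Least_equality [where P = "\<lambda>n. x \<in> U n", OF xn])
            fix m assume m: "x \<in> U m"
            show "n \<le> m"
            proof (rule ccontr)
              assume "\<not> n \<le> m"
              then have "m < n" by simp
              then have "y \<in> U m" using agree [OF y(1) y(3) [of m]] m by simp
              then have "(LEAST n. y \<in> U n) \<le> m" by (rule Least_le)
              with n \<open>m < n\<close> show False by simp
            qed
          qed
          with xn Suc show ?thesis by (auto simp: l'0)
        qed
        then have "a (Inr m) = l' x m" for m
          using lx by (cases m) (auto simp: l'_def r_def)
        with x show "a \<in> (\<lambda>x. case_sum (k x) (l' x)) ` ?X"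
          by (intro image_eqI [where x = x]) (auto simp: fun_eq_iff split: sum.split)
      qed
      show "\<forall>x\<in>?X. x \<in> (\<Union>n. U n) \<longleftrightarrow> l' x 0 \<noteq> 0"
        by (auto simp: l'0)
    qed
    then show ?case by blast
  qed
qed

section \<open>Analytic sets and separation\<close>

text \<open>The projection of a closed set: \<open>b\<close> carries the digits of the point at the
  places \<open>r i\<close> and may carry a witness at the others.\<close>

definition analytic :: "'a measure \<Rightarrow> ('a \<Rightarrow> 'i \<Rightarrow> nat) \<Rightarrow> 'a set \<Rightarrow> bool" where
  "analytic M k A \<longleftrightarrow> (\<exists>(K :: (nat \<Rightarrow> nat) set) r. fclosed K \<and>
     A = {x \<in> space M. \<exists>b\<in>K. \<forall>i. k x i = b (r i)})"

lemma analyticI: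
  fixes K :: "('j::countable \<Rightarrow> nat) set"
  assumes K: "fclosed K" and A: "A = {x \<in> space M. \<exists>b\<in>K. \<forall>i. k x i = b (r i)}"
  shows "analytic M k A"
  unfolding analytic_def
proof (intro exI conjI)
  show "fclosed ((\<lambda>b n. b (from_nat n)) ` K)" by (rule fclosed_to_nat [OF K])
  show "A = {x \<in> space M. \<exists>b\<in>(\<lambda>b n. b (from_nat n)) ` K. \<forall>i. k x i = b ((to_nat \<circ> r) i)}"
    by (auto simp: A)
qed

lemma analytic_INT:
  fixes A :: "nat \<Rightarrow> 'a set" and k :: "'a \<Rightarrow> 'i::countable \<Rightarrow> nat"
  assumes "\<And>n. analytic M k (A n)"
  shows "analytic M k (\<Inter>n. A n)"
proof -
  have "\<forall>n. \<exists>(K :: (nat \<Rightarrow> nat) set) r. fclosed K \<and>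
     A n = {x \<in> space M. \<exists>b\<in>K. \<forall>i. k x i = b (r i)}"
    using assms by (auto simp: analytic_def)
  from choice [OF this] obtain K where "\<forall>n. \<exists>r. fclosed (K n :: (nat \<Rightarrow> nat) set) \<and>
     A n = {x \<in> space M. \<exists>b\<in>K n. \<forall>i. k x i = b (r i)}" ..
  from choice [OF this] obtain r where "\<forall>n. fclosed (K n) \<and>
     A n = {x \<in> space M. \<exists>b\<in>K n. \<forall>i. k x i = b (r n i)}" ..
  then have K: "\<And>n. fclosed (K n)"
    and A: "\<And>n. A n = {x \<in> space M. \<exists>b\<in>K n. \<forall>i. k x i = b (r n i)}"
    by blast+
  \<comment> \<open>The places \<open>Inl i\<close> hold the digits of the point and row
    \<open>n\<close> holds a witness for \<open>A n\<close>. That every row speaks about the same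
    point is a closed condition.\<close>
  define L :: "('i + nat \<times> nat \<Rightarrow> nat) set" where
    "L = (\<Inter>n\<in>UNIV. {b. (\<lambda>i. b (Inr (n, i))) \<in> K n}) \<inter>
         (\<Inter>p\<in>UNIV. {b. b (Inl (snd p)) = b (Inr (fst p, r (fst p) (snd p)))})"
  show ?thesis
  proof (rule analyticI)
    show "fclosed L"
      unfolding L_def
      by (intro fclosed_Int fclosed_INT fclosed_reindex [OF K] fclosed_eq)
    show "(\<Inter>n. A n) = {x \<in> space M. \<exists>b\<in>L. \<forall>i. k x i = b (Inl i)}"
    proof (intro set_eqI iffI)
      fix x assume "x \<in> (\<Inter>n. A n)"
      then have x: "x \<in> space M" and "\<forall>n. \<exists>b\<in>K n. \<forall>i. k x i = b (r n i)"
        by (auto simp: A)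
      then obtain b where b: "\<And>n. b n \<in> K n" "\<And>n i. k x i = b n (r n i)" by metis
      have "case_sum (k x) (\<lambda>(n, i). b n i) \<in> L"
        using b by (auto simp: L_def)
      with x show "x \<in> {x \<in> space M. \<exists>b\<in>L. \<forall>i. k x i = b (Inl i)}"
        by (auto intro!: bexI [where x = "case_sum (k x) (\<lambda>(n, i). b n i)"])
    next
      fix x assume "x \<in> {x \<in> space M. \<exists>b\<in>L. \<forall>i. k x i = b (Inl i)}"
      then obtain b where "x \<in> space M" "b \<in> L" "\<And>i. k x i = b (Inl i)" by auto
      moreover have "(\<lambda>i. b (Inr (n, i))) \<in> K n" "b (Inl i) = b (Inr (n, r n i))" for n i
        using \<open>b \<in> L\<close> by (auto simp: L_def)
      ultimately have "x \<in> space M" "\<exists>b\<in>K n. \<forall>i. k x i = b (r n i)" for n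
        by (auto intro!: bexI [where x = "\<lambda>i. b (Inr (n, i))"])
      then show "x \<in> (\<Inter>n. A n)" by (auto simp: A)
    qed
  qed
qed

lemma is_code_pair:
  assumes k: "is_code M k"
  shows "is_code (M \<Otimes>\<^sub>M M) (\<lambda>p. case_sum (k (fst p)) (k (snd p)))"
    (is "is_code _ ?k")
  unfolding is_code_def
proof (intro conjI)
  note [measurable] = is_code_digit [OF k]
  show "inj_on ?k (space (M \<Otimes>\<^sub>M M))"
  proof (rule inj_onI)
    fix p q assume p: "p \<in> space (M \<Otimes>\<^sub>M M)" "q \<in> space (M \<Otimes>\<^sub>M M)" "?k p = ?k q"
    have "k (fst p) i = k (fst q) i" "k (snd p) i = k (snd q) i" for i
      using fun_cong [OF p(3), of "Inl i"] fun_cong [OF p(3), of "Inr i"] by auto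
    then have "k (fst p) = k (fst q)" "k (snd p) = k (snd q)" by auto
    with p k show "p = q"
      by (auto simp: is_code_eq_iff space_pair_measure prod_eq_iff)
  qed
  show "fclosed (?k ` space (M \<Otimes>\<^sub>M M))"
  proof (rule fclosedI)
    fix a assume "\<And>F. finite F \<Longrightarrow> \<exists>b\<in>?k ` space (M \<Otimes>\<^sub>M M). \<forall>i\<in>F. b i = a i"
    then have a: "\<And>F. finite F \<Longrightarrow> \<exists>p\<in>space (M \<Otimes>\<^sub>M M). \<forall>i\<in>F. ?k p i = a i" by blast
    have "\<exists>x\<in>space M. k x = a \<circ> Inl"
    proof (rule is_code_approx [OF k])
      fix F :: "'b set" assume "finite F"
      then show "\<exists>x\<in>space M. \<forall>i\<in>F. k x i = (a \<circ> Inl) i"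
        using a [of "Inl ` F"] by (auto simp: space_pair_measure)
    qed
    moreover have "\<exists>x\<in>space M. k x = a \<circ> Inr"
    proof (rule is_code_approx [OF k])
      fix F :: "'b set" assume "finite F"
      then show "\<exists>x\<in>space M. \<forall>i\<in>F. k x i = (a \<circ> Inr) i"
        using a [of "Inr ` F"] by (auto simp: space_pair_measure)
    qed
    ultimately obtain x y where "x \<in> space M" "y \<in> space M" "k x = a \<circ> Inl" "k y = a \<circ> Inr"
      by auto
    then show "a \<in> ?k ` space (M \<Otimes>\<^sub>M M)"
      by (intro image_eqI [where x = "(x, y)"])
        (auto simp: fun_eq_iff space_pair_measure split: sum.split)
  qed
  let ?X = "space (M \<Otimes>\<^sub>M M)" and ?E = "{{p \<in> space (M \<Otimes>\<^sub>M M). ?k p i = j} |i j. True}"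
  let ?N = "sigma ?X ?E"
  have E: "?E \<subseteq> Pow ?X" by auto
  have N: "space ?N = ?X" "sets ?N = sigma_sets ?X ?E"
    using E by (auto simp: space_measure_of sets_measure_of)
  show "sets (M \<Otimes>\<^sub>M M) = sigma_sets ?X ?E"
  proof
    have "?E \<subseteq> sets (M \<Otimes>\<^sub>M M)"
    proof clarify
      fix i :: "'b + 'b" and j
      have "{p \<in> ?X. ?k p i = j} = (if \<exists>m. i = Inl m then {p \<in> ?X. k (fst p) (projl i) = j}
              else {p \<in> ?X. k (snd p) (projr i) = j})"
        by (cases i) auto
      also have "\<dots> \<in> sets (M \<Otimes>\<^sub>M M)" by (cases i) simp_all
      finally show "{p \<in> ?X. ?k p i = j} \<in> sets (M \<Otimes>\<^sub>M M)" .
    qed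
    then show "sigma_sets ?X ?E \<subseteq> sets (M \<Otimes>\<^sub>M M)"
      by (rule sets.sigma_sets_subset)
    have digit: "(\<lambda>p. ?k p i) \<in> ?N \<rightarrow>\<^sub>M count_space UNIV" for i
    proof (subst measurable_count_space_eq2_countable, intro conjI ballI)
      fix j :: nat
      have "(\<lambda>p. ?k p i) -` {j} \<inter> space ?N = {p \<in> ?X. ?k p i = j}"
        unfolding N(1) by auto
      then show "(\<lambda>p. ?k p i) -` {j} \<inter> space ?N \<in> sets ?N"
        unfolding N(2) by (auto intro!: sigma_sets.Basic)
    qed auto
    have [measurable]: "fst \<in> ?N \<rightarrow>\<^sub>M M"
    proof (rule measurable_into_code [OF k])
      show "(\<lambda>x. k (fst x) i) \<in> ?N \<rightarrow>\<^sub>M count_space UNIV" for i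
        using digit [of "Inl i"] by simp
    qed (simp only: N(1), simp add: space_pair_measure mem_Times_iff)
    have [measurable]: "snd \<in> ?N \<rightarrow>\<^sub>M M"
    proof (rule measurable_into_code [OF k])
      show "(\<lambda>x. k (snd x) i) \<in> ?N \<rightarrow>\<^sub>M count_space UNIV" for i
        using digit [of "Inr i"] by simp
    qed (simp only: N(1), simp add: space_pair_measure mem_Times_iff)
    \<comment> \<open>Both projections are measurable for the digit algebra \<open>?N\<close>, so
      the product algebra, which they generate, is contained in it.\<close>
    have id: "(\<lambda>p. (fst p, snd p)) \<in> ?N \<rightarrow>\<^sub>M M \<Otimes>\<^sub>M M" by measurable
    show "sets (M \<Otimes>\<^sub>M M) \<subseteq> sigma_sets ?X ?E"
    proof
      fix A assume A: "A \<in> sets (M \<Otimes>\<^sub>M M)"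
      then have "(\<lambda>p. (fst p, snd p)) -` A \<inter> space ?N = A"
        using sets.sets_into_space [OF A] unfolding N(1) by auto
      then show "A \<in> sigma_sets ?X ?E"
        using measurable_sets [OF id A] unfolding N(2) by (simp only:)
    qed
  qed
qed

text \<open>Refining the code of pairs makes \<open>B\<close> clopen, so the pairs in
  \<open>B\<close> correspond to a closed set of digits. The digits of the second component and of
  the refinement become the witness.\<close>

lemma analytic_projection:
  fixes k :: "'a \<Rightarrow> 'i::countable \<Rightarrow> nat"
  assumes k: "is_code M k" and B: "B \<in> sets (M \<Otimes>\<^sub>M M)"
  shows "analytic M k {x \<in> space M. \<exists>y\<in>space M. (x, y) \<in> B}"
proof -
  let ?k = "\<lambda>p. case_sum (k (fst p)) (k (snd p))" and ?X = "space (M \<Otimes>\<^sub>M M)"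
  obtain l where l: "fclosed ((\<lambda>p. case_sum (?k p) (l p)) ` ?X)"
    "\<And>p. p \<in> ?X \<Longrightarrow> p \<in> B \<longleftrightarrow> l p (0::nat) \<noteq> 0"
    using refine_code [OF is_code_pair [OF k] B] by blast
  let ?K = "(\<lambda>p. case_sum (?k p) (l p)) ` ?X \<inter> {b. b (Inr 0) \<noteq> 0}"
  show ?thesis
  proof (rule analyticI)
    show "fclosed ?K"
      by (intro fclosed_Int l(1) fclosed_digit)
    show "{x \<in> space M. \<exists>y\<in>space M. (x, y) \<in> B} =
       {x \<in> space M. \<exists>b\<in>?K. \<forall>i. k x i = b (Inl (Inl i))}"
    proof (intro set_eqI iffI)
      fix x assume "x \<in> {x \<in> space M. \<exists>y\<in>space M. (x, y) \<in> B}"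
      then obtain y where "x \<in> space M" "y \<in> space M" "(x, y) \<in> B" by auto
      then show "x \<in> {x \<in> space M. \<exists>b\<in>?K. \<forall>i. k x i = b (Inl (Inl i))}"
        using l(2) [of "(x, y)"]
        by (auto simp: space_pair_measure intro!: bexI [where x = "case_sum (?k (x, y)) (l (x, y))"])
    next
      fix x assume x: "x \<in> {x \<in> space M. \<exists>b\<in>?K. \<forall>i. k x i = b (Inl (Inl i))}"
      then obtain p where p: "p \<in> ?X" "l p 0 \<noteq> 0" "\<And>i. k x i = k (fst p) i" by auto
      then have "k x = k (fst p)" by auto
      with x p k have "x = fst p"
        by (auto simp: is_code_eq_iff space_pair_measure)
      with p l(2) [of p] show "x \<in> {x \<in> space M. \<exists>y\<in>space M. (x, y) \<in> B}"
        by (cases p) (auto simp: space_pair_measure)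
    qed
  qed
qed

definition separable :: "'a measure \<Rightarrow> 'a set \<Rightarrow> 'a set \<Rightarrow> bool" where
  "separable M P Q \<longleftrightarrow> (\<exists>S\<in>sets M. P \<subseteq> S \<and> S \<inter> Q = {})"

text \<open>Used in the contrapositive: if two countable unions cannot be separated, neither can
  some member of the one from some member of the other.\<close>

lemma separable_UN:
  fixes P Q :: "nat \<Rightarrow> 'a set"
  assumes "\<And>i j. separable M (P i) (Q j)"
  shows "separable M (\<Union>i. P i) (\<Union>j. Q j)"
proof -
  obtain S where S: "\<And>i j. S i j \<in> sets M" "\<And>i j. P i \<subseteq> S i j" "\<And>i j. S i j \<inter> Q j = {}"
    using assms unfolding separable_def by metis
  show ?thesis
    unfolding separable_def
  proof (intro bexI conjI)
    show "(\<Union>i. \<Inter>j. S i j) \<in> sets M" using S(1) by auto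
    show "(\<Union>i. P i) \<subseteq> (\<Union>i. \<Inter>j. S i j)"
      by (intro UN_mono order_refl INT_greatest S(2))
    show "(\<Union>i. \<Inter>j. S i j) \<inter> (\<Union>j. Q j) = {}"
    proof (rule equals0I)
      fix x assume "x \<in> (\<Union>i. \<Inter>j. S i j) \<inter> (\<Union>j. Q j)"
      then obtain i j where "x \<in> S i j \<inter> Q j" by blast
      with S(3) [of i j] show False by simp
    qed
  qed
qed

text \<open>Lusin's theorem. Inseparable sets are split repeatedly by the next digit of their
  witnesses, giving two branches along which the pieces stay inseparable. The branches determine a
  point of \<open>A\<close> and a point of \<open>B\<close>; these differ in some digit, and that
  digit separates the pieces far enough down the branches.\<close>

lemma analytic_separation:
  fixes k :: "'a \<Rightarrow> 'i::countable \<Rightarrow> nat"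
  assumes k: "is_code M k" and "analytic M k A" "analytic M k B" and disj: "A \<inter> B = {}"
  shows "separable M A B"
proof (rule ccontr)
  assume nsep: "\<not> separable M A B"
  define pr where "pr K r n s = {x \<in> space M. \<exists>b\<in>K. (\<forall>i. k x i = b (r i)) \<and> (\<forall>i<n. b i = s i)}"
    for K :: "(nat \<Rightarrow> nat) set" and r :: "'i \<Rightarrow> nat" and n and s :: "nat \<Rightarrow> nat"
  obtain K :: "(nat \<Rightarrow> nat) set" and r where K1: "fclosed K" and A: "A = {x \<in> space M. \<exists>b\<in>K. \<forall>i. k x i = b (r i)}"
    using assms(2) unfolding analytic_def by blast
  obtain K' :: "(nat \<Rightarrow> nat) set" and r' where K2: "fclosed K'" and B: "B = {x \<in> space M. \<exists>b\<in>K'. \<forall>i. k x i = b (r' i)}"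
    using assms(3) unfolding analytic_def by blast
  have "(\<forall>i<Suc n. b i = (s(n := j)) i) \<longleftrightarrow> (\<forall>i<n. b i = s i) \<and> b n = j" for b s :: "nat \<Rightarrow> nat" and n j
    by (auto simp: less_Suc_eq)
  then have split: "pr K r n s = (\<Union>j. pr K r (Suc n) (s(n := j)))" for K r n s
    by (auto simp: pr_def)
  define R where "R n p \<longleftrightarrow> \<not> separable M (pr K r n (fst p)) (pr K' r' n (snd p))" for n p
  have "\<exists>f. \<forall>n. R n (f n) \<and> ((\<forall>i<n. fst (f (Suc n)) i = fst (f n) i) \<and>
      (\<forall>i<n. snd (f (Suc n)) i = snd (f n) i))"
  proof (rule dependent_nat_choice)
    show "\<exists>p. R 0 p"
      using nsep by (intro exI [of _ "(\<lambda>_. 0, \<lambda>_. 0)"]) (simp add: R_def pr_def A B)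
    fix p n assume "R n p"
    then have "\<not> separable M (\<Union>j. pr K r (Suc n) ((fst p)(n := j)))
        (\<Union>j. pr K' r' (Suc n) ((snd p)(n := j)))"
      by (simp add: R_def split [symmetric])
    then obtain i j where "\<not> separable M (pr K r (Suc n) ((fst p)(n := i)))
        (pr K' r' (Suc n) ((snd p)(n := j)))"
      using separable_UN [of M "\<lambda>i. pr K r (Suc n) ((fst p)(n := i))"
          "\<lambda>j. pr K' r' (Suc n) ((snd p)(n := j))"] by blast
    then show "\<exists>q. R (Suc n) q \<and> ((\<forall>i<n. fst q i = fst p i) \<and> (\<forall>i<n. snd q i = snd p i))"
      by (intro exI [of _ "((fst p)(n := i), (snd p)(n := j))"]) (auto simp: R_def)
  qed
  then obtain f where f: "\<And>n. R n (f n)" "\<And>n i. i < n \<Longrightarrow> fst (f (Suc n)) i = fst (f n) i"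
    "\<And>n i. i < n \<Longrightarrow> snd (f (Suc n)) i = snd (f n) i" by blast
  have stab: "g (f n) i = g (f (Suc i)) i"
    if "i < n" "\<And>n i. i < n \<Longrightarrow> g (f (Suc n)) i = g (f n) i" for n i and g :: "_ \<Rightarrow> nat \<Rightarrow> nat"
    using that(1) by (induction n) (auto simp: that(2) less_Suc_eq)
  define a where "a i = fst (f (Suc i)) i" for i
  define a' where "a' i = snd (f (Suc i)) i" for i
  have a: "fst (f n) i = a i" "snd (f n) i = a' i" if "i < n" for n i
    using stab [OF that, of fst] stab [OF that, of snd] f by (auto simp: a_def a'_def)
  have ne: "pr K r n a \<noteq> {}" "pr K' r' n a' \<noteq> {}"
    and ns: "\<not> separable M (pr K r n a) (pr K' r' n a')" for n
  proof -
    have "pr K r n (fst (f n)) = pr K r n a" "pr K' r' n (snd (f n)) = pr K' r' n a'"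
      by (simp_all add: pr_def a)
    then show *: "\<not> separable M (pr K r n a) (pr K' r' n a')"
      using f(1) [of n] by (simp add: R_def)
    \<comment> \<open>An empty piece on this side would be separated by the empty set, and one on
      the other side by the whole space.\<close>
    show "pr K r n a \<noteq> {}"
      using * by (auto simp: separable_def)
    have "pr K r n a \<subseteq> space M" by (auto simp: pr_def)
    then show "pr K' r' n a' \<noteq> {}"
      using * by (auto simp: separable_def)
  qed
  have lim: "\<exists>x\<in>space M. (\<forall>i. k x i = a (r i)) \<and> a \<in> K"
    if cl: "fclosed K" and ne': "\<And>n. pr K r n a \<noteq> {}" for K r a
  proof -
    have ex: "\<exists>x\<in>space M. \<exists>b\<in>K. (\<forall>i. k x i = b (r i)) \<and> (\<forall>i\<in>F. b i = a i)" if fin: "finite F" for F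
    proof -
      obtain n where "F \<subseteq> {..<n}" using fin finite_nat_iff_bounded by blast
      moreover obtain x where "x \<in> pr K r n a" using ne' [of n] by blast
      ultimately show ?thesis unfolding pr_def by blast
    qed
    have "a \<in> K" by (rule fclosedD [OF cl]) (use ex in blast)
    moreover have "\<exists>x\<in>space M. k x = a \<circ> r"
    proof (rule is_code_approx [OF k])
      fix F :: "'i set" assume "finite F"
      then show "\<exists>x\<in>space M. \<forall>i\<in>F. k x i = (a \<circ> r) i"
        using ex [of "r ` F"] by (metis comp_apply finite_imageI imageI)
    qed
    ultimately show ?thesis by (metis comp_apply)
  qed
  obtain x where x: "x \<in> space M" "\<And>i. k x i = a (r i)" "a \<in> K"
    using lim [OF K1 ne(1)] by blast
  obtain y where y: "y \<in> space M" "\<And>i. k y i = a' (r' i)" "a' \<in> K'"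
    using lim [OF K2 ne(2)] by blast
  have "x \<in> A" "y \<in> B" using x y by (auto simp: A B)
  with disj have "x \<noteq> y" by auto
  with x y k have "k x \<noteq> k y" by (simp add: is_code_eq_iff)
  then obtain i where "k x i \<noteq> k y i" by (auto simp: fun_eq_iff)
  then have i: "a (r i) \<noteq> a' (r' i)" by (simp add: x(2) y(2))
  let ?n = "Suc (max (r i) (r' i))"
  have "separable M (pr K r ?n a) (pr K' r' ?n a')"
    unfolding separable_def
  proof (intro bexI conjI)
    show "pr K r ?n a \<subseteq> {z \<in> space M. k z i = a (r i)}"
      by (auto simp: pr_def)
    show "{z \<in> space M. k z i = a (r i)} \<inter> pr K' r' ?n a' = {}"
      using i by (auto simp: pr_def)
    show "{z \<in> space M. k z i = a (r i)} \<in> sets M"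
      using is_code_digit [OF k, of i] by measurable
  qed
  with ns show False by blast
qed

text \<open>Think of every \<open>P j\<close> as open and written as the union over \<open>m\<close>
  of the complements of \<open>P (t j m)\<close>, which are closed. The digit is 0 outside of
  \<open>P j\<close>, and otherwise names the first of these closed sets that contains the
  point.\<close>

definition least_code :: "('i \<Rightarrow> 'a \<Rightarrow> bool) \<Rightarrow> ('i \<Rightarrow> nat \<Rightarrow> 'i) \<Rightarrow> 'a \<Rightarrow> 'i \<Rightarrow> nat" where
  "least_code P t x j = (if P j x then Suc (LEAST m. \<not> P (t j m) x) else 0)"

text \<open>A digit 0 is a closed condition, and the second hypothesis says that these pass to
  limits. A positive digit is certified by a digit 0, that of the closed set which it names.\<close>

lemma fclosed_least_code:
  assumes wit: "\<And>x j. x \<in> X \<Longrightarrow> P j x \<longleftrightarrow> (\<exists>m. \<not> P (t j m) x)"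
    and lim: "\<And>a. (\<And>F. finite F \<Longrightarrow> \<exists>x\<in>X. \<forall>j\<in>F. least_code P t x j = a j) \<Longrightarrow>
      \<exists>x\<in>X. \<forall>j. a j = 0 \<longrightarrow> \<not> P j x"
  shows "fclosed (least_code P t ` X)"
proof (rule fclosedI)
  fix a assume "\<And>F. finite F \<Longrightarrow> \<exists>b\<in>least_code P t ` X. \<forall>i\<in>F. b i = a i"
  then have a: "\<exists>x\<in>X. \<forall>j\<in>F. least_code P t x j = a j" if "finite F" for F
    using that by blast
  then obtain x where x: "x \<in> X" "\<And>j. a j = 0 \<Longrightarrow> \<not> P j x" using lim [of a] by blast
  have least: "\<not> P (t j (LEAST m. \<not> P (t j m) y)) y" if "y \<in> X" "P j y" for y j
    using that wit [OF that(1)] LeastI_ex [of "\<lambda>m. \<not> P (t j m) y"] by blast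
  have P: "P j x \<longleftrightarrow> a j \<noteq> 0" for j
  proof
    assume "P j x" with x show "a j \<noteq> 0" by blast
  next
    assume "a j \<noteq> 0"
    obtain y where y: "y \<in> X" "least_code P t y j = a j"
        "least_code P t y (t j (a j - 1)) = a (t j (a j - 1))"
      using a [of "{j, t j (a j - 1)}"] by auto
    then have "P j y" using \<open>a j \<noteq> 0\<close> by (auto simp: least_code_def split: if_splits)
    moreover have "a j - 1 = (LEAST m. \<not> P (t j m) y)"
      using y \<open>P j y\<close> by (simp add: least_code_def split: if_splits)
    ultimately have "\<not> P (t j (a j - 1)) y" using least [OF y(1)] by simp
    then have "a (t j (a j - 1)) = 0" using y(3) by (simp add: least_code_def)
    then have "\<not> P (t j (a j - 1)) x" by (rule x(2))
    with wit [OF x(1)] show "P j x" by blast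
  qed
  have "least_code P t x j = a j" for j
  proof (cases "a j")
    case 0 then show ?thesis using P by (simp add: least_code_def)
  next
    case (Suc n)
    obtain y where y: "y \<in> X" "least_code P t y j = a j"
        "\<And>m. m \<le> n \<Longrightarrow> least_code P t y (t j m) = a (t j m)"
      using a [of "insert j (t j ` {..n})"] by auto
    have Py: "P (t j m) y \<longleftrightarrow> P (t j m) x" if "m \<le> n" for m
      using y(3) [OF that] by (auto simp: P least_code_def split: if_splits)
    have yj: "P j y" and n: "(LEAST m. \<not> P (t j m) y) = n"
      using y(2) Suc by (auto simp: least_code_def split: if_splits)
    have "(LEAST m. \<not> P (t j m) x) = n"
    proof (rule Least_equality)
      show "\<not> P (t j n) x" using Py [of n] least [OF y(1) yj] n by simp
      fix m assume m: "\<not> P (t j m) x"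
      show "n \<le> m"
      proof (rule ccontr)
        assume "\<not> n \<le> m"
        then have "\<not> P (t j m) y" using Py [of m] m by simp
        then have "(LEAST m. \<not> P (t j m) y) \<le> m" by (rule Least_le)
        with n \<open>\<not> n \<le> m\<close> show False by simp
      qed
    qed
    then show ?thesis using P [of j] Suc by (simp add: least_code_def)
  qed
  then have "a = least_code P t x" by (simp add: fun_eq_iff)
  with x(1) show "a \<in> least_code P t ` X" by blast
qed

text \<open>The digits of the code record the position of \<open>d (q i) x\<close> relative to each rational
  \<open>r\<close>, with a witness for each strict inequality, and indices of points \<open>q i\<close> close to \<open>x\<close>. The
  witnesses make the range of the code closed.\<close>

lemma standard_borel_code:
  assumes "standard_borel M"
  shows "\<exists>k :: 'a \<Rightarrow> nat \<Rightarrow> nat. is_code M k"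
proof (cases "space M = {}")
  case True
  then have "sets M = {{}}" by (metis space_empty_iff)
  moreover have "sigma_sets {} A = {{}}" if "A \<subseteq> {{}}" for A :: "'a set set"
    using that by (metis Pow_empty sigma_sets_empty_eq sigma_sets_into_sp subset_antisym
        sigma_sets.Empty empty_subsetI insert_subset subsetI PowI singletonD)
  ultimately have "is_code M (\<lambda>x n. 0)"
    by (auto simp: is_code_def True fclosed_def)
  then show ?thesis by blast
next
  case False
  obtain T where T: "completely_metrizable_space T" "second_countable T" "topspace T = space M"
    and sets: "sets M = sigma_sets (space M) {U. openin T U}"
    using assms by (auto simp: standard_borel_def)
  obtain X d where "Metric_space X d" and mc: "Metric_space.mcomplete X d"
    and T': "T = Metric_space.mtopology X d"
    using T(1) by (auto simp: completely_metrizable_space_def)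
  interpret Metric_space X d by fact
  have X: "space M = X" using T T' by simp
  obtain C where C: "countable C" "C \<subseteq> X" "mtopology closure_of C = X"
    using second_countable_imp_separable_space [OF T(2)] T' by (auto simp: separable_space_def)
  have "C \<noteq> {}" using C False X by auto
  define q where "q = from_nat_into C"
  have qX: "q i \<in> X" for i
    using from_nat_into [OF \<open>C \<noteq> {}\<close>] C by (auto simp: q_def)
  have dense: "\<exists>i. d (q i) x < r" if xr: "x \<in> X" "r > 0" for x r
  proof -
    have "x \<in> {x \<in> X. \<forall>r>0. \<exists>y\<in>C. y \<in> mball x r}"
      using xr(1) C(3) unfolding metric_closure_of by simp
    then obtain y where "y \<in> C" "d x y < r" using xr(2) by auto
    then show ?thesis
      using from_nat_into_surj [OF C(1), of y] by (metis commute q_def)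
  qed
  \<comment> \<open>The condition \<open>Inl n\<close> holds everywhere; only its digit matters,
    which by the choice of \<open>t\<close> names a point of the dense sequence at distance at most
    1/(n+1).\<close>
  define P :: "nat + bool \<times> nat \<times> rat \<Rightarrow> 'a \<Rightarrow> bool" where
    "P = case_sum (\<lambda>n x. True) (\<lambda>(b, i, r) x. if b then d (q i) x > of_rat r else d (q i) x < of_rat r)"
  define t :: "nat + bool \<times> nat \<times> rat \<Rightarrow> nat \<Rightarrow> nat + bool \<times> nat \<times> rat" where
    "t = case_sum (\<lambda>n m. Inr (True, m, 1 / of_nat (Suc n)))
      (\<lambda>(b, i, r) m. Inr (\<not> b, i, if b then r + 1 / of_nat (Suc m) else r - 1 / of_nat (Suc m)))"
  have P_simps: "P (Inl n) x" "P (Inr (True, i, r)) x \<longleftrightarrow> d (q i) x > of_rat r"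
    "P (Inr (False, i, r)) x \<longleftrightarrow> d (q i) x < of_rat r" for n x i r
    by (simp_all add: P_def)
  have t_simps: "t (Inl n) m = Inr (True, m, 1 / of_nat (Suc n))"
    "t (Inr (True, i, r)) m = Inr (False, i, r + 1 / of_nat (Suc m))"
    "t (Inr (False, i, r)) m = Inr (True, i, r - 1 / of_nat (Suc m))" for n m i r
    by (simp_all add: t_def)
  have rat1: "of_rat (1 / of_nat (Suc n)) = (1 / real (Suc n))" for n
    by (metis of_rat_1 of_rat_divide of_rat_of_nat_eq)
  have Parch: "\<exists>m. 1 / real (Suc m) < e" if "e > 0" for e
    using that nat_approx_posE by blast
  have wit: "P j x \<longleftrightarrow> (\<exists>m. \<not> P (t j m) x)" if "x \<in> X" for x j
  proof -
    consider (l) n where "j = Inl n" | (gt) i r where "j = Inr (True, i, r)"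
      | (lt) i r where "j = Inr (False, i, r)"
      by (metis (full_types) old.prod.exhaust sum.exhaust)
    then show ?thesis
    proof cases
      case l
      then show ?thesis
        using dense [OF that, of "1 / real (Suc n)"]
        by (auto simp: P_simps t_simps rat1 not_less intro: less_imp_le simp del: of_nat_Suc)
    next
      case gt
      have "d (q i) x > of_rat r \<longleftrightarrow> (\<exists>m. of_rat r + 1 / real (Suc m) \<le> d (q i) x)"
      proof
        assume "d (q i) x > of_rat r"
        then obtain m where "1 / real (Suc m) < d (q i) x - of_rat r"
          using Parch [of "d (q i) x - of_rat r"] by auto
        then show "\<exists>m. of_rat r + 1 / real (Suc m) \<le> d (q i) x"
          by (intro exI [of _ m]) linarith
      next
        assume "\<exists>m. of_rat r + 1 / real (Suc m) \<le> d (q i) x"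
        then obtain m where "of_rat r + 1 / real (Suc m) \<le> d (q i) x" ..
        moreover have "1 / real (Suc m) > 0" by simp
        ultimately show "d (q i) x > of_rat r" by linarith
      qed
      then show ?thesis
        by (simp only: gt P_simps t_simps of_rat_add rat1 not_less)
    next
      case lt
      have "d (q i) x < of_rat r \<longleftrightarrow> (\<exists>m. d (q i) x \<le> of_rat r - 1 / real (Suc m))"
      proof
        assume "d (q i) x < of_rat r"
        then obtain m where "1 / real (Suc m) < of_rat r - d (q i) x"
          using Parch [of "of_rat r - d (q i) x"] by auto
        then show "\<exists>m. d (q i) x \<le> of_rat r - 1 / real (Suc m)"
          by (intro exI [of _ m]) linarith
      next
        assume "\<exists>m. d (q i) x \<le> of_rat r - 1 / real (Suc m)"
        then obtain m where "d (q i) x \<le> of_rat r - 1 / real (Suc m)" ..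
        moreover have "1 / real (Suc m) > 0" by simp
        ultimately show "d (q i) x < of_rat r" by linarith
      qed
      then show ?thesis
        by (simp only: lt P_simps t_simps of_rat_diff rat1 not_less)
    qed
  qed
  define k where "k = least_code P t"
  have Pk: "P j x \<longleftrightarrow> k x j \<noteq> 0" for j x by (simp add: k_def least_code_def)
  have lim: "\<exists>x\<in>X. \<forall>j. a j = 0 \<longrightarrow> \<not> P j x"
    if a: "\<And>F. finite F \<Longrightarrow> \<exists>x\<in>X. \<forall>j\<in>F. least_code P t x j = a j" for a
  proof -
    \<comment> \<open>The shift by one in \<open>least_code\<close> is undone. The digits at
      \<open>Inl n\<close> thus name a Cauchy sequence, and its limit is the point sought.\<close>
    define \<sigma> where "\<sigma> n = q (a (Inl n) - 1)" for n
    have near: "d (\<sigma> n) y \<le> 1 / real (Suc n)" if "y \<in> X" "k y (Inl n) = a (Inl n)" for y n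
    proof -
      have "a (Inl n) - 1 = (LEAST m. \<not> P (t (Inl n) m) y)"
        using that by (simp add: k_def least_code_def P_simps flip: that(2))
      then have "\<not> P (t (Inl n) (a (Inl n) - 1)) y"
        using wit [OF that(1), of "Inl n"] LeastI_ex [of "\<lambda>m. \<not> P (t (Inl n) m) y"]
        by (simp add: P_simps)
      then show ?thesis by (simp add: t_simps P_simps rat1 \<sigma>_def not_less del: of_nat_Suc)
    qed
    have \<sigma>X: "\<sigma> n \<in> X" for n by (simp add: \<sigma>_def qX)
    have \<sigma>\<sigma>: "d (\<sigma> n) (\<sigma> m) \<le> 1 / real (Suc n) + 1 / real (Suc m)" for n m
    proof -
      obtain y where y: "y \<in> X" "k y (Inl n) = a (Inl n)" "k y (Inl m) = a (Inl m)"
        using a [of "{Inl n, Inl m}"] by (auto simp: k_def)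
      have "d (\<sigma> n) (\<sigma> m) \<le> d (\<sigma> n) y + d y (\<sigma> m)" by (rule triangle) (use \<sigma>X y in auto)
      with near [OF y(1,2)] near [OF y(1,3)] show ?thesis by (simp add: commute)
    qed
    have "MCauchy \<sigma>"
      unfolding MCauchy_def
    proof (intro conjI allI impI)
      show "range \<sigma> \<subseteq> X" using \<sigma>X by auto
      fix e :: real assume "e > 0"
      then obtain N where N: "1 / real (Suc N) < e / 2" using Parch [of "e / 2"] by auto
      have "d (\<sigma> n) (\<sigma> m) < e" if "N \<le> n" "N \<le> m" for n m
      proof -
        have "1 / real (Suc n) \<le> 1 / real (Suc N)" "1 / real (Suc m) \<le> 1 / real (Suc N)"
          using that by (auto simp: field_simps)
        with \<sigma>\<sigma> [of n m] N show ?thesis by linarith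
      qed
      then show "\<exists>N. \<forall>n n'. N \<le> n \<longrightarrow> N \<le> n' \<longrightarrow> d (\<sigma> n) (\<sigma> n') < e" by blast
    qed
    then obtain x where x: "limitin mtopology \<sigma> x sequentially"
      using mc by (auto simp: mcomplete_def)
    then have xX: "x \<in> X" using limitin_topspace by fastforce
    have close: "\<exists>y\<in>X. k y j = a j \<and> d y x < e" if "e > 0" for e j
    proof -
      have "e / 2 > 0" using that by simp
      then obtain N where N: "\<And>n. n \<ge> N \<Longrightarrow> d (\<sigma> n) x < e / 2"
        using x unfolding limit_metric_sequentially by blast
      obtain n' where n': "1 / real (Suc n') < e / 2" using Parch [OF \<open>e / 2 > 0\<close>] by blast
      define n where "n = max N n'"
      have "1 / real (Suc n) \<le> 1 / real (Suc n')"
        by (auto simp: field_simps n_def)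
      with n' have n: "1 / real (Suc n) < e / 2" by simp
      obtain y where y: "y \<in> X" "k y j = a j" "k y (Inl n) = a (Inl n)"
        using a [of "{j, Inl n}"] by (auto simp: k_def)
      have "d y x \<le> d y (\<sigma> n) + d (\<sigma> n) x" by (rule triangle) (use \<sigma>X y xX in auto)
      moreover have "d (\<sigma> n) x < e / 2" by (rule N) (simp add: n_def)
      ultimately have "d y x < e"
        using near [OF y(1,3)] n by (simp add: commute)
      with y show ?thesis by blast
    qed
    show ?thesis
    proof (intro bexI [OF _ xX] allI impI notI)
      \<comment> \<open>Each \<open>P j\<close> is open: if it held at \<open>x\<close>, it would
        hold at all sufficiently close points, but among these are points whose digit
        \<open>j\<close> is 0.\<close>
      fix j assume j: "a j = 0" "P j x"
      consider (l) n where "j = Inl n" | (gt) i r where "j = Inr (True, i, r)"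
        | (lt) i r where "j = Inr (False, i, r)"
        by (metis (full_types) old.prod.exhaust sum.exhaust)
      then show False
      proof cases
        case l
        obtain y where "y \<in> X" "k y j = a j" using a [of "{j}"] by (auto simp: k_def)
        with l j show False using Pk [of j y] by (simp add: P_simps)
      next
        case gt
        with j obtain y where y: "y \<in> X" "k y j = a j" "d y x < d (q i) x - of_rat r"
          using close [of "d (q i) x - of_rat r" j] by (auto simp: P_simps)
        then have "\<not> P j y" using j Pk by simp
        then have "d (q i) y \<le> of_rat r" by (simp add: gt P_simps)
        moreover have "d (q i) x \<le> d (q i) y + d y x" by (rule triangle) (use qX y xX in auto)
        ultimately show False using y by linarith
      next
        case lt
        with j obtain y where y: "y \<in> X" "k y j = a j" "d y x < of_rat r - d (q i) x"
          using close [of "of_rat r - d (q i) x" j] by (auto simp: P_simps)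
        then have "\<not> P j y" using j Pk by simp
        then have "d (q i) y \<ge> of_rat r" by (simp add: lt P_simps)
        moreover have "d (q i) y \<le> d (q i) x + d x y" by (rule triangle) (use qX y xX in auto)
        ultimately show False using y by (simp add: commute)
      qed
    qed
  qed
  have cl: "fclosed (k ` X)"
    unfolding k_def
  proof (rule fclosed_least_code)
    show "P j x \<longleftrightarrow> (\<exists>m. \<not> P (t j m) x)" if "x \<in> X" for x j
      by (rule wit [OF that])
    show "\<exists>x\<in>X. \<forall>j. a j = 0 \<longrightarrow> \<not> P j x"
      if "\<And>F. finite F \<Longrightarrow> \<exists>x\<in>X. \<forall>j\<in>F. least_code P t x j = a j" for a
      by (rule lim [OF that])
  qed
  have inj: "inj_on k X"
  proof (rule inj_onI, rule ccontr)
    fix x y assume xy: "x \<in> X" "y \<in> X" "k x = k y" "x \<noteq> y"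
    then have "d x y / 2 > 0" by simp
    then obtain i where i: "d (q i) x < d x y / 2" using dense [OF xy(1)] by blast
    have "d x y \<le> d (q i) x + d (q i) y"
      using triangle'' [of x "q i" y] qX xy by (simp add: commute)
    with i have "d (q i) x < d (q i) y" by linarith
    then obtain r where r: "d (q i) x < of_rat r" "of_rat r < d (q i) y"
      using of_rat_dense by blast
    then have "P (Inr (False, i, r)) x" "\<not> P (Inr (False, i, r)) y" by (simp_all add: P_simps)
    with xy show False by (simp add: Pk)
  qed
  have openP: "openin mtopology {x \<in> X. P j x}" for j
  proof -
    consider (l) n where "j = Inl n" | (gt) i r where "j = Inr (True, i, r)"
      | (lt) i r where "j = Inr (False, i, r)"
      by (metis (full_types) old.prod.exhaust sum.exhaust)
    then show ?thesis
    proof cases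
      case l
      then show ?thesis using openin_topspace [of mtopology] by (simp add: P_simps)
    next
      case gt
      have "{x \<in> X. P j x} = topspace mtopology - mcball (q i) (of_rat r)"
        using qX by (auto simp: gt P_simps)
      then show ?thesis using closedin_mcball by (metis closedin_def)
    next
      case lt
      have "{x \<in> X. P j x} = mball (q i) (of_rat r)"
        using qX by (auto simp: lt P_simps)
      then show ?thesis by simp
    qed
  qed
  have [measurable]: "Measurable.pred M (P j)" for j
    using openP [of j] sets T' X by (auto simp: pred_def intro!: sigma_sets.Basic)
  have digit: "(\<lambda>x. k x j) \<in> M \<rightarrow>\<^sub>M count_space UNIV" for j
    unfolding k_def least_code_def by measurable
  have "sets M = sigma_sets X {{x \<in> X. k x j = m} |j m. True}" (is "_ = sigma_sets X ?E")
  proof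
    have "?E \<subseteq> sets M"
    proof clarify
      fix j m
      have "(\<lambda>x. k x j) -` {m} \<inter> space M \<in> sets M"
        by (rule measurable_sets [OF digit]) simp
      also have "(\<lambda>x. k x j) -` {m} \<inter> space M = {x \<in> X. k x j = m}" by (auto simp: X)
      finally show "{x \<in> X. k x j = m} \<in> sets M" .
    qed
    then show "sigma_sets X ?E \<subseteq> sets M"
      using sets.sigma_sets_subset [of ?E M] by (simp add: X)
    have PE: "{x \<in> X. P j x} \<in> sigma_sets X ?E" for j
    proof -
      have "X - {x \<in> X. k x j = 0} \<in> sigma_sets X ?E"
        by (intro sigma_sets.Compl sigma_sets.Basic) blast
      also have "X - {x \<in> X. k x j = 0} = {x \<in> X. P j x}" by (auto simp: Pk)
      finally show ?thesis .
    qed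
    have "U \<in> sigma_sets X ?E" if U: "openin mtopology U" for U
    proof -
      define J where "J = {j. {x \<in> X. P j x} \<subseteq> U}"
      have "U = (\<Union>j\<in>J. {x \<in> X. P j x})"
      proof (intro equalityI subsetI)
        fix x assume "x \<in> U"
        then obtain r where r: "r > 0" "mball x r \<subseteq> U" and xX: "x \<in> X"
          using U unfolding openin_mtopology by blast
        obtain i where i: "d (q i) x < r / 2" using dense [OF xX, of "r / 2"] r by auto
        obtain s where s: "d (q i) x < of_rat s" "of_rat s < r / 2" using of_rat_dense [OF i] by blast
        have "{y \<in> X. P (Inr (False, i, s)) y} \<subseteq> mball x r"
        proof
          fix y assume y: "y \<in> {y \<in> X. P (Inr (False, i, s)) y}"
          have "d x y \<le> d (q i) x + d (q i) y"
            using triangle'' [of x "q i" y] qX xX y by (simp add: commute)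
          with s y xX show "y \<in> mball x r" by (auto simp: P_simps)
        qed
        with r have "Inr (False, i, s) \<in> J" by (auto simp: J_def)
        moreover have "x \<in> {y \<in> X. P (Inr (False, i, s)) y}" using s xX by (simp add: P_simps)
        ultimately show "x \<in> (\<Union>j\<in>J. {x \<in> X. P j x})" by blast
      qed (auto simp: J_def)
      also have "\<dots> \<in> sigma_sets X ?E"
        using PE by (intro sigma_sets_UNION) auto
      finally show ?thesis .
    qed
    then show "sets M \<subseteq> sigma_sets X ?E"
      unfolding sets X T' by (intro sigma_sets_mono) auto
  qed
  with inj cl have "is_code M k" by (simp add: is_code_def X)
  then show ?thesis using is_code_to_nat by blast
qed

section \<open>Neighbours in regular Borel graphs\<close>

definition cylinder :: "'a measure \<Rightarrow> ('a \<Rightarrow> nat \<Rightarrow> nat) \<Rightarrow> nat list \<Rightarrow> 'a set" where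
  "cylinder M k s = {y \<in> space M. map (k y) [0..<length s] = s}"

lemma cylinder_sets:
  fixes k :: "'a \<Rightarrow> nat \<Rightarrow> nat"
  assumes "is_code M k"
  shows "cylinder M k s \<in> sets M"
proof -
  have "map (k y) [0..<length s] = s \<longleftrightarrow> (\<forall>i<length s. k y i = s ! i)" for y
    unfolding list_eq_iff_nth_eq [of "map (k y) [0..<length s]"] by simp
  then have "cylinder M k s = {y \<in> space M. \<forall>i<length s. k y i = s ! i}"
    by (auto simp: cylinder_def)
  also have "\<dots> \<in> sets M"
    using is_code_digit [OF assms] by measurable
  finally show ?thesis .
qed

lemma cylinder_prefix:
  "y \<in> space M \<Longrightarrow> y \<in> cylinder M k (map (k y) [0..<n])"
  by (simp add: cylinder_def)

text \<open>Makes the finitely many neighbours of a vertex lie in disjoint cylinders.\<close>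

lemma inj_on_prefix:
  fixes k :: "'a \<Rightarrow> nat \<Rightarrow> nat"
  assumes k: "is_code M k" and "finite N" "N \<subseteq> space M"
  shows "\<exists>n. inj_on (\<lambda>y. map (k y) [0..<n]) N"
proof -
  have "\<forall>p. \<exists>i. fst p \<in> N \<and> snd p \<in> N \<and> fst p \<noteq> snd p \<longrightarrow> k (fst p) i \<noteq> k (snd p) i"
  proof
    fix p :: "'a \<times> 'a"
    show "\<exists>i. fst p \<in> N \<and> snd p \<in> N \<and> fst p \<noteq> snd p \<longrightarrow> k (fst p) i \<noteq> k (snd p) i"
    proof (cases "fst p \<in> N \<and> snd p \<in> N \<and> fst p \<noteq> snd p")
      case True
      then have "k (fst p) \<noteq> k (snd p)" using is_code_eq_iff [OF k] assms(3) by blast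
      then show ?thesis by (auto simp: fun_eq_iff)
    qed auto
  qed
  from choice [OF this] obtain i where
    i: "\<forall>p. fst p \<in> N \<and> snd p \<in> N \<and> fst p \<noteq> snd p \<longrightarrow> k (fst p) (i p) \<noteq> k (snd p) (i p)" ..
  have "finite (i ` (N \<times> N))" using assms(2) by simp
  then obtain n where n: "\<And>p. p \<in> N \<times> N \<Longrightarrow> i p < n"
    using finite_nat_iff_bounded [of "i ` (N \<times> N)"] by auto
  have "inj_on (\<lambda>y. map (k y) [0..<n]) N"
  proof (rule inj_onI, rule ccontr)
    fix y z assume yz: "y \<in> N" "z \<in> N" "map (k y) [0..<n] = map (k z) [0..<n]" "y \<noteq> z"
    then have "k y (i (y, z)) = k z (i (y, z))" using n [of "(y, z)"] by simp
    with i yz show False by (metis fst_conv snd_conv)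
  qed
  then show ?thesis ..
qed

text \<open>A point with no neighbour in \<open>V\<close> has \<open>m\<close> neighbours in disjoint cylinders minus \<open>V\<close>, and
  conversely. So the complement is a countable union of analytic sets, each of which can be separated
  from the analytic set under consideration.\<close>

lemma regular_preimage_sets:
  fixes k :: "'a \<Rightarrow> nat \<Rightarrow> nat"
  assumes k: "is_code M k" and G: "G \<in> sets (M \<Otimes>\<^sub>M M)" "G \<subseteq> space M \<times> space M"
    and deg: "\<And>x. x \<in> space M \<Longrightarrow> finite {y. (x, y) \<in> G} \<and> card {y. (x, y) \<in> G} = m" and "m > 0"
    and V: "V \<in> sets M"
  shows "{x \<in> space M. \<exists>y\<in>V. (x, y) \<in> G} \<in> sets M"
proof -
  let ?X = "space M"
  define P where "P V = {x \<in> ?X. \<exists>y\<in>V. (x, y) \<in> G}" for V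
  have anP: "analytic M k (P V)" if V: "V \<in> sets M" for V
  proof -
    have "G \<inter> ?X \<times> V \<in> sets (M \<Otimes>\<^sub>M M)" using V G by auto
    moreover have "P V = {x \<in> ?X. \<exists>y\<in>?X. (x, y) \<in> G \<inter> ?X \<times> V}"
      using sets.sets_into_space [OF V] by (auto simp: P_def)
    ultimately show ?thesis using analytic_projection [OF k] by (simp only:)
  qed
  \<comment> \<open>Distinct words of equal length have disjoint cylinders, so neighbours found in
    the \<open>m\<close> cylinders are different and, the degree being \<open>m\<close>, are all the
    neighbours.\<close>
  define good where "good qs \<longleftrightarrow> distinct qs \<and> length qs = m \<and> (\<exists>n. \<forall>q\<in>set qs. length q = n)"
    for qs :: "nat list list"
  \<comment> \<open>Taking indices modulo \<open>m\<close> turns the intersection over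
    \<open>m\<close> words into one over all natural numbers, as in
    \<open>analytic_INT\<close>.\<close>
  define B where "B qs = (\<Inter>n. P (cylinder M k (qs ! (n mod m)) - V))" for qs
  have BP: "B qs \<inter> P V = {}" if good: "good qs" for qs
  proof (rule equals0I)
    fix x assume x: "x \<in> B qs \<inter> P V"
    then have xX: "x \<in> ?X" by (auto simp: P_def)
    have "\<exists>y. y \<in> cylinder M k q - V \<and> (x, y) \<in> G" if q: "q \<in> set qs" for q
    proof -
      obtain n where n: "n < m" "q = qs ! n"
        using q good by (auto simp: in_set_conv_nth good_def)
      then have "qs ! (n mod m) = q" by simp
      then have "x \<in> P (cylinder M k q - V)" using x by (auto simp: B_def)
      then show ?thesis by (auto simp: P_def)
    qed
    then obtain f where f: "\<And>q. q \<in> set qs \<Longrightarrow> f q \<in> cylinder M k q - V \<and> (x, f q) \<in> G" by metis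
    have "inj_on f (set qs)"
    proof (rule inj_onI)
      fix p q assume pq: "p \<in> set qs" "q \<in> set qs" "f p = f q"
      then have "length p = length q" using good unfolding good_def by metis
      with f [OF pq(1)] f [OF pq(2)] pq(3) show "p = q" unfolding cylinder_def by auto
    qed
    then have "card (f ` set qs) = m"
      using good by (simp add: card_image distinct_card good_def)
    moreover have "f ` set qs \<subseteq> {y. (x, y) \<in> G}" using f by blast
    ultimately have "f ` set qs = {y. (x, y) \<in> G}"
      using deg [OF xX] by (intro card_subset_eq) auto
    moreover obtain y where "y \<in> V" "(x, y) \<in> G" using x by (auto simp: P_def)
    ultimately have "y \<in> f ` set qs" by blast
    with f \<open>y \<in> V\<close> show False by blast
  qed
  have "\<forall>qs. \<exists>S. good qs \<longrightarrow> S \<in> sets M \<and> B qs \<subseteq> S \<and> S \<inter> P V = {}"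
  proof
    fix qs
    show "\<exists>S. good qs \<longrightarrow> S \<in> sets M \<and> B qs \<subseteq> S \<and> S \<inter> P V = {}"
    proof (cases "good qs")
      case True
      have "analytic M k (B qs)"
        unfolding B_def by (intro analytic_INT anP sets.Diff cylinder_sets [OF k] V)
      then have "separable M (B qs) (P V)"
        by (rule analytic_separation [OF k _ anP [OF V] BP [OF True]])
      then show ?thesis by (auto simp: separable_def)
    qed auto
  qed
  from choice [OF this] obtain S where
    S: "\<And>qs. good qs \<Longrightarrow> S qs \<in> sets M \<and> B qs \<subseteq> S qs \<and> S qs \<inter> P V = {}" by blast
  define U where "U = (\<Union>qs. if good qs then S qs else {})"
  have "U \<in> sets M" unfolding U_def using S by auto
  moreover have "P V = ?X - U"
  proof (intro equalityI subsetI)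
    fix x assume "x \<in> P V"
    then show "x \<in> ?X - U" using S by (fastforce simp: U_def P_def split: if_splits)
  next
    fix x assume x: "x \<in> ?X - U"
    show "x \<in> P V"
    proof (rule ccontr)
      assume nP: "x \<notin> P V"
      define N where "N = {y. (x, y) \<in> G}"
      have N: "finite N" "card N = m" "N \<subseteq> ?X" using deg x G by (auto simp: N_def)
      obtain n where n: "inj_on (\<lambda>y. map (k y) [0..<n]) N" using inj_on_prefix [OF k N(1,3)] by blast
      obtain qs where qs: "distinct qs" "set qs = (\<lambda>y. map (k y) [0..<n]) ` N"
        using finite_distinct_list [of "(\<lambda>y. map (k y) [0..<n]) ` N"] N by auto
      have len: "length qs = m"
        using distinct_card [OF qs(1)] qs(2) n N by (simp add: card_image)
      have good: "good qs" using qs len by (auto simp: good_def)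
      have "x \<in> P (cylinder M k q - V)" if q: "q \<in> set qs" for q
      proof -
        obtain y where "y \<in> N" "q = map (k y) [0..<n]" using q qs by auto
        then have "y \<in> cylinder M k q" "(x, y) \<in> G" "y \<notin> V"
          using cylinder_prefix [of y M k n] N(3) nP x by (auto simp: N_def P_def)
        then show ?thesis using x by (auto simp: P_def)
      qed
      then have "x \<in> B qs" using len \<open>m > 0\<close> by (auto simp: B_def)
      then have "x \<in> U" using S [OF good] good by (force simp: U_def)
      with x show False by simp
    qed
  qed
  ultimately have "P V \<in> sets M" by auto
  then show ?thesis by (simp add: P_def)
qed

text \<open>Where a cylinder contains exactly one neighbour, that neighbour depends on the point in
  a Borel way, and every neighbour is isolated by some cylinder.\<close>

lemma regular_neighbour_functions:
  fixes k :: "'a \<Rightarrow> nat \<Rightarrow> nat"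
  assumes k: "is_code M k" and G: "G \<in> sets (M \<Otimes>\<^sub>M M)" "G \<subseteq> space M \<times> space M"
    and deg: "\<And>x. x \<in> space M \<Longrightarrow> finite {y. (x, y) \<in> G} \<and> card {y. (x, y) \<in> G} = m" and "m > 0"
  shows "\<exists>h :: nat \<Rightarrow> 'a \<Rightarrow> 'a. (\<forall>s. h s \<in> M \<rightarrow>\<^sub>M M) \<and> (\<forall>x y. (x, y) \<in> G \<longrightarrow> (\<exists>s. h s x = y))"
proof -
  let ?X = "space M"
  define P where "P V = {x \<in> ?X. \<exists>y\<in>V. (x, y) \<in> G}" for V
  have P: "P V \<in> sets M" if "V \<in> sets M" for V
    unfolding P_def by (rule regular_preimage_sets [OF assms that])
  define C where "C = cylinder M k"
  have C: "C s \<in> sets M" for s by (simp add: C_def cylinder_sets [OF k])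
  define Q where "Q s x y \<longleftrightarrow> y \<in> C s \<and> (x, y) \<in> G" for s x y
  \<comment> \<open>Where the neighbour is missing or not unique, the value is \<open>x\<close>
    itself, which keeps the map Borel.\<close>
  define h where "h s x = (if \<exists>!y. Q s x y then THE y. Q s x y else x)" for s x
  have hQ: "Q s x (h s x)" if "\<exists>!y. Q s x y" for s x
    using theI' [OF that] that by (simp add: h_def)
  \<comment> \<open>Uniqueness in terms of preimages: a second neighbour in \<open>C s\<close> would
    be told from the first one by two different words of equal length.\<close>
  define U where "U s = P (C s) -
      (\<Union>p. if length (fst p) = length (snd p) \<and> fst p \<noteq> snd p
        then P (C s \<inter> C (fst p)) \<inter> P (C s \<inter> C (snd p)) else {})" for s
  have Us: "U s \<in> sets M" for s
  proof -
    have "P (C s \<inter> C p) \<inter> P (C s \<inter> C q) \<in> sets M" for p q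
      by (intro sets.Int P C)
    then have "(\<Union>p. if length (fst p) = length (snd p) \<and> fst p \<noteq> snd p
        then P (C s \<inter> C (fst p)) \<inter> P (C s \<inter> C (snd p)) else {}) \<in> sets M"
      by (intro sets.countable_UN image_subsetI) simp
    then show ?thesis unfolding U_def by (rule sets.Diff [OF P [OF C]])
  qed
  have U: "x \<in> U s \<longleftrightarrow> x \<in> ?X \<and> (\<exists>!y. Q s x y)" for x s
  proof (intro iffI conjI)
    assume x: "x \<in> U s"
    then show "x \<in> ?X" by (auto simp: U_def P_def)
    from x obtain y where y: "Q s x y" by (auto simp: U_def P_def Q_def)
    moreover have "z = y" if z: "Q s x z" for z
    proof (rule ccontr)
      assume "z \<noteq> y"
      have yz: "y \<in> ?X" "z \<in> ?X" using y z G by (auto simp: Q_def)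
      then obtain n where n: "inj_on (\<lambda>y. map (k y) [0..<n]) {y, z}"
        using inj_on_prefix [OF k, of "{y, z}"] by auto
      define p where "p = map (k y) [0..<n]"
      define q where "q = map (k z) [0..<n]"
      have "p \<noteq> q" using n \<open>z \<noteq> y\<close> unfolding inj_on_def p_def q_def by blast
      moreover have "x \<in> P (C s \<inter> C p)" "x \<in> P (C s \<inter> C q)"
        using y z yz cylinder_prefix [of _ M k n] \<open>x \<in> ?X\<close>
        by (auto simp: P_def Q_def C_def p_def q_def)
      moreover have "length p = length q" by (simp add: p_def q_def)
      ultimately show False using x unfolding U_def by force
    qed
    ultimately show "\<exists>!y. Q s x y" by blast
  next
    assume x: "x \<in> ?X \<and> (\<exists>!y. Q s x y)"
    then obtain y where y: "Q s x y" "\<And>z. Q s x z \<Longrightarrow> z = y" by blast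
    have "x \<in> P (C s)" using x y by (auto simp: P_def Q_def)
    moreover have "p = q" if "length p = length q" "x \<in> P (C s \<inter> C p)" "x \<in> P (C s \<inter> C q)" for p q
    proof -
      have "y \<in> C p" "y \<in> C q" using that y(2) by (auto simp: P_def Q_def)
      with that(1) show ?thesis unfolding C_def cylinder_def by auto
    qed
    ultimately show "x \<in> U s" by (auto simp: U_def split: if_splits)
  qed
  have hX: "h s x \<in> ?X" if "x \<in> ?X" for s x
    using hQ [of s x] that G by (cases "\<exists>!y. Q s x y") (auto simp: Q_def h_def)
  have meas: "h s \<in> M \<rightarrow>\<^sub>M M" for s
  proof (rule measurableI)
    fix V assume V: "V \<in> sets M"
    have "h s -` V \<inter> ?X = (U s \<inter> P (C s \<inter> V)) \<union> ((?X - U s) \<inter> V)" (is "?L = ?R")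
    proof (intro set_eqI)
      fix x
      show "x \<in> ?L \<longleftrightarrow> x \<in> ?R"
      proof (cases "x \<in> U s")
        case True
        then have x: "x \<in> ?X" and ex: "\<exists>!y. Q s x y" by (auto simp: U)
        have "h s x \<in> V \<longleftrightarrow> x \<in> P (C s \<inter> V)"
        proof
          assume "h s x \<in> V" then show "x \<in> P (C s \<inter> V)"
            using hQ [OF ex] x by (auto simp: P_def Q_def)
        next
          assume "x \<in> P (C s \<inter> V)"
          then obtain y where "Q s x y" "y \<in> V" by (auto simp: P_def Q_def)
          with hQ [OF ex] ex show "h s x \<in> V" by metis
        qed
        with True x show ?thesis by simp
      next
        case False
        then show ?thesis by (auto simp: U h_def)
      qed
    qed
    also have "\<dots> \<in> sets M" using Us V P C by auto
    finally show "h s -` V \<inter> ?X \<in> sets M" .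
  qed (rule hX)
  have ex: "\<exists>s. h s x = y" if xy: "(x, y) \<in> G" for x y
  proof -
    define N where "N = {y. (x, y) \<in> G}"
    have N: "finite N" "N \<subseteq> ?X" "y \<in> N" using deg [of x] xy G by (auto simp: N_def)
    obtain n where n: "inj_on (\<lambda>y. map (k y) [0..<n]) N" using inj_on_prefix [OF k N(1,2)] by blast
    let ?s = "map (k y) [0..<n]"
    have "Q ?s x y" using N xy by (auto simp: Q_def C_def cylinder_prefix)
    moreover have "z = y" if "Q ?s x z" for z
      using that N n by (auto simp: Q_def C_def cylinder_def N_def inj_on_def)
    ultimately have "\<exists>!y. Q ?s x y" by blast
    with hQ [OF this] have "h ?s x = y" using \<open>Q ?s x y\<close> by blast
    then show ?thesis ..
  qed
  have "\<exists>n. h (from_nat n) x = y" if "(x, y) \<in> G" for x y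
    using ex [OF that] by (metis from_nat_to_nat)
  with meas show ?thesis by (intro exI [of _ "\<lambda>n. h (from_nat n)"]) auto
qed

section \<open>The ideal of small sets\<close>

declare split_paired_All [simp del] split_paired_Ex [simp del]

text \<open>The diagonal is Borel because countably many digits separate points.\<close>

lemma code_measurable_eq:
  fixes k :: "'a \<Rightarrow> nat \<Rightarrow> nat"
  assumes code: "is_code M k" and fg [measurable]: "f \<in> N \<rightarrow>\<^sub>M M" "g \<in> N \<rightarrow>\<^sub>M M"
  shows "Measurable.pred N (\<lambda>x. f x = g x)"
proof -
  have eq: "f x = g x \<longleftrightarrow> (\<forall>i. \<exists>j. k (f x) i = j \<and> k (g x) i = j)" if "x \<in> space N" for x
    using is_code_eq_iff [OF code, of "f x" "g x"] that fg [THEN measurable_space]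
    by (auto simp: fun_eq_iff)
  have [measurable]: "(\<lambda>x. k (f x) i) \<in> N \<rightarrow>\<^sub>M count_space UNIV"
    "(\<lambda>x. k (g x) i) \<in> N \<rightarrow>\<^sub>M count_space UNIV" for i
    using fg [THEN measurable_compose, OF is_code_digit [OF code]] by simp_all
  have "Measurable.pred N (\<lambda>x. \<forall>i. \<exists>j. k (f x) i = j \<and> k (g x) i = j)" by measurable
  then show ?thesis by (subst measurable_cong [OF eq])
qed

text \<open>The vertices are charted by \<open>c\<close> on each class of \<open>cl\<close>; \<open>mv p x\<close> moves from \<open>x\<close> by \<open>p\<close> in a
  frame at \<open>x\<close> whose first axis is horizontal in the chart if \<open>hz x\<close>. The charts need not be
  measurable, but the moves are.\<close>

locale borel_frames =
  fixes M :: "'a measure" and k :: "'a \<Rightarrow> nat \<Rightarrow> nat" and cl :: "'a \<Rightarrow> 'c"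
    and c :: "'a \<Rightarrow> int \<times> int" and hz :: "'a \<Rightarrow> bool" and mv :: "int \<times> int \<Rightarrow> 'a \<Rightarrow> 'a"
  assumes code: "is_code M k"
    and mv_measurable [measurable]: "\<And>p. mv p \<in> M \<rightarrow>\<^sub>M M"
    and cl_mv: "\<And>p x. x \<in> space M \<Longrightarrow> cl (mv p x) = cl x"
    and chart_inj: "\<And>x y. x \<in> space M \<Longrightarrow> y \<in> space M \<Longrightarrow> cl x = cl y \<Longrightarrow> c x = c y \<Longrightarrow> x = y"
    and c_mv: "\<And>x. x \<in> space M \<Longrightarrow> \<exists>\<sigma>\<in>{1, -1}. \<exists>\<tau>\<in>{1, -1}. \<forall>p. c (mv p x) =
      (if hz x then (fst (c x) + \<sigma> * fst p, snd (c x) + \<tau> * snd p)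
       else (fst (c x) + \<tau> * snd p, snd (c x) + \<sigma> * fst p))"
begin

lemma mv_in: "x \<in> space M \<Longrightarrow> mv p x \<in> space M"
  using measurable_space [OF mv_measurable] .

lemma ex_mv:
  assumes "x \<in> space M" "y \<in> space M" "cl x = cl y"
  obtains p where "y = mv p x"
proof -
  obtain \<sigma> \<tau> :: int where s: "\<sigma> \<in> {1, -1}" "\<tau> \<in> {1, -1}" "\<And>p. c (mv p x) =
      (if hz x then (fst (c x) + \<sigma> * fst p, snd (c x) + \<tau> * snd p)
       else (fst (c x) + \<tau> * snd p, snd (c x) + \<sigma> * fst p))"
    using c_mv [OF assms(1)] by blast
  define p where "p = (if hz x then (\<sigma> * (fst (c y) - fst (c x)), \<tau> * (snd (c y) - snd (c x)))
     else (\<sigma> * (snd (c y) - snd (c x)), \<tau> * (fst (c y) - fst (c x))))"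
  have "c (mv p x) = c y" using s(1,2) by (auto simp: s(3) p_def prod_eq_iff)
  then have "y = mv p x" using assms by (intro chart_inj) (auto simp: mv_in cl_mv)
  then show ?thesis by (rule that)
qed

lemma mv_diff:
  assumes "x \<in> space M"
  shows "\<bar>fst (c (mv p x)) - fst (c x)\<bar> = (if hz x then \<bar>fst p\<bar> else \<bar>snd p\<bar>)"
    "\<bar>snd (c (mv p x)) - snd (c x)\<bar> = (if hz x then \<bar>snd p\<bar> else \<bar>fst p\<bar>)"
  using c_mv [OF assms] by (auto simp: abs_mult)

lemma mv_0: "x \<in> space M \<Longrightarrow> mv (0, 0) x = x"
  using c_mv [of x] by (intro chart_inj) (auto simp: mv_in cl_mv prod_eq_iff)

lemma measurable_eq [measurable]:
  "f \<in> N \<rightarrow>\<^sub>M M \<Longrightarrow> g \<in> N \<rightarrow>\<^sub>M M \<Longrightarrow> Measurable.pred N (\<lambda>x. f x = g x)"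
  by (rule code_measurable_eq [OF code])

text \<open>The key to measurability: \<open>hz\<close> itself need not be Borel, but its change
  under a move is visible in equations between Borel maps. A unit step along the first axis at
  \<open>mv p x\<close> changes the first coordinate in the frame at \<open>x\<close> precisely if
  the two frames have the same direction.\<close>

lemma hz_eq_iff:
  assumes "x \<in> space M"
  shows "hz (mv p x) = hz x \<longleftrightarrow> mv (1, 0) (mv p x) = mv (fst p + 1, snd p) x \<or>
     mv (1, 0) (mv p x) = mv (fst p - 1, snd p) x"
proof -
  let ?y = "mv p x"
  have y: "?y \<in> space M" using assms by (rule mv_in)
  have eq: "mv (1, 0) ?y = mv q x \<longleftrightarrow> c (mv (1, 0) ?y) = c (mv q x)" for q
    using chart_inj [of "mv (1, 0) ?y" "mv q x"] y assms by (auto simp: mv_in cl_mv)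
  obtain \<sigma> \<tau> :: int where s: "\<sigma> \<in> {1, -1}" "\<tau> \<in> {1, -1}" "\<And>p. c (mv p x) =
      (if hz x then (fst (c x) + \<sigma> * fst p, snd (c x) + \<tau> * snd p)
       else (fst (c x) + \<tau> * snd p, snd (c x) + \<sigma> * fst p))"
    using c_mv [OF assms(1)] by blast
  obtain \<sigma>' \<tau>' :: int where s': "\<sigma>' \<in> {1, -1}" "\<tau>' \<in> {1, -1}" "\<And>p. c (mv p ?y) =
      (if hz ?y then (fst (c ?y) + \<sigma>' * fst p, snd (c ?y) + \<tau>' * snd p)
       else (fst (c ?y) + \<tau>' * snd p, snd (c ?y) + \<sigma>' * fst p))"
    using c_mv [OF y] by blast
  show ?thesis
    unfolding eq s'(3) s(3) using s(1,2) s'(1,2) by (cases "hz ?y"; cases "hz x"; auto simp: algebra_simps)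
qed

lemma hz_measurable [measurable]: "Measurable.pred M (\<lambda>x. hz (mv p x) = hz x)"
proof -
  have "Measurable.pred M (\<lambda>x. mv (1, 0) (mv p x) = mv (fst p + 1, snd p) x \<or>
     mv (1, 0) (mv p x) = mv (fst p - 1, snd p) x)"
    by measurable
  then show ?thesis by (subst measurable_cong [OF hz_eq_iff])
qed

text \<open>A Borel set \<open>B\<close> selects a direction on a class if it consists of the points whose frame has that
  direction.\<close>

definition selects :: "'a set \<Rightarrow> bool \<Rightarrow> 'a \<Rightarrow> bool" where
  "selects B b x \<longleftrightarrow> (\<forall>y\<in>space M. cl y = cl x \<longrightarrow> (y \<in> B \<longleftrightarrow> hz y = b))"

text \<open>The direction \<open>b\<close> may vary with the class. A single \<open>b\<close> for
  all of \<open>A\<close> would tie \<open>B\<close> to the arbitrary charts.\<close>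

definition small :: "'a set \<Rightarrow> bool" where
  "small A \<longleftrightarrow> (\<exists>B\<in>sets M. \<forall>x\<in>A. \<exists>b. selects B b x)"

lemma small_saturation:
  assumes "small A" "\<And>x. x \<in> B \<Longrightarrow> \<exists>y\<in>A. cl y = cl x"
  shows "small B"
  using assms unfolding small_def selects_def by metis

lemma small_subset: "small A \<Longrightarrow> B \<subseteq> A \<Longrightarrow> small B"
  by (rule small_saturation) auto

text \<open>Each class follows the selection \<open>B i\<close> of the first \<open>A i\<close> that
  it meets. Which sets a class meets is decided in a Borel way by searching through all
  moves.\<close>

lemma small_UN:
  fixes A :: "'i::countable \<Rightarrow> 'a set"
  assumes A [measurable]: "\<And>i. A i \<in> sets M" and small: "\<And>i. small (A i)"
  shows "small (\<Union>i. A i)"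
proof -
  have "\<forall>i. \<exists>B. B \<in> sets M \<and> (\<forall>x\<in>A i. \<exists>b. selects B b x)"
    using small unfolding small_def by blast
  from choice [OF this] obtain B where B [measurable]: "\<And>i. B i \<in> sets M"
    and Bc: "\<And>i x. x \<in> A i \<Longrightarrow> \<exists>b. selects (B i) b x"
    by blast
  define S where "S n x \<longleftrightarrow> (\<exists>p. mv p x \<in> A (from_nat n))" for n x
  have S [measurable]: "Measurable.pred M (S n)" for n unfolding S_def by measurable
  have S_eq: "S n x \<longleftrightarrow> (\<exists>z\<in>A (from_nat n). cl z = cl x)" if "x \<in> space M" for n x
  proof
    assume "S n x" then show "\<exists>z\<in>A (from_nat n). cl z = cl x"
      using that cl_mv by (auto simp: S_def)
  next
    assume "\<exists>z\<in>A (from_nat n). cl z = cl x"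
    then obtain z where z: "z \<in> A (from_nat n)" "cl z = cl x" ..
    then have "z \<in> space M" using sets.sets_into_space [OF A] by blast
    with that z obtain p where "z = mv p x" by (metis ex_mv)
    with z show "S n x" by (auto simp: S_def)
  qed
  define C where "C = {x \<in> space M. \<exists>n. S n x \<and> (\<forall>m<n. \<not> S m x) \<and> x \<in> B (from_nat n)}"
  show ?thesis
    unfolding small_def
  proof (intro bexI ballI)
    show "C \<in> sets M" unfolding C_def by measurable
    fix x assume "x \<in> (\<Union>i. A i)"
    then obtain i where i: "x \<in> A i" by blast
    then have x: "x \<in> space M" using sets.sets_into_space [OF A] by blast
    have "S (to_nat i) x" using i by (auto simp: S_eq [OF x])
    then obtain n where n: "S n x" "\<And>m. m < n \<Longrightarrow> \<not> S m x"
      using exists_least_iff [of "\<lambda>n. S n x"] by blast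
    then obtain z where z: "z \<in> A (from_nat n)" "cl z = cl x" by (auto simp: S_eq [OF x])
    then obtain b where b: "selects (B (from_nat n)) b z"
      using Bc by blast
    have "y \<in> C \<longleftrightarrow> hz y = b" if y: "y \<in> space M" "cl y = cl x" for y
    proof -
      have "S m y \<longleftrightarrow> S m x" for m using x y by (simp add: S_eq)
      then have "y \<in> C \<longleftrightarrow> y \<in> B (from_nat n)"
        using n y unfolding C_def by (auto, metis linorder_neqE_nat)
      with b y z show ?thesis by (simp add: selects_def)
    qed
    then show "\<exists>b. selects C b x" by (intro exI [of _ b]) (simp add: selects_def)
  qed
qed

text \<open>On each class that it meets, \<open>A\<close> itself points out the direction to be
  selected, namely that of its own points.\<close>

lemma small_independent:
  assumes A [measurable]: "A \<in> sets M"
    and ind: "\<And>x y. x \<in> A \<Longrightarrow> y \<in> A \<Longrightarrow> cl x = cl y \<Longrightarrow> hz x = hz y"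
  shows "small A"
  unfolding small_def
proof (intro bexI ballI)
  let ?B = "{y \<in> space M. \<exists>p. mv p y \<in> A \<and> hz (mv p y) = hz y}"
  show "?B \<in> sets M" by measurable
  fix x assume x: "x \<in> A"
  then have xX: "x \<in> space M" using sets.sets_into_space [OF A] by blast
  have *: "y \<in> ?B \<longleftrightarrow> hz y = hz x" if y: "y \<in> space M" "cl y = cl x" for y
  proof
    assume "y \<in> ?B"
    then obtain p where p: "mv p y \<in> A" "hz (mv p y) = hz y" by blast
    then show "hz y = hz x" using ind [of "mv p y" x] x y by (simp add: cl_mv)
  next
    assume "hz y = hz x"
    moreover obtain p where "x = mv p y" using ex_mv [OF y(1) xX y(2)] .
    ultimately show "y \<in> ?B" using x y by auto
  qed
  show "\<exists>b. selects ?B b x"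
    unfolding selects_def by (intro exI [of _ "hz x"] ballI impI *)
qed

end

section \<open>Sets whose points of different directions are aligned\<close>

definition spread_bounded :: "('b \<Rightarrow> int) \<Rightarrow> 'b set \<Rightarrow> bool" where
  "spread_bounded f S \<longleftrightarrow> (\<exists>N. \<forall>s\<in>S. \<forall>t\<in>S. \<bar>f s - f t\<bar> \<le> N)"

lemma spread_bounded_Un:
  assumes "spread_bounded f S" "spread_bounded f T"
  shows "spread_bounded f (S \<union> T)"
proof (cases "S = {} \<or> T = {}")
  case False
  then obtain s t where st: "s \<in> S" "t \<in> T" by blast
  obtain N where N: "\<And>a b. a \<in> S \<Longrightarrow> b \<in> S \<Longrightarrow> \<bar>f a - f b\<bar> \<le> N"
    using assms(1) unfolding spread_bounded_def by blast
  obtain N' where N': "\<And>a b. a \<in> T \<Longrightarrow> b \<in> T \<Longrightarrow> \<bar>f a - f b\<bar> \<le> N'"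
    using assms(2) unfolding spread_bounded_def by blast
  have "\<bar>f a - f s\<bar> \<le> \<bar>f s - f t\<bar> + N + N'" if "a \<in> S \<union> T" for a
    using that N [of a s] N' [of a t] N [of s s] N' [of t t] st by auto
  then have "\<bar>f a - f b\<bar> \<le> 2 * (\<bar>f s - f t\<bar> + N + N')" if "a \<in> S \<union> T" "b \<in> S \<union> T" for a b
    using that by (smt (verit, best))
  then show ?thesis unfolding spread_bounded_def by blast
qed (use assms in auto)

text \<open>If every point of \<open>H\<close> is aligned with every point of \<open>V\<close> up to \<open>D\<close>, two points of \<open>H\<close> that
  are far apart in one coordinate confine \<open>V\<close> to two strips.\<close>

lemma aligned_spread_bounded:
  assumes al: "\<And>h v. h \<in> H \<Longrightarrow> v \<in> V \<Longrightarrow> \<bar>f h - f v\<bar> \<le> D \<or> \<bar>g h - g v\<bar> \<le> (D :: int)"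
    and "\<not> spread_bounded f H"
  shows "spread_bounded g V"
proof -
  obtain h h' where h: "h \<in> H" "h' \<in> H" "\<bar>f h - f h'\<bar> > 2 * D"
    using assms(2) unfolding spread_bounded_def by (meson not_le)
  have "\<bar>g v - g h\<bar> \<le> \<bar>D\<bar> + \<bar>g h - g h'\<bar>" if "v \<in> V" for v
    using al [OF h(1) that] al [OF h(2) that] h(3) by linarith
  then have "\<bar>g v - g w\<bar> \<le> 2 * (\<bar>D\<bar> + \<bar>g h - g h'\<bar>)" if "v \<in> V" "w \<in> V" for v w
    using that by (smt (verit, best))
  then show ?thesis unfolding spread_bounded_def by blast
qed

context borel_frames
begin

text \<open>Some cylinder isolates each point from the finitely many others of \<open>Q\<close> in
  its class. The points isolated by a fixed cylinder are at most one per class, hence trivially of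
  one direction there.\<close>

lemma small_finite_on_classes:
  assumes Q [measurable]: "Q \<in> sets M" and fin: "\<And>x. x \<in> Q \<Longrightarrow> finite {y \<in> Q. cl y = cl x}"
  shows "small Q"
proof -
  note QX = sets.sets_into_space [OF Q]
  define R where "R s = {x \<in> Q \<inter> cylinder M k s. \<forall>p. mv p x \<in> Q \<inter> cylinder M k s \<longrightarrow> mv p x = x}" for s
  note [measurable] = cylinder_sets [OF code]
  have R: "R s \<in> sets M" for s
  proof -
    have "R s = {x \<in> space M. x \<in> Q \<inter> cylinder M k s \<and> (\<forall>p. mv p x \<in> Q \<inter> cylinder M k s \<longrightarrow> mv p x = x)}"
      using QX by (auto simp: R_def)
    also have "\<dots> \<in> sets M" by measurable
    finally show ?thesis .
  qed
  have "small (R s)" for s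
  proof (rule small_independent [OF R])
    fix x y assume xy: "x \<in> R s" "y \<in> R s" "cl x = cl y"
    then have "x \<in> space M" "y \<in> space M" using QX by (auto simp: R_def)
    then obtain p where "y = mv p x" using ex_mv xy(3) by metis
    with xy have "y = x" by (auto simp: R_def)
    then show "hz x = hz y" by simp
  qed
  then have "small (\<Union>s. R s)" using R by (intro small_UN) auto
  moreover have "Q \<subseteq> (\<Union>s. R s)"
  proof
    fix x assume x: "x \<in> Q"
    let ?N = "{y \<in> Q. cl y = cl x}"
    obtain n where n: "inj_on (\<lambda>y. map (k y) [0..<n]) ?N"
      using inj_on_prefix [OF code fin [OF x]] QX by blast
    let ?s = "map (k x) [0..<n]"
    have "mv p x = x" if p: "mv p x \<in> Q \<inter> cylinder M k ?s" for p
    proof -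
      have "map (k (mv p x)) [0..<n] = map (k x) [0..<n]"
        using p by (simp add: cylinder_def)
      moreover have "mv p x \<in> ?N" "x \<in> ?N" using p x QX cl_mv [of x p] by auto
      ultimately show ?thesis using n by (meson inj_onD)
    qed
    then have "x \<in> R ?s" using x QX by (auto simp: R_def cylinder_prefix)
    then show "x \<in> (\<Union>s. R s)" by blast
  qed
  ultimately show ?thesis by (rule small_subset)
qed

text \<open>If on some class the points of \<open>A\<close> have both directions, either one of these directions occurs
  only finitely often, or all points lie in a strip, whose direction can be selected.\<close>

lemma small_aligned:
  assumes A [measurable]: "A \<in> sets M"
    and al: "\<And>x y. x \<in> A \<Longrightarrow> y \<in> A \<Longrightarrow> cl x = cl y \<Longrightarrow> hz x \<noteq> hz y \<Longrightarrow>
      \<bar>fst (c x) - fst (c y)\<bar> \<le> D \<or> \<bar>snd (c x) - snd (c y)\<bar> \<le> D"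
  shows "small A"
proof -
  note AX = sets.sets_into_space [OF A]
  define A1 where "A1 = {x \<in> space M. x \<in> A \<and> (\<forall>p. mv p x \<in> A \<longrightarrow> hz (mv p x) = hz x)}"
  \<comment> \<open>Bounded moves between points of the same direction: a Borel way of saying that
    this direction occurs only finitely often on the class.\<close>
  define Q where "Q = {x \<in> space M. x \<in> A \<and>
    (\<exists>N. \<forall>p. mv p x \<in> A \<and> hz (mv p x) = hz x \<longrightarrow> \<bar>fst p\<bar> \<le> N \<and> \<bar>snd p\<bar> \<le> N)}"
  define A3 where "A3 = {x \<in> space M. x \<in> A \<and> x \<notin> A1 \<and> (\<forall>p. mv p x \<notin> Q)}"
  have [measurable]: "A1 \<in> sets M" unfolding A1_def by measurable
  have [measurable]: "Q \<in> sets M" unfolding Q_def by measurable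
  have [measurable]: "A3 \<in> sets M" unfolding A3_def by measurable
  have mvA: "\<exists>p. y = mv p x" if "x \<in> A" "y \<in> A" "cl y = cl x" for x y
    using ex_mv [of x y] that AX by (metis subsetD)
  have "small A1"
  proof (rule small_independent)
    fix x y assume xy: "x \<in> A1" "y \<in> A1" "cl x = cl y"
    then obtain p where "y = mv p x" using mvA [of x y] by (auto simp: A1_def)
    with xy show "hz x = hz y" by (auto simp: A1_def)
  qed measurable
  moreover have "small Q"
  proof (rule small_finite_on_classes)
    have fin: "finite {y \<in> Q. cl y = cl x \<and> hz y = hz x}" if x: "x \<in> Q" for x
    proof -
      obtain N where N: "\<And>p. mv p x \<in> A \<Longrightarrow> hz (mv p x) = hz x \<Longrightarrow> \<bar>fst p\<bar> \<le> N \<and> \<bar>snd p\<bar> \<le> N"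
        using x unfolding Q_def by blast
      have "{y \<in> Q. cl y = cl x \<and> hz y = hz x} \<subseteq> (\<lambda>p. mv p x) ` ({-N..N} \<times> {-N..N})"
      proof
        fix y assume y: "y \<in> {y \<in> Q. cl y = cl x \<and> hz y = hz x}"
        then obtain p where p: "y = mv p x" using mvA [of x y] x by (auto simp: Q_def)
        then have "\<bar>fst p\<bar> \<le> N \<and> \<bar>snd p\<bar> \<le> N" using N [of p] y by (auto simp: Q_def)
        then have "p \<in> {-N..N} \<times> {-N..N}" by (auto simp: mem_Times_iff)
        with p show "y \<in> (\<lambda>p. mv p x) ` ({-N..N} \<times> {-N..N})" by blast
      qed
      then show ?thesis by (rule finite_subset) auto
    qed
    have fin': "finite {y \<in> Q. cl y = cl x \<and> hz y = b}" for x b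
    proof (cases "{y \<in> Q. cl y = cl x \<and> hz y = b} = {}")
      case False
      then obtain z where "z \<in> Q" "cl z = cl x" "hz z = b" by blast
      with fin [of z] show ?thesis by simp
    next
      case True
      then show ?thesis by (simp only: finite.emptyI)
    qed
    fix x assume "x \<in> Q"
    have "{y \<in> Q. cl y = cl x} = {y \<in> Q. cl y = cl x \<and> hz y = True} \<union> {y \<in> Q. cl y = cl x \<and> hz y = False}"
      by blast
    then show "finite {y \<in> Q. cl y = cl x}" using fin' by (simp only: finite_Un)
  qed measurable
  moreover have "small A3"
    unfolding small_def
  proof (intro bexI ballI)
    \<comment> \<open>The bound is on moves across the first axis, so \<open>y\<close> belongs to
      this set iff the points of \<open>A\<close> in its class lie in a strip that runs in the
      direction of the frame at \<open>y\<close>.\<close>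
    let ?B = "{y \<in> space M. \<exists>N. \<forall>p. mv p y \<in> A \<longrightarrow> \<bar>snd p\<bar> \<le> (N :: int)}"
    show "?B \<in> sets M" by measurable
    fix x assume x: "x \<in> A3"
    then have xA: "x \<in> A" "x \<in> space M" by (auto simp: A3_def)
    define S where "S b = {y \<in> A. cl y = cl x \<and> hz y = b}" for b
    have al': "\<bar>fst (c y) - fst (c z)\<bar> \<le> D \<or> \<bar>snd (c y) - snd (c z)\<bar> \<le> D"
      "\<bar>snd (c y) - snd (c z)\<bar> \<le> D \<or> \<bar>fst (c y) - fst (c z)\<bar> \<le> D"
      if "y \<in> S b" "z \<in> S (\<not> b)" for y z b
      using al [of y z] that by (auto simp: S_def)
    have ne: "S b \<noteq> {}" for b
    proof -
      obtain p where "mv p x \<in> A" "hz (mv p x) \<noteq> hz x" using x by (auto simp: A3_def A1_def)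
      then have "x \<in> S (hz x)" "mv p x \<in> S (\<not> hz x)" using xA cl_mv by (auto simp: S_def)
      then show ?thesis by (cases "b = hz x") auto
    qed
    \<comment> \<open>If it were bounded in both coordinates, a direction would occur only in a box,
      and its points would be in \<open>Q\<close>, which the classes of \<open>A3\<close>
      avoid.\<close>
    have unb: "\<not> (spread_bounded (fst \<circ> c) (S b) \<and> spread_bounded (snd \<circ> c) (S b))" for b
    proof
      assume "spread_bounded (fst \<circ> c) (S b) \<and> spread_bounded (snd \<circ> c) (S b)"
      then obtain N N' where N: "\<And>y z. y \<in> S b \<Longrightarrow> z \<in> S b \<Longrightarrow> \<bar>fst (c y) - fst (c z)\<bar> \<le> N"
        "\<And>y z. y \<in> S b \<Longrightarrow> z \<in> S b \<Longrightarrow> \<bar>snd (c y) - snd (c z)\<bar> \<le> N'"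
        unfolding spread_bounded_def comp_def by blast
      obtain y where y: "y \<in> S b" using ne by blast
      then have yX: "y \<in> space M" "y \<in> A" "cl y = cl x" using AX by (auto simp: S_def)
      have "\<bar>fst p\<bar> \<le> max N N' \<and> \<bar>snd p\<bar> \<le> max N N'" if "mv p y \<in> A" "hz (mv p y) = hz y" for p
      proof -
        have "mv p y \<in> S b" using that y yX cl_mv by (auto simp: S_def)
        then show ?thesis using N [of "mv p y" y] y mv_diff [OF yX(1), of p] by (auto split: if_splits)
      qed
      then have "y \<in> Q" using yX unfolding Q_def by blast
      moreover obtain p where "y = mv p x" using mvA [OF xA(1) yX(2,3)] ..
      ultimately show False using x by (auto simp: A3_def)
    qed
    have opp: "spread_bounded (snd \<circ> c) (S (\<not> b))" if "\<not> spread_bounded (fst \<circ> c) (S b)" for b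
      by (rule aligned_spread_bounded [OF _ that, where D = D]) (use al' in auto)
    have opp': "spread_bounded (fst \<circ> c) (S (\<not> b))" if "\<not> spread_bounded (snd \<circ> c) (S b)" for b
      by (rule aligned_spread_bounded [OF _ that, where D = D]) (use al' in auto)
    define AC where "AC = {y \<in> A. cl y = cl x}"
    have AC: "AC = S True \<union> S False" by (auto simp: AC_def S_def)
    have xAC: "x \<in> AC" using xA by (simp add: AC_def)
    have B: "y \<in> ?B \<longleftrightarrow> spread_bounded (if hz y then snd \<circ> c else fst \<circ> c) AC"
      if y: "y \<in> space M" "cl y = cl x" for y
    proof -
      let ?f = "if hz y then snd \<circ> c else fst \<circ> c"
      have f: "\<bar>?f (mv p y) - ?f y\<bar> = \<bar>snd p\<bar>" for p using mv_diff [OF y(1), of p] by auto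
      have inAC: "mv p y \<in> AC \<longleftrightarrow> mv p y \<in> A" for p using y cl_mv by (simp add: AC_def)
      have exp: "\<exists>p. z = mv p y" if "z \<in> AC" for z
        using that ex_mv [of y z] y AX by (metis (mono_tags, lifting) AC_def mem_Collect_eq subsetD)
      show ?thesis
      proof
        assume "y \<in> ?B"
        then obtain N where N: "\<And>p. mv p y \<in> A \<Longrightarrow> \<bar>snd p\<bar> \<le> N" by blast
        have "\<bar>?f z - ?f y\<bar> \<le> N" if "z \<in> AC" for z
          using exp [OF that] that N inAC f by metis
        then have "\<bar>?f z - ?f w\<bar> \<le> 2 * N" if "z \<in> AC" "w \<in> AC" for z w
          using that by (smt (verit, best))
        then show "spread_bounded ?f AC" unfolding spread_bounded_def by blast
      next
        assume "spread_bounded ?f AC"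
        then obtain N where N: "\<And>z w. z \<in> AC \<Longrightarrow> w \<in> AC \<Longrightarrow> \<bar>?f z - ?f w\<bar> \<le> N"
          unfolding spread_bounded_def by blast
        have "\<bar>snd p\<bar> \<le> N + \<bar>?f x - ?f y\<bar>" if "mv p y \<in> A" for p
          using N [of "mv p y" x] xAC inAC [of p] that f [of p] by linarith
        then show "y \<in> ?B" using y by blast
      qed
    qed
    show "\<exists>b. selects ?B b x"
    proof (cases "spread_bounded (fst \<circ> c) (S True)")
      \<comment> \<open>Unboundedness propagates: \<open>S True\<close>, unbounded in the first
        coordinate, confines \<open>S False\<close> in the second, so \<open>S False\<close> is
        unbounded in the first and confines \<open>S True\<close> in turn. All points of
        \<open>A\<close> in the class lie in a horizontal strip.\<close>
      case False
      then have "spread_bounded (snd \<circ> c) (S False)" using opp by fastforce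
      moreover from this have "\<not> spread_bounded (fst \<circ> c) (S False)" using unb by blast
      then have "spread_bounded (snd \<circ> c) (S True)" using opp by fastforce
      ultimately have "spread_bounded (snd \<circ> c) AC" unfolding AC by (intro spread_bounded_Un)
      moreover have "\<not> spread_bounded (fst \<circ> c) AC"
        using False unfolding AC spread_bounded_def by blast
      ultimately have *: "y \<in> ?B \<longleftrightarrow> hz y = True" if "y \<in> space M" "cl y = cl x" for y
        using B [OF that] by simp
      show ?thesis unfolding selects_def by (intro exI [of _ True] ballI impI *)
    next
      case True
      then have nb: "\<not> spread_bounded (snd \<circ> c) (S True)" using unb by blast
      then have "spread_bounded (fst \<circ> c) (S False)" using opp' by fastforce
      with True have "spread_bounded (fst \<circ> c) AC" unfolding AC by (intro spread_bounded_Un)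
      moreover have "\<not> spread_bounded (snd \<circ> c) AC"
        using nb unfolding AC spread_bounded_def by blast
      ultimately have *: "y \<in> ?B \<longleftrightarrow> hz y = False" if "y \<in> space M" "cl y = cl x" for y
        using B [OF that] by simp
      show ?thesis unfolding selects_def by (intro exI [of _ False] ballI impI *)
    qed
  qed
  ultimately have "small (\<Union>i::nat. case_nat A1 (case_nat Q (\<lambda>_. A3)) i)"
    by (intro small_UN) (auto split: nat.split)
  moreover have "A1 \<union> Q \<union> A3 = (\<Union>i. case_nat A1 (case_nat Q (\<lambda>_. A3)) i)"
  proof (intro equalityI subsetI)
    fix x assume "x \<in> A1 \<union> Q \<union> A3"
    then have "x \<in> case_nat A1 (case_nat Q (\<lambda>_. A3)) 0 \<or> x \<in> case_nat A1 (case_nat Q (\<lambda>_. A3)) 1 \<or>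
        x \<in> case_nat A1 (case_nat Q (\<lambda>_. A3)) 2"
      by auto
    then show "x \<in> (\<Union>i. case_nat A1 (case_nat Q (\<lambda>_. A3)) i)" by blast
  next
    fix x assume "x \<in> (\<Union>i. case_nat A1 (case_nat Q (\<lambda>_. A3)) i)"
    then obtain i where i: "x \<in> case_nat A1 (case_nat Q (\<lambda>_. A3)) i" by blast
    consider "i = 0" | "i = 1" | j where "i = Suc (Suc j)" by (metis One_nat_def not0_implies_Suc)
    then show "x \<in> A1 \<union> Q \<union> A3" using i by cases simp_all
  qed
  ultimately have "small (A1 \<union> Q \<union> A3)" by simp
  then show ?thesis
  proof (rule small_saturation)
    fix x assume x: "x \<in> A"
    then have xX: "x \<in> space M" using AX by blast
    consider "x \<in> A1" | "\<exists>p. mv p x \<in> Q" | "x \<in> A3"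
      using x xX unfolding A3_def by blast
    then show "\<exists>y\<in>A1 \<union> Q \<union> A3. cl y = cl x"
      using cl_mv [OF xX] by cases blast+
  qed
qed

text \<open>If all these sets were small, so would be their union over the moves. On the classes
  that miss the union, points of \<open>A\<close> with different directions are never far apart in
  both coordinates, and \<open>small_aligned\<close> applies.\<close>

lemma not_small_extend:
  assumes A [measurable]: "A \<in> sets M" and ns: "\<not> small A"
  shows "\<exists>p. D < \<bar>fst p\<bar> \<and> D < \<bar>snd p\<bar> \<and>
    \<not> small {x \<in> space M. x \<in> A \<and> mv p x \<in> A \<and> hz (mv p x) \<noteq> hz x}"
proof (rule ccontr)
  assume neg: "\<not> ?thesis"
  define A' where "A' p = (if D < \<bar>fst p\<bar> \<and> D < \<bar>snd p\<bar> then
      {x \<in> space M. x \<in> A \<and> mv p x \<in> A \<and> hz (mv p x) \<noteq> hz x} else {})" for p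
  have "{x \<in> space M. x \<in> A \<and> mv p x \<in> A \<and> hz (mv p x) \<noteq> hz x} \<in> sets M" for p
    by measurable
  then have [measurable]: "A' p \<in> sets M" for p by (simp add: A'_def)
  have "small {}" by (auto simp: small_def)
  then have "small (A' p)" for p using neg by (auto simp: A'_def)
  then have sN: "small (\<Union>p. A' p)" by (intro small_UN) auto
  define R where "R = {x \<in> space M. x \<in> A \<and> (\<forall>p q. mv p x \<notin> A' q)}"
  have [measurable]: "R \<in> sets M" unfolding R_def by measurable
  have "small R"
  proof (rule small_aligned)
    fix x y assume xy: "x \<in> R" "y \<in> R" "cl x = cl y" "hz x \<noteq> hz y"
    then have X: "x \<in> space M" "y \<in> space M" by (auto simp: R_def)
    obtain p where p: "y = mv p x" using ex_mv [OF X xy(3)] .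
    \<comment> \<open>\<open>R\<close> avoids the sets \<open>A' q\<close> along whole classes; the
      trivial move gives the statement at \<open>x\<close> itself.\<close>
    have "mv (0, 0) x \<notin> A' p" using xy by (auto simp: R_def)
    then have "\<not> (D < \<bar>fst p\<bar> \<and> D < \<bar>snd p\<bar>)"
      using xy X p by (auto simp: mv_0 A'_def R_def)
    then show "\<bar>fst (c x) - fst (c y)\<bar> \<le> D \<or> \<bar>snd (c x) - snd (c y)\<bar> \<le> D"
      using mv_diff [OF X(1), of p] p by (auto simp: abs_minus_commute split: if_splits)
  qed measurable
  with sN have "small (\<Union>i. if i then R else (\<Union>p. A' p))"
    by (intro small_UN) auto
  then have "small A"
  proof (rule small_saturation)
    fix x assume x: "x \<in> A"
    then have xX: "x \<in> space M" using sets.sets_into_space [OF A] by blast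
    show "\<exists>y\<in>(\<Union>i. if i then R else (\<Union>p. A' p)). cl y = cl x"
    proof (cases "x \<in> R")
      case True
      then show ?thesis by (auto intro: bexI [of _ x])
    next
      case False
      then obtain p q where "mv p x \<in> A' q" using x xX by (auto simp: R_def)
      then show ?thesis using cl_mv [OF xX, of p] by (auto intro!: bexI [of _ "mv p x"] exI [of _ q])
    qed
  qed
  with ns show False by simp
qed

end

section \<open>Fusion\<close>

text \<open>All refinements extend the same code \<open>k\<close>, which determines the point. Hence
  the limits found for the single sets \<open>U n\<close> coincide and the refinements can be
  joined.\<close>

lemma refine_code_family:
  fixes k :: "'a \<Rightarrow> nat \<Rightarrow> nat" and U :: "nat \<Rightarrow> 'a set"
  assumes k: "is_code M k" and U: "\<And>n. U n \<in> sets M"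
  shows "\<exists>k' :: 'a \<Rightarrow> nat \<Rightarrow> nat. is_code M k' \<and> (\<forall>n. \<exists>i. \<forall>x\<in>space M. k' x i = k x n) \<and>
    (\<forall>n. \<exists>i. \<forall>x\<in>space M. x \<in> U n \<longleftrightarrow> k' x i \<noteq> 0)"
proof -
  let ?X = "space M"
  have "\<forall>n. \<exists>l :: 'a \<Rightarrow> nat \<Rightarrow> nat. (\<forall>i. (\<lambda>x. l x i) \<in> M \<rightarrow>\<^sub>M count_space UNIV) \<and>
    fclosed ((\<lambda>x. case_sum (k x) (l x)) ` ?X) \<and> (\<forall>x\<in>?X. x \<in> U n \<longleftrightarrow> l x 0 \<noteq> 0)"
    using refine_code [OF k U] by blast
  from choice [OF this] obtain l :: "nat \<Rightarrow> 'a \<Rightarrow> nat \<Rightarrow> nat" where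
    lm: "\<And>n i. (\<lambda>x. l n x i) \<in> M \<rightarrow>\<^sub>M count_space UNIV"
    and lc: "\<And>n. fclosed ((\<lambda>x. case_sum (k x) (l n x)) ` ?X)"
    and lU: "\<And>n x. x \<in> ?X \<Longrightarrow> x \<in> U n \<longleftrightarrow> l n x 0 \<noteq> 0" by blast
  define K where "K x = case_sum (k x) (\<lambda>p. l (fst p) x (snd p))" for x
  have KI: "K x (Inl i) = k x i" "K x (Inr (n, i)) = l n x i" for x i n by (simp_all add: K_def)
  have "is_code M K"
    unfolding is_code_def
  proof (intro conjI)
    show "inj_on K ?X"
    proof (rule inj_onI)
      fix x y assume xy: "x \<in> ?X" "y \<in> ?X" "K x = K y"
      have "k x i = k y i" for i
        using fun_cong [OF xy(3), of "Inl i"] by (simp add: KI)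
      then have "k x = k y" by (rule ext)
      with xy show "x = y" using is_code_eq_iff [OF k] by blast
    qed
    show "fclosed (K ` ?X)"
    proof (rule fclosedI)
      fix a assume "\<And>F. finite F \<Longrightarrow> \<exists>b\<in>K ` ?X. \<forall>i\<in>F. b i = a i"
      then have a: "\<exists>x\<in>?X. \<forall>i\<in>F. K x i = a i" if "finite F" for F using that by blast
      define r :: "nat \<Rightarrow> nat + nat \<Rightarrow> nat + nat \<times> nat"
        where "r n = case_sum Inl (\<lambda>m. Inr (n, m))" for n
      have r: "case_sum (k x) (l n x) i = K x (r n i)" for x i n
        by (cases i) (simp_all add: r_def KI)
      have ex: "\<exists>x\<in>?X. k x = a \<circ> Inl \<and> (\<forall>m. l n x m = a (Inr (n, m)))" for n
      proof -
        have "a \<circ> r n \<in> (\<lambda>x. case_sum (k x) (l n x)) ` ?X"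
        proof (rule fclosedD [OF lc])
          fix F :: "(nat + nat) set" assume "finite F"
          then have "finite (r n ` F)" by simp
          from a [OF this] obtain x where "x \<in> ?X" "\<forall>i\<in>r n ` F. K x i = a i" by blast
          then show "\<exists>b\<in>(\<lambda>x. case_sum (k x) (l n x)) ` ?X. \<forall>i\<in>F. b i = (a \<circ> r n) i"
            by (auto simp: r intro!: bexI [of _ x])
        qed
        then obtain x where x: "x \<in> ?X" "a \<circ> r n = case_sum (k x) (l n x)" by auto
        have "k x i = a (Inl i)" "l n x m = a (Inr (n, m))" for i m
          using fun_cong [OF x(2), of "Inl i"] fun_cong [OF x(2), of "Inr m"] by (simp_all add: r_def)
        with x(1) show ?thesis by (intro bexI [of _ x]) (simp_all add: fun_eq_iff)
      qed
      then obtain x where x: "x \<in> ?X" "k x = a \<circ> Inl" by blast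
      have "l n x m = a (Inr (n, m))" for n m
      proof -
        obtain y where "y \<in> ?X" "k y = a \<circ> Inl" "\<forall>m. l n y m = a (Inr (n, m))" using ex by blast
        with x is_code_eq_iff [OF k] show ?thesis by metis
      qed
      then have "a = K x" using x by (auto simp: fun_eq_iff K_def split: sum.split)
      with x show "a \<in> K ` ?X" by blast
    qed
    have digit: "(\<lambda>x. K x i) \<in> M \<rightarrow>\<^sub>M count_space UNIV" for i
      using is_code_digit [OF k] lm by (cases i) (simp_all add: K_def)
    have mem: "{x \<in> ?X. K x i = j} \<in> sets M" for i j
    proof -
      have "{x \<in> ?X. K x i = j} = (\<lambda>x. K x i) -` {j} \<inter> ?X" by auto
      then show ?thesis using measurable_sets [OF digit, of "{j}" i] by simp
    qed
    show "sets M = sigma_sets ?X {{x \<in> ?X. K x i = j} |i j. True}" (is "_ = sigma_sets _ ?E")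
    proof
      have "?E \<subseteq> sets M" using mem by blast
      then show "sigma_sets ?X ?E \<subseteq> sets M" by (rule sets.sigma_sets_subset)
      have "{{x \<in> ?X. k x i = j} |i j. True} \<subseteq> ?E"
        unfolding KI(1) [symmetric] by blast
      then have "sigma_sets ?X {{x \<in> ?X. k x i = j} |i j. True} \<subseteq> sigma_sets ?X ?E"
        by (rule sigma_sets_mono')
      then show "sets M \<subseteq> sigma_sets ?X ?E" using k by (simp add: is_code_def)
    qed
  qed
  then have "is_code M (\<lambda>x n. K x (from_nat n))" by (rule is_code_to_nat)
  moreover have "\<exists>i. \<forall>x\<in>?X. K x (from_nat i) = k x n" for n
    by (intro exI [of _ "to_nat (Inl n :: nat + nat \<times> nat)"]) (simp add: KI)
  moreover have "\<exists>i. \<forall>x\<in>?X. x \<in> U n \<longleftrightarrow> K x (from_nat i) \<noteq> 0" for n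
    by (intro exI [of _ "to_nat (Inr (n, 0) :: nat + nat \<times> nat)"]) (simp add: KI lU)
  ultimately show ?thesis by blast
qed

context borel_frames
begin

lemma small_empty: "small {}"
  by (auto simp: small_def)

text \<open>The values of each function split the set into countably many Borel pieces, not all of
  which can be small.\<close>

lemma not_small_constant:
  assumes A [measurable]: "A \<in> sets M" and ns: "\<not> small A" and "finite I"
    and F [measurable]: "\<And>i. i \<in> I \<Longrightarrow> F i \<in> M \<rightarrow>\<^sub>M count_space (UNIV :: nat set)"
  shows "\<exists>A'\<in>sets M. A' \<subseteq> A \<and> \<not> small A' \<and> (\<forall>i\<in>I. \<exists>j. \<forall>x\<in>A'. F i x = j)"
  using \<open>finite I\<close> F
proof (induction I)
  case empty
  then show ?case using A ns by auto
next
  case (insert i I)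
  then obtain B where B [measurable]: "B \<in> sets M" and "B \<subseteq> A" "\<not> small B" "\<forall>i\<in>I. \<exists>j. \<forall>x\<in>B. F i x = j"
    by auto
  note [measurable] = insert.prems [of i, simplified]
  define C where "C j = {x \<in> space M. x \<in> B \<and> F i x = j}" for j
  have [measurable]: "C j \<in> sets M" for j unfolding C_def by measurable
  have "B = (\<Union>j. C j)" using sets.sets_into_space [OF B] by (auto simp: C_def)
  then obtain j where "\<not> small (C j)" using small_UN [of C] \<open>\<not> small B\<close> by auto
  moreover have "\<exists>j'. \<forall>x\<in>C j. F i' x = j'" if "i' \<in> insert i I" for i'
    using that \<open>\<forall>i\<in>I. \<exists>j. \<forall>x\<in>B. F i x = j\<close> unfolding C_def by blast
  moreover have "C j \<subseteq> A" using \<open>B \<subseteq> A\<close> by (auto simp: C_def)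
  moreover have "C j \<in> sets M" by simp
  ultimately show ?case by blast
qed

text \<open>The moves \<open>P n, \<dots>, P (n + j - 1)\<close>, the last one first, whose index is set in \<open>a\<close>.\<close>

primrec word :: "(nat \<Rightarrow> int \<times> int) \<Rightarrow> (nat \<Rightarrow> bool) \<Rightarrow> nat \<Rightarrow> nat \<Rightarrow> 'a \<Rightarrow> 'a" where
  "word P a n 0 x = x"
| "word P a n (Suc j) x = word P a n j (if a (n + j) then mv (P (n + j)) x else x)"

lemma word_measurable [measurable]: "word P a n j \<in> M \<rightarrow>\<^sub>M M"
proof (induction j)
  case (Suc j)
  have eq: "word P a n (Suc j) = (\<lambda>x. word P a n j (if a (n + j) then mv (P (n + j)) x else x))"
    by (rule ext) simp
  have "(\<lambda>x. if a (n + j) then mv (P (n + j)) x else x) \<in> M \<rightarrow>\<^sub>M M" by simp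
  from measurable_compose [OF this Suc] show ?case by (simp only: eq)
qed simp

lemma word_in: "x \<in> space M \<Longrightarrow> word P a n j x \<in> space M"
  using measurable_space [OF word_measurable] .

lemma word_cl: "x \<in> space M \<Longrightarrow> cl (word P a n j x) = cl x"
  by (induction j arbitrary: x) (simp_all add: cl_mv mv_in)

lemma word_cong:
  assumes "\<And>i. n \<le> i \<Longrightarrow> i < n + j \<Longrightarrow> P i = Q i \<and> (a i \<longleftrightarrow> b i)"
  shows "word P a n j x = word Q b n j x"
  using assms by (induction j arbitrary: x) auto

lemma word_append: "word P a n (j + i) x = word P a n j (word P a (n + j) i x)"
  by (induction i arbitrary: x) (simp_all add: add.assoc)

lemma word_bound:
  assumes "x \<in> space M"
  shows "\<bar>fst (c (word P a n j x)) - fst (c x)\<bar> \<le> (\<Sum>i<j. \<bar>fst (P (n + i))\<bar> + \<bar>snd (P (n + i))\<bar>) \<and>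
    \<bar>snd (c (word P a n j x)) - snd (c x)\<bar> \<le> (\<Sum>i<j. \<bar>fst (P (n + i))\<bar> + \<bar>snd (P (n + i))\<bar>)"
  using assms
proof (induction j arbitrary: x)
  case (Suc j)
  let ?y = "if a (n + j) then mv (P (n + j)) x else x"
  have y: "?y \<in> space M" using Suc.prems by (simp add: mv_in)
  have tri: "\<bar>u - w\<bar> \<le> S + T" if "\<bar>u - v\<bar> \<le> S" "\<bar>v - w\<bar> \<le> T" for u v w S T :: int
    using that by linarith
  have step: "\<bar>fst (c ?y) - fst (c x)\<bar> \<le> \<bar>fst (P (n + j))\<bar> + \<bar>snd (P (n + j))\<bar>"
    "\<bar>snd (c ?y) - snd (c x)\<bar> \<le> \<bar>fst (P (n + j))\<bar> + \<bar>snd (P (n + j))\<bar>"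
    using mv_diff [OF Suc.prems, of "P (n + j)"] by auto
  have "word P a n (Suc j) x = word P a n j ?y" by simp
  then show ?case
    using tri [OF conjunct1 [OF Suc.IH [OF y]] step(1)] tri [OF conjunct2 [OF Suc.IH [OF y]] step(2)]
    by (simp only: sum.lessThan_Suc)
qed simp

section \<open>Different words lead to points that are apart\<close>

definition differs :: "nat \<Rightarrow> (nat \<Rightarrow> bool) \<Rightarrow> (nat \<Rightarrow> bool) \<Rightarrow> bool" where
  "differs n a b \<longleftrightarrow> (\<exists>i<n. a i \<noteq> b i)"

text \<open>Both coordinates are required because the line through a point may have either
  direction.\<close>

definition apart :: "'a \<Rightarrow> 'a \<Rightarrow> bool" where
  "apart x y \<longleftrightarrow> fst (c x) \<noteq> fst (c y) \<and> snd (c x) \<noteq> snd (c y)"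

definition spread :: "nat \<Rightarrow> (nat \<Rightarrow> int \<times> int) \<Rightarrow> 'a set \<Rightarrow> bool" where
  "spread n P A \<longleftrightarrow> (\<forall>x\<in>A. \<forall>a b. differs n a b \<longrightarrow> apart (word P a 0 n x) (word P b 0 n x))"

lemma spreadD: "spread n P A \<Longrightarrow> x \<in> A \<Longrightarrow> differs n a b \<Longrightarrow> apart (word P a 0 n x) (word P b 0 n x)"
  by (simp only: spread_def)

lemma spread_subset:
  assumes "spread n P A" "B \<subseteq> A"
  shows "spread n P B"
  unfolding spread_def
proof
  fix x assume "x \<in> B"
  with assms(2) have "x \<in> A" ..
  with assms(1) show "\<forall>a b. differs n a b \<longrightarrow> apart (word P a 0 n x) (word P b 0 n x)"
    unfolding spread_def by (rule bspec)
qed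

text \<open>The sum bounds the displacement by the first \<open>n\<close> moves in each coordinate.
  Two points displaced by at most that much stay apart if they start more than twice that distance
  from each other, whence the factor 2. Words that agree about the last move are covered by the old
  spread, at \<open>x\<close> or at \<open>mv p x\<close>.\<close>

lemma spread_extend:
  assumes sp: "spread n P A" and A: "A \<subseteq> space M"
    and p: "2 * (\<Sum>i<n. \<bar>fst (P i)\<bar> + \<bar>snd (P i)\<bar>) < \<bar>fst p\<bar>"
      "2 * (\<Sum>i<n. \<bar>fst (P i)\<bar> + \<bar>snd (P i)\<bar>) < \<bar>snd p\<bar>"
  shows "spread (Suc n) (P(n := p)) {x \<in> A. mv p x \<in> A}"
  unfolding spread_def
proof (intro ballI allI impI)
  fix x a b assume x: "x \<in> {x \<in> A. mv p x \<in> A}" and ab: "differs (Suc n) a b"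
  let ?S = "\<Sum>i<n. \<bar>fst (P i)\<bar> + \<bar>snd (P i)\<bar>"
  have xX: "x \<in> space M" "mv p x \<in> space M" using x A by auto
  have w: "word (P(n := p)) d 0 (Suc n) x = word P d 0 n (if d n then mv p x else x)" for d
    using word_cong [of 0 n "P(n := p)" P d d] by simp
  show "apart (word (P(n := p)) a 0 (Suc n) x) (word (P(n := p)) b 0 (Suc n) x)"
  proof (cases "a n = b n")
    case True
    then have "differs n a b" using ab unfolding differs_def less_Suc_eq by blast
    moreover have "(if b n then mv p x else x) \<in> A" using x by simp
    ultimately show ?thesis using spreadD [OF sp] unfolding w True by blast
  next
    case False
    have d: "\<bar>fst (c (mv p x)) - fst (c x)\<bar> > 2 * ?S" "\<bar>snd (c (mv p x)) - snd (c x)\<bar> > 2 * ?S"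
      using mv_diff [OF xX(1), of p] p by auto
    have far: "apart (word P e 0 n x) (word P e' 0 n (mv p x))"
      "apart (word P e' 0 n (mv p x)) (word P e 0 n x)" for e e'
    proof -
      note wb = word_bound [OF xX(1), of P e 0 n, unfolded add_0] word_bound [OF xX(2), of P e' 0 n, unfolded add_0]
      have "fst (c (word P e 0 n x)) \<noteq> fst (c (word P e' 0 n (mv p x)))"
        using d(1) wb(1) [THEN conjunct1] wb(2) [THEN conjunct1] by linarith
      moreover have "snd (c (word P e 0 n x)) \<noteq> snd (c (word P e' 0 n (mv p x)))"
        using d(2) wb(1) [THEN conjunct2] wb(2) [THEN conjunct2] by linarith
      ultimately show "apart (word P e 0 n x) (word P e' 0 n (mv p x))"
        "apart (word P e' 0 n (mv p x)) (word P e 0 n x)" by (simp_all add: apart_def)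
    qed
    show ?thesis
    proof (cases "a n")
      case True
      with False have "\<not> b n" by simp
      with True show ?thesis unfolding w using far(2) [of a b] by simp
    next
      case False
      with \<open>a n \<noteq> b n\<close> have "b n" by simp
      with False show ?thesis unfolding w using far(1) [of a b] by simp
    qed
  qed
qed

text \<open>Finitely many digits are the same for all points of \<open>A\<close>: those of the moved points, those
  separating a moved point from the line of another, and the moves between moved points that differ
  by the last one.\<close>

definition uniform :: "('a \<Rightarrow> nat \<Rightarrow> nat) \<Rightarrow> nat \<Rightarrow> (nat \<Rightarrow> int \<times> int) \<Rightarrow> 'a set \<Rightarrow> bool" where
  "uniform k' n P A \<longleftrightarrow>
    (\<forall>a. \<forall>i<Suc n. \<exists>j. \<forall>x\<in>A. k' (word P a 0 (Suc n) x) i = j) \<and>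
    (\<forall>a b t. differs (Suc n) a b \<and> \<bar>t\<bar> \<le> int n \<longrightarrow> (\<exists>i j j'. j \<noteq> j' \<and>
      (\<forall>x\<in>A. k (word P b 0 (Suc n) x) i = j \<and> k (mv (t, 0) (word P a 0 (Suc n) x)) i = j'))) \<and>
    (\<forall>a. \<exists>q. \<forall>x\<in>A. word P a 0 n (mv (P n) x) = mv q (word P a 0 n x))"

lemma uniform_exists:
  assumes k': "is_code M k'" and A [measurable]: "A \<in> sets M" and ns: "\<not> small A" and sp: "spread (Suc n) P A"
  shows "\<exists>A'\<in>sets M. A' \<subseteq> A \<and> \<not> small A' \<and> uniform k' n P A'"
proof -
  note AX = sets.sets_into_space [OF A]
  let ?m = "Suc n"
  \<comment> \<open>A word depends only on which of its \<open>Suc n\<close> moves are made, so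
    finitely many sets index all of them.\<close>
  define tr where "tr a = {i. i < ?m \<and> a i}" for a :: "nat \<Rightarrow> bool"
  define w where "w S = word P (\<lambda>i. i \<in> S) 0 ?m" for S
  have w: "word P a 0 ?m x = w (tr a) x" for a x
    unfolding w_def tr_def by (rule word_cong) auto
  have trfin: "tr a \<in> Pow {..<?m}" for a by (auto simp: tr_def)
  have w_meas [measurable]: "w S \<in> M \<rightarrow>\<^sub>M M" for S by (simp add: w_def)
  have dg [measurable]: "(\<lambda>x. k (f x) i) \<in> M \<rightarrow>\<^sub>M count_space UNIV" if "f \<in> M \<rightarrow>\<^sub>M M" for f i
    using measurable_compose [OF that is_code_digit [OF code]] .
  define F1 where "F1 S i x = k' (w S x) i" for S i x
  have F1: "F1 S i \<in> M \<rightarrow>\<^sub>M count_space UNIV" for S i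
    using measurable_compose [OF w_meas is_code_digit [OF k']] by (simp add: F1_def [abs_def])
  \<comment> \<open>The first digit that separates the end of word \<open>T\<close> from the point
    \<open>t\<close> steps along the line of the end of word \<open>S\<close>. Making it constant,
    together with the two values there, keeps the separation in the limit.\<close>
  define D where "D S T t x = (LEAST i. \<not> (\<exists>j. k (w T x) i = j \<and> k (mv (t, 0) (w S x)) i = j))" for S T t x
  have [measurable]: "(\<lambda>x. mv (t, 0) (w S x)) \<in> M \<rightarrow>\<^sub>M M" for t S by measurable
  have D: "D S T t \<in> M \<rightarrow>\<^sub>M count_space UNIV" for S T t
    unfolding D_def by measurable
  have D1: "(\<lambda>x. k (w T x) (D S T t x)) \<in> M \<rightarrow>\<^sub>M count_space UNIV" for S T t
    by (rule measurable_compose_countable [OF _ D]) measurable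
  have D2: "(\<lambda>x. k (mv (t, 0) (w S x)) (D S T t x)) \<in> M \<rightarrow>\<^sub>M count_space UNIV" for S T t
    by (rule measurable_compose_countable [OF _ D]) measurable
  \<comment> \<open>The last move is made before the others, so seen from the end of the word it is
    some other move; this is its number.\<close>
  define E where "E S x = (LEAST r. word P (\<lambda>i. i \<in> S) 0 n (mv (P n) x) =
      mv (from_nat r) (word P (\<lambda>i. i \<in> S) 0 n x))" for S x
  have E: "E S \<in> M \<rightarrow>\<^sub>M count_space UNIV" for S
    unfolding E_def by measurable
  \<comment> \<open>The tag below 5 selects one of the five families of functions to be made
    constant.\<close>
  define I where "I = (Pow {..<?m} \<times> Pow {..<?m}) \<times> {-int n..int n} \<times> {..<?m} \<times> {..<5::nat}"
  define F where "F q = (case q of ((S, T), t, i, e) \<Rightarrow>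
     if e = 0 then F1 S i else if e = 1 then D S T t else if e = 2 then (\<lambda>x. k (w T x) (D S T t x))
     else if e = 3 then (\<lambda>x. k (mv (t, 0) (w S x)) (D S T t x)) else E S)"
    for q :: "(nat set \<times> nat set) \<times> int \<times> nat \<times> nat"
  have "finite I" by (auto simp: I_def)
  moreover have "F q \<in> M \<rightarrow>\<^sub>M count_space UNIV" for q
    using F1 D D1 D2 E by (auto simp: F_def split: prod.split)
  ultimately obtain A' where A': "A' \<in> sets M" "A' \<subseteq> A" "\<not> small A'"
    and const: "\<And>q. q \<in> I \<Longrightarrow> \<exists>j. \<forall>x\<in>A'. F q x = j"
    using not_small_constant [OF A ns, of I F] by blast
  have A'X: "x \<in> space M" if "x \<in> A'" for x using that A'(2) AX by blast
  have "uniform k' n P A'"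
    unfolding uniform_def
  proof (intro conjI allI impI)
    fix a i assume "i < ?m"
    then have "((tr a, tr a), 0, i, 0) \<in> I" using trfin by (simp add: I_def)
    from const [OF this] show "\<exists>j. \<forall>x\<in>A'. k' (word P a 0 ?m x) i = j"
      by (simp add: F_def F1_def w del: word.simps)
  next
    fix a b t assume abt: "differs ?m a b \<and> \<bar>t\<bar> \<le> int n"
    let ?S = "tr a" and ?T = "tr b"
    have "((?S, ?T), t, 0, e) \<in> I" if "e < 5" for e using abt that trfin by (auto simp: I_def)
    from const [OF this [of 1]] const [OF this [of 2]] const [OF this [of 3]]
    obtain i j j' where ij: "\<And>x. x \<in> A' \<Longrightarrow> D ?S ?T t x = i"
      "\<And>x. x \<in> A' \<Longrightarrow> k (w ?T x) (D ?S ?T t x) = j"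
      "\<And>x. x \<in> A' \<Longrightarrow> k (mv (t, 0) (w ?S x)) (D ?S ?T t x) = j'"
      by (auto simp: F_def)
    have "k (w ?T x) (D ?S ?T t x) \<noteq> k (mv (t, 0) (w ?S x)) (D ?S ?T t x)" if x: "x \<in> A'" for x
    proof -
      have xX: "w ?S x \<in> space M" "w ?T x \<in> space M" using A'X [OF x] by (simp_all add: w_def word_in del: word.simps)
      have "x \<in> A" using x A'(2) by blast
      then have "apart (w ?S x) (w ?T x)"
        using spreadD [OF sp, of x a b] abt unfolding w by blast
      then have "w ?T x \<noteq> mv (t, 0) (w ?S x)"
        using mv_diff [OF xX(1), of "(t, 0)"] by (auto simp: apart_def split: if_splits)
      then have "k (w ?T x) \<noteq> k (mv (t, 0) (w ?S x))"
        using is_code_eq_iff [OF code xX(2) mv_in [OF xX(1)]] by blast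
      then obtain i where "k (w ?T x) i \<noteq> k (mv (t, 0) (w ?S x)) i" unfolding fun_eq_iff by blast
      then have "\<exists>i. \<not> (\<exists>j. k (w ?T x) i = j \<and> k (mv (t, 0) (w ?S x)) i = j)"
        by (intro exI [of _ i]) auto
      then have "\<not> (\<exists>j. k (w ?T x) (D ?S ?T t x) = j \<and> k (mv (t, 0) (w ?S x)) (D ?S ?T t x) = j)"
        unfolding D_def by (rule LeastI_ex)
      then show ?thesis by simp
    qed
    moreover have "A' \<noteq> {}" using A'(3) small_empty by auto
    ultimately have "j \<noteq> j'" using ij by auto
    with ij show "\<exists>i j j'. j \<noteq> j' \<and>
      (\<forall>x\<in>A'. k (word P b 0 ?m x) i = j \<and> k (mv (t, 0) (word P a 0 ?m x)) i = j')"
      unfolding w by (intro exI [of _ i] exI [of _ j] exI [of _ j']) auto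
  next
    fix a
    let ?S = "tr a"
    have wa: "word P a 0 n x = word P (\<lambda>i. i \<in> ?S) 0 n x" for x
      by (rule word_cong) (auto simp: tr_def)
    have "((?S, ?S), 0, 0, 4) \<in> I" using trfin by (simp add: I_def)
    from const [OF this] obtain r where r: "\<And>x. x \<in> A' \<Longrightarrow> E ?S x = r" by (auto simp: F_def)
    have "word P a 0 n (mv (P n) x) = mv (from_nat r) (word P a 0 n x)" if x: "x \<in> A'" for x
    proof -
      have X: "word P a 0 n x \<in> space M" "word P a 0 n (mv (P n) x) \<in> space M"
        using A'X [OF x] by (auto simp: word_in mv_in)
      have "cl (word P a 0 n x) = cl (word P a 0 n (mv (P n) x))"
        using A'X [OF x] by (simp add: word_cl mv_in cl_mv)
      then obtain q where "word P a 0 n (mv (P n) x) = mv q (word P a 0 n x)" using ex_mv [OF X] by blast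
      then have "word P a 0 n (mv (P n) x) = mv (from_nat (to_nat q)) (word P a 0 n x)" by simp
      then have "word P a 0 n (mv (P n) x) = mv (from_nat (E ?S x)) (word P a 0 n x)"
        unfolding E_def wa by (rule LeastI)
      with r [OF x] show ?thesis by simp
    qed
    then show "\<exists>q. \<forall>x\<in>A'. word P a 0 n (mv (P n) x) = mv q (word P a 0 n x)" by blast
  qed
  with A' show ?thesis by blast
qed

lemma uniform_cong:
  assumes "\<And>i. i < Suc n \<Longrightarrow> P i = Q i"
  shows "uniform k' n P A = uniform k' n Q A"
proof -
  have "word P a 0 n x = word Q a 0 n x" "word P a 0 (Suc n) x = word Q a 0 (Suc n) x" for a x
    using assms by (auto intro!: word_cong simp del: word.simps)
  moreover have "P n = Q n" using assms by simp
  ultimately show ?thesis unfolding uniform_def by (simp del: word.simps)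
qed

text \<open>Dependent choice on pairs of a set and its moves. Each step keeps the moves chosen
  earlier, so that they converge to \<open>P\<close>, and asks \<open>not_small_extend\<close> for
  the distance that \<open>spread_extend\<close> requires.\<close>

lemma fusion_sequence:
  assumes k': "is_code M k'" and ns: "\<not> small (space M)"
  obtains A P where "\<And>n. A n \<in> sets M" "\<And>n. \<not> small (A n)" "\<And>n. A (Suc n) \<subseteq> A n"
    "\<And>n x. x \<in> A (Suc n) \<Longrightarrow> mv (P n) x \<in> A n" "\<And>n x. x \<in> A (Suc n) \<Longrightarrow> hz (mv (P n) x) \<noteq> hz x"
    "\<And>n. uniform k' n P (A (Suc n))"
proof -
  define I where "I n s \<longleftrightarrow> fst s \<in> sets M \<and> \<not> small (fst s) \<and> spread n (snd s) (fst s)" for n s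
  define R where "R n s s' \<longleftrightarrow> (\<forall>i<n. snd s' i = snd s i) \<and> fst s' \<subseteq> fst s \<and>
    (\<forall>x\<in>fst s'. mv (snd s' n) x \<in> fst s \<and> hz (mv (snd s' n) x) \<noteq> hz x) \<and>
    uniform k' n (snd s') (fst s')" for n s s'
  have "\<exists>f. \<forall>n. I n (f n) \<and> R n (f n) (f (Suc n))"
  proof (rule dependent_nat_choice)
    show "\<exists>s. I 0 s"
      using ns by (intro exI [of _ "(space M, \<lambda>_. (0, 0))"]) (auto simp: I_def spread_def differs_def)
    fix s n assume "I n s"
    then have s: "fst s \<in> sets M" "\<not> small (fst s)" "spread n (snd s) (fst s)" by (auto simp: I_def)
    note sX = sets.sets_into_space [OF s(1)]
    obtain p where p: "2 * (\<Sum>i<n. \<bar>fst (snd s i)\<bar> + \<bar>snd (snd s i)\<bar>) < \<bar>fst p\<bar>"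
      "2 * (\<Sum>i<n. \<bar>fst (snd s i)\<bar> + \<bar>snd (snd s i)\<bar>) < \<bar>snd p\<bar>"
      and B: "\<not> small {x \<in> space M. x \<in> fst s \<and> mv p x \<in> fst s \<and> hz (mv p x) \<noteq> hz x}"
      using not_small_extend [OF s(1,2), of "2 * (\<Sum>i<n. \<bar>fst (snd s i)\<bar> + \<bar>snd (snd s i)\<bar>)"] by blast
    define B where "B = {x \<in> space M. x \<in> fst s \<and> mv p x \<in> fst s \<and> hz (mv p x) \<noteq> hz x}"
    note [measurable] = s(1)
    have Bs: "B \<in> sets M" unfolding B_def by measurable
    let ?P = "(snd s)(n := p)"
    have "spread (Suc n) ?P {x \<in> fst s. mv p x \<in> fst s}"
      by (rule spread_extend [OF s(3) sX p])
    then have sp: "spread (Suc n) ?P B" by (rule spread_subset) (auto simp: B_def)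
    then obtain A' where A': "A' \<in> sets M" "A' \<subseteq> B" "\<not> small A'" "uniform k' n ?P A'"
      using uniform_exists [OF k' Bs _ sp] B unfolding B_def by blast
    have "I (Suc n) (A', ?P)" using A' spread_subset [OF sp A'(2)] by (simp add: I_def)
    moreover have "R n s (A', ?P)" using A' by (auto simp: R_def B_def)
    ultimately show "\<exists>s'. I (Suc n) s' \<and> R n s s'" by blast
  qed
  then obtain f where f: "\<And>n. I n (f n)" "\<And>n. R n (f n) (f (Suc n))" by blast
  define A where "A n = fst (f n)" for n
  define P where "P n = snd (f (Suc n)) n" for n
  have P: "snd (f n) i = P i" if "i < n" for i n
    using that
  proof (induction n)
    case (Suc n)
    then show ?case using f(2) [of n] by (cases "i = n") (auto simp: R_def P_def)
  qed simp
  show ?thesis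
  proof (rule that [of A P])
    fix n
    show "A n \<in> sets M" "\<not> small (A n)" using f(1) [of n] by (auto simp: I_def A_def)
    show "A (Suc n) \<subseteq> A n" using f(2) [of n] by (auto simp: R_def A_def)
    show "mv (P n) x \<in> A n" "hz (mv (P n) x) \<noteq> hz x" if "x \<in> A (Suc n)" for x
      using f(2) [of n] that by (auto simp: R_def A_def P_def)
    show "uniform k' n P (A (Suc n))"
      using f(2) [of n] uniform_cong [of n "snd (f (Suc n))" P k'] P [of _ "Suc n"]
      by (auto simp: R_def A_def)
  qed
qed

end

lemma measurable_finitely_determined:
  fixes g :: "(nat \<Rightarrow> bool) \<Rightarrow> nat"
  assumes "\<And>a b. (\<And>i. i < n \<Longrightarrow> a i = b i) \<Longrightarrow> g a = g b"
  shows "g \<in> borel \<rightarrow>\<^sub>M count_space UNIV"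
proof -
  have "{a. g a = j} \<in> sets borel" for j
  proof -
    define C where "C S = (\<Inter>i\<in>{..<n}. {a :: nat \<Rightarrow> bool. a i = (i \<in> S)})" for S
    have op: "open {a :: nat \<Rightarrow> bool. a i = b}" for i b
    proof -
      have "open ((\<lambda>a :: nat \<Rightarrow> bool. a i) -` {b})"
        by (intro open_vimage open_discrete) (rule continuous_on_product_coordinates)
      moreover have "(\<lambda>a :: nat \<Rightarrow> bool. a i) -` {b} = {a. a i = b}" by auto
      ultimately show ?thesis by simp
    qed
    have "open (C S)" for S unfolding C_def by (intro open_INT ballI op) simp
    then have "open (\<Union>S\<in>{S. S \<subseteq> {..<n} \<and> g (\<lambda>i. i \<in> S) = j}. C S)" by blast
    moreover have "{a. g a = j} = (\<Union>S\<in>{S. S \<subseteq> {..<n} \<and> g (\<lambda>i. i \<in> S) = j}. C S)"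
    proof (intro equalityI subsetI)
      fix a assume a: "a \<in> {a. g a = j}"
      let ?S = "{i. i < n \<and> a i}"
      have "g (\<lambda>i. i \<in> ?S) = g a" by (rule assms) simp
      moreover have "a \<in> C ?S" by (simp add: C_def)
      ultimately show "a \<in> (\<Union>S\<in>{S. S \<subseteq> {..<n} \<and> g (\<lambda>i. i \<in> S) = j}. C S)"
        using a by (intro UN_I [of ?S]) auto
    next
      fix a assume "a \<in> (\<Union>S\<in>{S. S \<subseteq> {..<n} \<and> g (\<lambda>i. i \<in> S) = j}. C S)"
      then obtain S where S: "g (\<lambda>i. i \<in> S) = j" "a \<in> C S" by blast
      have "g a = g (\<lambda>i. i \<in> S)" using S(2) by (intro assms) (simp add: C_def)
      with S show "a \<in> {a. g a = j}" by simp
    qed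
    ultimately show ?thesis by simp
  qed
  then show ?thesis
    by (subst measurable_count_space_eq2_countable) (auto simp: vimage_def)
qed

context borel_frames
begin

lemma uniformD:
  assumes "uniform k' n P A"
  shows "\<And>i. i < Suc n \<Longrightarrow> \<exists>j. \<forall>x\<in>A. k' (word P a 0 (Suc n) x) i = j"
    "\<And>t. differs (Suc n) a b \<Longrightarrow> \<bar>t\<bar> \<le> int n \<Longrightarrow> \<exists>i j j'. j \<noteq> j' \<and>
      (\<forall>x\<in>A. k (word P b 0 (Suc n) x) i = j \<and> k (mv (t, 0) (word P a 0 (Suc n) x)) i = j')"
    "\<exists>q. \<forall>x\<in>A. word P a 0 n (mv (P n) x) = mv q (word P a 0 n x)"
proof -
  note U = assms [unfolded uniform_def]
  show "\<exists>j. \<forall>x\<in>A. k' (word P a 0 (Suc n) x) i = j" if "i < Suc n" for i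
    by (rule conjunct1 [OF U, THEN spec, THEN spec, THEN mp, OF that])
  show "\<exists>i j j'. j \<noteq> j' \<and>
      (\<forall>x\<in>A. k (word P b 0 (Suc n) x) i = j \<and> k (mv (t, 0) (word P a 0 (Suc n) x)) i = j')"
    if "differs (Suc n) a b" "\<bar>t\<bar> \<le> int n" for t
    by (rule conjunct1 [OF conjunct2 [OF U], THEN spec, THEN spec, THEN spec, THEN mp, OF conjI [OF that]])
  show "\<exists>q. \<forall>x\<in>A. word P a 0 n (mv (P n) x) = mv q (word P a 0 n x)"
    by (rule conjunct2 [OF conjunct2 [OF U], THEN spec])
qed

text \<open>The point \<open>f a\<close> is coded by the common digits of \<open>word P a 0 n x\<close> for \<open>x \<in> A n\<close>. Relations
  that depend on finitely many digits of the refined code \<open>k'\<close> pass to the limit.\<close>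

lemma not_small_embedding:
  assumes ns: "\<not> small (space M)"
  shows "\<exists>f :: (nat \<Rightarrow> bool) \<Rightarrow> 'a. f \<in> borel \<rightarrow>\<^sub>M M \<and>
     (\<forall>a b j. a j \<noteq> b j \<and> (\<forall>i. i \<noteq> j \<longrightarrow> a i = b i) \<longrightarrow> cl (f a) = cl (f b) \<and> hz (f a) \<noteq> hz (f b)) \<and>
     (\<forall>a b t. a \<noteq> b \<longrightarrow> f b \<noteq> mv (t, 0) (f a))"
proof -
  let ?X = "space M"
  \<comment> \<open>What has to pass to the limit: the digits of moved points, and whether a move
    preserves the direction. In the code \<open>k'\<close> each of these is decided by one
    digit.\<close>
  define V where "V = case_sum (\<lambda>(p, i, j). {x \<in> ?X. k (mv p x) i = j}) (\<lambda>p. {x \<in> ?X. hz (mv p x) = hz x})"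
  have V_sets: "V q \<in> sets M" for q
  proof (cases q)
    case (Inl r)
    have [measurable]: "(\<lambda>x. k (mv p x) i) \<in> M \<rightarrow>\<^sub>M count_space UNIV" for p i
      using measurable_compose [OF mv_measurable is_code_digit [OF code]] .
    have "{x \<in> ?X. k (mv p x) i = j} \<in> sets M" for p i j by measurable
    then show ?thesis by (simp add: Inl V_def split: prod.split)
  next
    case (Inr p)
    have "{x \<in> ?X. hz (mv p x) = hz x} \<in> sets M" by measurable
    then show ?thesis by (simp add: Inr V_def)
  qed
  obtain k' :: "'a \<Rightarrow> nat \<Rightarrow> nat" where k': "is_code M k'"
    and kk': "\<And>n. \<exists>i. \<forall>x\<in>?X. k' x i = k x n"
    and Vk': "\<And>n. \<exists>i. \<forall>x\<in>?X. x \<in> V (from_nat n) \<longleftrightarrow> k' x i \<noteq> 0"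
    using refine_code_family [OF code, of "\<lambda>n. V (from_nat n)"] V_sets by blast
  have Vd: "\<exists>i. \<forall>x\<in>?X. x \<in> V q \<longleftrightarrow> k' x i \<noteq> 0" for q
    using Vk' [of "to_nat q"] by simp
  have Vl: "\<exists>i'. \<forall>x\<in>?X. k (mv p x) i = j \<longleftrightarrow> k' x i' \<noteq> 0" for p i j
    using Vd [of "Inl (p, i, j)"] by (simp add: V_def)
  have Vr: "\<exists>i'. \<forall>x\<in>?X. hz (mv p x) = hz x \<longleftrightarrow> k' x i' \<noteq> 0" for p
    using Vd [of "Inr p"] by (simp add: V_def)
  obtain A P where As: "\<And>n. A n \<in> sets M" and nsA: "\<And>n. \<not> small (A n)"
    and dec: "\<And>n. A (Suc n) \<subseteq> A n"
    and mvA: "\<And>n x. x \<in> A (Suc n) \<Longrightarrow> mv (P n) x \<in> A n"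
    and flip: "\<And>n x. x \<in> A (Suc n) \<Longrightarrow> hz (mv (P n) x) \<noteq> hz x"
    and unif: "\<And>n. uniform k' n P (A (Suc n))"
    using fusion_sequence [OF k' ns] by blast
  have AX: "x \<in> ?X" if "x \<in> A n" for x n using that sets.sets_into_space [OF As] by blast
  have ne: "\<exists>x. x \<in> A n" for n using nsA [of n] small_empty by (metis all_not_in_conv)
  have word_A: "word P a n j x \<in> A n" if "x \<in> A (n + j)" for a n j x
    using that
  proof (induction j arbitrary: x)
    case (Suc j)
    then show ?case using dec [of "n + j"] mvA [of x "n + j"] by auto
  qed simp
  define w where "w n a x = word P a 0 n x" for n a x
  \<comment> \<open>The moves from \<open>n\<close> on are made first and stay within
    \<open>A n\<close>; hence a longer word is the shorter one applied to another point of
    \<open>A n\<close>, and what is constant on \<open>A n\<close> persists.\<close>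
  have w_split: "\<exists>y\<in>A n. w m a x = w n a y \<and> y = word P a n (m - n) x" if "n \<le> m" "x \<in> A m" for n m a x
    using word_append [of P a 0 n "m - n" x] word_A [of x n "m - n" a] that by (auto simp: w_def)
  have wX: "w n a x \<in> ?X" if "x \<in> A n" for n a x using that AX by (simp add: w_def word_in)
  have const: "\<exists>j. \<forall>n x. i < n \<and> x \<in> A n \<longrightarrow> k' (w n a x) i = j" for a i
  proof -
    obtain j where j: "\<And>x. x \<in> A (Suc i) \<Longrightarrow> k' (w (Suc i) a x) i = j"
      using uniformD(1) [OF unif lessI, where a = a] unfolding w_def by blast
    have "k' (w n a x) i = j" if n: "i < n" and x: "x \<in> A n" for n x
    proof -
      have "Suc i \<le> n" using n by simp
      from w_split [OF this x, of a] j show ?thesis by auto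
    qed
    then show ?thesis by blast
  qed
  define g where "g a i = (SOME j. \<forall>n x. i < n \<and> x \<in> A n \<longrightarrow> k' (w n a x) i = j)" for a i
  have g: "k' (w n a x) i = g a i" if "i < n" "x \<in> A n" for a i n x
    using someI_ex [OF const [of i a]] that unfolding g_def by blast
  have "\<exists>x\<in>?X. k' x = g a" for a
  proof (rule is_code_approx [OF k'])
    fix F :: "nat set" assume "finite F"
    then obtain n where n: "F \<subseteq> {..<n}" using finite_nat_iff_bounded by blast
    obtain x where "x \<in> A n" using ne by blast
    with n g wX show "\<exists>x\<in>?X. \<forall>i\<in>F. k' x i = g a i" by (intro bexI [of _ "w n a x"]) auto
  qed
  then obtain f where f: "\<And>a. f a \<in> ?X" "\<And>a. k' (f a) = g a" by metis
  have near: "k' (f a) i = k' (w n a x) i" if "i < n" "x \<in> A n" for a i n x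
    using g [OF that] f by simp
  have k_near: "\<exists>m. \<forall>a n x. m \<le> n \<and> x \<in> A n \<longrightarrow> k (f a) i = k (w n a x) i" for i
  proof -
    obtain i' where i': "\<And>x. x \<in> ?X \<Longrightarrow> k' x i' = k x i" using kk' by blast
    then show ?thesis using near f(1) wX by (intro exI [of _ "Suc i'"]) (metis Suc_le_eq)
  qed
  \<comment> \<open>The digit value at \<open>f a\<close> is fixed first: the set of points having
    this value after the move is clopen for \<open>k'\<close>, so the approximations eventually
    belong to it.\<close>
  have mv_near: "\<exists>m. \<forall>n x. m \<le> n \<and> x \<in> A n \<longrightarrow> k (mv p (f a)) i = k (mv p (w n a x)) i" for p a i
  proof -
    obtain i' where i': "\<And>x. x \<in> ?X \<Longrightarrow> k (mv p x) i = k (mv p (f a)) i \<longleftrightarrow> k' x i' \<noteq> 0"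
      using Vl [of p i "k (mv p (f a)) i"] by blast
    then have "k' (f a) i' \<noteq> 0" using f(1) by blast
    then have "k (mv p (w n a x)) i = k (mv p (f a)) i" if "Suc i' \<le> n" "x \<in> A n" for n x
      using near [of i' n x a] i' [OF wX [OF that(2)], of a] that by simp
    then show ?thesis by (intro exI [of _ "Suc i'"]) simp
  qed
  have hz_near: "\<exists>m. \<forall>n x. m \<le> n \<and> x \<in> A n \<longrightarrow>
      (hz (mv p (f a)) = hz (f a) \<longleftrightarrow> hz (mv p (w n a x)) = hz (w n a x))" for p a
  proof -
    obtain i' where i': "\<And>x. x \<in> ?X \<Longrightarrow> hz (mv p x) = hz x \<longleftrightarrow> k' x i' \<noteq> 0"
      using Vr by blast
    have "hz (mv p (f a)) = hz (f a) \<longleftrightarrow> hz (mv p (w n a x)) = hz (w n a x)" if "Suc i' \<le> n" "x \<in> A n" for n x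
      using near [of i' n x a] i' [OF wX [OF that(2)], of a] i' [OF f(1) [of a]] that by simp
    then show ?thesis by (intro exI [of _ "Suc i'"]) blast
  qed
  \<comment> \<open>Every move that is made exchanges the direction on the current set, so a word
    either keeps or exchanges the directions of both points.\<close>
  have hz_w: "hz (w n a x) = hz (w n a y) \<longleftrightarrow> hz x = hz y" if "x \<in> A n" "y \<in> A n" for n a x y
    using that
  proof (induction n arbitrary: x y)
    case (Suc n)
    let ?m = "\<lambda>x. if a n then mv (P n) x else x"
    have "?m x \<in> A n" "?m y \<in> A n" using Suc.prems dec mvA by auto
    moreover have "w (Suc n) a z = w n a (?m z)" for z by (simp add: w_def)
    moreover have "hz (?m x) = hz (?m y) \<longleftrightarrow> hz x = hz y" using flip Suc.prems by auto
    ultimately show ?case using Suc.IH by simp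
  qed (simp add: w_def)
  have "f \<in> borel \<rightarrow>\<^sub>M M"
  proof (rule measurable_into_code [OF k'])
    fix i
    have "g a i = g b i" if "\<And>l. l < Suc i \<Longrightarrow> a l = b l" for a b
    proof -
      obtain x where x: "x \<in> A (Suc i)" using ne by blast
      have "w (Suc i) a x = w (Suc i) b x" unfolding w_def by (rule word_cong) (use that in auto)
      then show ?thesis using g [OF lessI x, of a] g [OF lessI x, of b] by simp
    qed
    then have "(\<lambda>a. g a i) \<in> borel \<rightarrow>\<^sub>M count_space UNIV" by (rule measurable_finitely_determined [where n = "Suc i"]) simp
    then show "(\<lambda>a. k' (f a) i) \<in> borel \<rightarrow>\<^sub>M count_space UNIV" by (simp add: f(2))
  qed (simp add: f)
  moreover have step: "cl (f a) = cl (f b) \<and> hz (f a) \<noteq> hz (f b)"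
    if ab: "\<not> a n" "b n" "\<And>i. i \<noteq> n \<Longrightarrow> a i = b i" for a b n
  proof -
    \<comment> \<open>By uniformity the same move \<open>q\<close> leads from the word without move
      \<open>n\<close> to the word with it, for all starting points, and so it survives in the
      limit.\<close>
    obtain q where q: "\<And>x. x \<in> A (Suc n) \<Longrightarrow> w n a (mv (P n) x) = mv q (w n a x)"
      using uniformD(3) [OF unif, where a = a and n = n] unfolding w_def by blast
    have rel: "w m b x = mv q (w m a x) \<and> hz (mv q (w m a x)) \<noteq> hz (w m a x)"
      if m: "Suc n \<le> m" and x: "x \<in> A m" for m x
    proof -
      obtain y where y: "y \<in> A (Suc n)" "w m a x = w (Suc n) a y" "y = word P a (Suc n) (m - Suc n) x"
        using w_split [OF m x, of a] by blast
      obtain y' where y': "w m b x = w (Suc n) b y'" "y' = word P b (Suc n) (m - Suc n) x"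
        using w_split [OF m x, of b] by blast
      have "y' = y" unfolding y(3) y'(2) by (rule word_cong) (use ab in auto)
      have wb: "w n b z = w n a z" for z unfolding w_def by (rule word_cong) (use ab in auto)
      have wa: "w m a x = w n a y" using y ab by (simp add: w_def)
      have "w m b x = w n a (mv (P n) y)"
        using y'(1) ab(2) \<open>y' = y\<close> wb [of "mv (P n) y"] by (simp add: w_def)
      with q [OF y(1)] wa have eq: "w m b x = mv q (w m a x)" by simp
      have "hz (w n a (mv (P n) y)) \<noteq> hz (w n a y)"
        using hz_w [of "mv (P n) y" n y a] flip [OF y(1)] mvA [OF y(1)] dec y(1) by blast
      then have "hz (mv q (w m a x)) \<noteq> hz (w m a x)" using q [OF y(1)] wa by simp
      with eq show ?thesis by blast
    qed
    have "k (f b) i = k (mv q (f a)) i" for i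
    proof -
      obtain m1 where m1: "\<And>n x. m1 \<le> n \<Longrightarrow> x \<in> A n \<Longrightarrow> k (f b) i = k (w n b x) i"
        using k_near [of i] by blast
      obtain m2 where m2: "\<And>n x. m2 \<le> n \<Longrightarrow> x \<in> A n \<Longrightarrow> k (mv q (f a)) i = k (mv q (w n a x)) i"
        using mv_near [of q a i] by blast
      define m where "m = max (Suc n) (max m1 m2)"
      obtain x where x: "x \<in> A m" using ne by blast
      show ?thesis using m1 [of m x] m2 [of m x] rel [of m x] x by (simp add: m_def)
    qed
    then have "k (f b) = k (mv q (f a))" by (rule ext)
    then have eq: "f b = mv q (f a)" using is_code_eq_iff [OF code] f(1) mv_in by blast
    obtain m where m: "\<And>n x. m \<le> n \<Longrightarrow> x \<in> A n \<Longrightarrow>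
      (hz (mv q (f a)) = hz (f a) \<longleftrightarrow> hz (mv q (w n a x)) = hz (w n a x))" using hz_near by blast
    obtain x where x: "x \<in> A (max m (Suc n))" using ne by blast
    have "hz (mv q (f a)) \<noteq> hz (f a)"
      using m [OF _ x] rel [OF _ x] by simp
    with eq show ?thesis using f(1) cl_mv by simp
  qed
  have "\<forall>a b j. a j \<noteq> b j \<and> (\<forall>i. i \<noteq> j \<longrightarrow> a i = b i) \<longrightarrow> cl (f a) = cl (f b) \<and> hz (f a) \<noteq> hz (f b)"
  proof (intro allI impI)
    fix a b :: "nat \<Rightarrow> bool" and j assume ab: "a j \<noteq> b j \<and> (\<forall>i. i \<noteq> j \<longrightarrow> a i = b i)"
    show "cl (f a) = cl (f b) \<and> hz (f a) \<noteq> hz (f b)"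
    proof (cases "a j")
      case True
      then have "cl (f b) = cl (f a) \<and> hz (f b) \<noteq> hz (f a)" using step [of b j a] ab by auto
      then show ?thesis by auto
    next
      case False
      then show ?thesis using step [of a j b] ab by auto
    qed
  qed
  moreover have "\<forall>a b t. a \<noteq> b \<longrightarrow> f b \<noteq> mv (t, 0) (f a)"
  proof (intro allI impI)
    fix a b t assume "a \<noteq> (b :: nat \<Rightarrow> bool)"
    then obtain l where l: "a l \<noteq> b l" by (auto simp: fun_eq_iff)
    \<comment> \<open>Late enough for the words to differ and for the displacement \<open>t\<close>
      to be among those treated.\<close>
    define n where "n = max l (nat \<bar>t\<bar>)"
    have dif: "differs (Suc n) a b" "\<bar>t\<bar> \<le> int n" using l by (auto simp: differs_def n_def intro!: exI [of _ l])
    obtain i j j' where ij: "j \<noteq> j'"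
      "\<And>x. x \<in> A (Suc n) \<Longrightarrow> k (w (Suc n) b x) i = j"
      "\<And>x. x \<in> A (Suc n) \<Longrightarrow> k (mv (t, 0) (w (Suc n) a x)) i = j'"
      using uniformD(2) [OF unif dif] unfolding w_def by blast
    obtain m1 where m1: "\<And>n x. m1 \<le> n \<Longrightarrow> x \<in> A n \<Longrightarrow> k (f b) i = k (w n b x) i"
      using k_near [of i] by blast
    obtain m2 where m2: "\<And>n x. m2 \<le> n \<Longrightarrow> x \<in> A n \<Longrightarrow> k (mv (t, 0) (f a)) i = k (mv (t, 0) (w n a x)) i"
      using mv_near [of "(t, 0)" a i] by blast
    define m where "m = max (Suc n) (max m1 m2)"
    obtain x where x: "x \<in> A m" using ne by blast
    have m: "Suc n \<le> m" by (simp add: m_def)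
    have "k (f b) i = j"
      using m1 [of m x] x w_split [OF m x, of b] ij(2) by (auto simp: m_def)
    moreover have "k (mv (t, 0) (f a)) i = j'"
      using m2 [of m x] x w_split [OF m x, of a] ij(3) by (auto simp: m_def)
    ultimately show "f b \<noteq> mv (t, 0) (f a)" using ij(1) by auto
  qed
  ultimately show "\<exists>f :: (nat \<Rightarrow> bool) \<Rightarrow> 'a. f \<in> borel \<rightarrow>\<^sub>M M \<and>
     (\<forall>a b j. a j \<noteq> b j \<and> (\<forall>i. i \<noteq> j \<longrightarrow> a i = b i) \<longrightarrow> cl (f a) = cl (f b) \<and> hz (f a) \<noteq> hz (f b)) \<and>
     (\<forall>a b t. a \<noteq> b \<longrightarrow> f b \<noteq> mv (t, 0) (f a))"
    by blast
qed

end

declare split_paired_All [simp] split_paired_Ex [simp]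

section \<open>Straight lines in grids\<close>

definition taxi :: "int \<times> int \<Rightarrow> int \<times> int \<Rightarrow> int" where
  "taxi P Q = \<bar>fst P - fst Q\<bar> + \<bar>snd P - snd Q\<bar>"

text \<open>Besides the square lattice itself, this covers its quadrants.\<close>

locale grid =
  fixes G :: "'a rel" and K :: "'a set" and c :: "'a \<Rightarrow> int \<times> int" and I J :: "int set"
  assumes inj: "inj_on c K" and image: "c ` K = I \<times> J"
    and convI: "\<And>a b t. a \<in> I \<Longrightarrow> b \<in> I \<Longrightarrow> a \<le> t \<Longrightarrow> t \<le> b \<Longrightarrow> t \<in> I"
    and convJ: "\<And>a b t. a \<in> J \<Longrightarrow> b \<in> J \<Longrightarrow> a \<le> t \<Longrightarrow> t \<le> b \<Longrightarrow> t \<in> J"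
    and closed: "\<And>u v. (u, v) \<in> G \<Longrightarrow> u \<in> K \<longleftrightarrow> v \<in> K"
    and adj: "\<And>u v. u \<in> K \<Longrightarrow> v \<in> K \<Longrightarrow> (u, v) \<in> G \<longleftrightarrow> taxi (c u) (c v) = 1"
begin

text \<open>Lets every statement about rows be used for columns.\<close>

lemma transpose: "grid G K (prod.swap \<circ> c) J I"
proof
  show "inj_on (prod.swap \<circ> c) K" using inj by (simp add: inj_on_def) (metis swap_swap)
  show "(prod.swap \<circ> c) ` K = J \<times> I"
    unfolding image_comp [symmetric] image by (rule product_swap)
  show "(u, v) \<in> G \<longleftrightarrow> taxi ((prod.swap \<circ> c) u) ((prod.swap \<circ> c) v) = 1" if "u \<in> K" "v \<in> K" for u v
    using adj [OF that] by (simp add: taxi_def add.commute)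
qed (fact convI convJ closed)+

definition pt :: "int \<times> int \<Rightarrow> 'a" where
  "pt P = inv_into K c P"

lemma pt: "P \<in> I \<times> J \<Longrightarrow> pt P \<in> K \<and> c (pt P) = P"
  unfolding pt_def by (metis f_inv_into_f image inv_into_into)

lemma c_in: "x \<in> K \<Longrightarrow> c x \<in> I \<times> J"
  using image by blast

lemma pt_c: "x \<in> K \<Longrightarrow> pt (c x) = x"
  by (simp add: pt_def inj)

lemma is_path_Cons: "is_path G (x # y # p) \<longleftrightarrow> (x, y) \<in> G \<and> is_path G (y # p)"
  by (simp add: is_path_def)

lemma path_in: "is_path G p \<Longrightarrow> x \<in> set p \<Longrightarrow> x \<in> K \<longleftrightarrow> hd p \<in> K"
proof (induction p arbitrary: x)
  case (Cons u p)
  show ?case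
  proof (cases p)
    case (Cons v q)
    with Cons.prems have "(u, v) \<in> G" "is_path G p" by (auto simp: is_path_Cons)
    then have "x \<in> K \<longleftrightarrow> hd p \<in> K" if "x \<in> set p" using Cons.IH that by blast
    then show ?thesis using closed [OF \<open>(u, v) \<in> G\<close>] Cons.prems(2) Cons by auto
  qed (use Cons.prems in auto)
qed (simp add: is_path_def)

lemma path_length: "is_path G p \<Longrightarrow> hd p \<in> K \<Longrightarrow> taxi (c (hd p)) (c (last p)) < int (length p)"
proof (induction p)
  case (Cons u p)
  show ?case
  proof (cases p)
    case Nil then show ?thesis by (simp add: taxi_def)
  next
    case (Cons v q)
    with Cons.prems have uv: "(u, v) \<in> G" "is_path G p" "u \<in> K" by (auto simp: is_path_Cons)
    then have "v \<in> K" using closed by blast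
    with uv adj have "taxi (c u) (c v) = 1" by blast
    moreover have "taxi (c v) (c (last p)) < int (length p)"
      using Cons.IH uv \<open>v \<in> K\<close> Cons by simp
    ultimately show ?thesis using Cons by (simp add: taxi_def)
  qed
qed (simp add: is_path_def)

lemma path_exists:
  assumes "P \<in> I \<times> J" "Q \<in> I \<times> J"
  shows "\<exists>p. is_path G p \<and> c (hd p) = P \<and> hd p \<in> K \<and> c (last p) = Q \<and> int (length p) = taxi P Q + 1"
  using assms
proof (induction "nat (taxi P Q)" arbitrary: P)
  case 0
  then have "\<bar>fst P - fst Q\<bar> + \<bar>snd P - snd Q\<bar> \<le> 0" by (simp add: taxi_def)
  then have "P = Q" by (intro prod_eqI) linarith+
  with 0 pt [of Q] show ?case by (intro exI [of _ "[pt Q]"]) (auto simp: is_path_def taxi_def)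
next
  case (Suc n)
  have "\<exists>P' \<in> I \<times> J. taxi P P' = 1 \<and> taxi P' Q = taxi P Q - 1"
  proof (cases "fst P = fst Q")
    case False
    let ?P' = "(fst P + sgn (fst Q - fst P), snd P)"
    have "?P' \<in> I \<times> J"
      using Suc.prems False
        convI [of "fst P" "fst Q" "fst ?P'"] convI [of "fst Q" "fst P" "fst ?P'"]
      by (cases "fst P < fst Q") (auto simp: sgn_if)
    then show ?thesis using False by (intro bexI [of _ ?P']) (auto simp: taxi_def sgn_if)
  next
    case True
    then have ne: "snd P \<noteq> snd Q" using Suc.hyps(2) by (auto simp: taxi_def)
    let ?P' = "(fst P, snd P + sgn (snd Q - snd P))"
    have "?P' \<in> I \<times> J"
      using Suc.prems ne
        convJ [of "snd P" "snd Q" "snd ?P'"] convJ [of "snd Q" "snd P" "snd ?P'"]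
      by (cases "snd P < snd Q") (auto simp: sgn_if)
    then show ?thesis using ne by (intro bexI [of _ ?P']) (auto simp: taxi_def sgn_if)
  qed
  then obtain P' where P': "P' \<in> I \<times> J" "taxi P P' = 1" "taxi P' Q = taxi P Q - 1" by blast
  then have "n = nat (taxi P' Q)" using Suc.hyps(2) by simp
  then obtain p where p: "is_path G p" "c (hd p) = P'" "hd p \<in> K" "c (last p) = Q"
      "int (length p) = taxi P' Q + 1"
    using Suc.hyps(1) P' Suc.prems by blast
  then obtain x q where q: "p = x # q" by (cases p) (auto simp: is_path_def)
  have "(pt P, x) \<in> G" using adj [of "pt P" x] pt [OF Suc.prems(1)] p q P' by simp
  with p q P' pt [OF Suc.prems(1)] show ?case
    by (intro exI [of _ "pt P # p"]) (auto simp: is_path_Cons)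
qed

text \<open>Prescribing the first step yields two different shortest paths between points that share
  neither row nor column, so that no straight line joins them.\<close>

lemma path_exists_via:
  assumes "P \<in> I \<times> J" "Q \<in> I \<times> J" "P' \<in> I \<times> J" "taxi P P' = 1" "taxi P' Q = taxi P Q - 1"
  shows "\<exists>p. is_path G p \<and> hd p = pt P \<and> c (last p) = Q \<and> int (length p) = taxi P Q + 1 \<and> c (p ! 1) = P'"
proof -
  obtain p where p: "is_path G p" "c (hd p) = P'" "hd p \<in> K" "c (last p) = Q"
      "int (length p) = taxi P' Q + 1"
    using path_exists [OF assms(3,2)] by blast
  then obtain x q where q: "p = x # q" by (cases p) (auto simp: is_path_def)
  have "(pt P, x) \<in> G" using adj [of "pt P" x] pt [OF assms(1)] p q assms by simp
  with p q assms show ?thesis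
    by (intro exI [of _ "pt P # p"]) (auto simp: is_path_Cons)
qed

text \<open>A distance of \<open>n\<close> covered in at most \<open>n\<close> steps leaves no
  choice: each step must go by \<open>s\<close> along the row.\<close>

lemma straight_unique:
  assumes "is_path G q" "hd q \<in> K" "c (hd q) = (a, b)" "c (last q) = (a + s * int n, b)"
    "s = 1 \<or> s = -1" "length q \<le> Suc n"
  shows "map c q = map (\<lambda>i. (a + s * int i, b)) [0..<Suc n]"
  using assms
proof (induction n arbitrary: a q)
  case 0
  then obtain x where "q = [x]" by (cases q) (auto simp: is_path_def)
  with 0 show ?case by simp
next
  case (Suc n)
  obtain x r where q: "q = x # r" using Suc.prems(1) by (cases q) (auto simp: is_path_def)
  have "r \<noteq> []" using Suc.prems q by auto
  then obtain y r' where r: "r = y # r'" by (cases r) auto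
  have xy: "(x, y) \<in> G" "is_path G r" using Suc.prems q r by (auto simp: is_path_Cons)
  then have K: "x \<in> K" "y \<in> K" using closed Suc.prems q by auto
  obtain a' b' where y: "c y = (a', b')" by fastforce
  have "taxi (a, b) (a', b') = 1" using adj [OF K] xy Suc.prems q y by simp
  moreover have "taxi (a', b') (a + s * int (Suc n), b) \<le> int n"
    using path_length [OF xy(2)] K r q y Suc.prems by simp
  ultimately have "a' = a + s" "b' = b" using Suc.prems(5) by (auto simp: taxi_def)
  then have "map c r = map (\<lambda>i. (a + s + s * int i, b)) [0..<Suc n]"
    using Suc.prems q r y K xy by (intro Suc.IH) (auto simp: algebra_simps)
  moreover have "[0..<Suc (Suc n)] = 0 # map Suc [0..<Suc n]"
    by (simp add: map_Suc_upt upt_conv_Cons del: upt_Suc)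
  ultimately show ?case using q Suc.prems by (simp add: algebra_simps)
qed

definition seg :: "int \<times> int \<Rightarrow> int \<times> int \<Rightarrow> nat \<Rightarrow> 'a list" where
  "seg P d n = map (\<lambda>i. pt (fst P + fst d * int i, snd P + snd d * int i)) [0..<Suc n]"

lemma straight_line_hseg:
  assumes on: "\<And>i. i \<le> n \<Longrightarrow> (a + s * int i, b) \<in> I \<times> J" and s: "s = 1 \<or> s = -1"
  shows "straight_line G (seg (a, b) (s, 0) n)"
proof -
  let ?p = "seg (a, b) (s, 0) n"
  let ?f = "\<lambda>i. pt (a + s * int i, b)"
  have p: "?p = map ?f [0..<Suc n]" by (simp add: seg_def)
  have f: "?f i \<in> K" "c (?f i) = (a + s * int i, b)" if "i \<le> n" for i
    using pt [OF on [OF that]] by auto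
  have "successively (\<lambda>u v. (u, v) \<in> G) ?p"
    unfolding successively_conv_nth
  proof (intro allI impI)
    fix i assume "Suc i < length ?p"
    then have i: "Suc i \<le> n" by (simp add: p)
    then have "taxi (c (?f i)) (c (?f (Suc i))) = 1"
      using s f [of i] f [of "Suc i"] by (auto simp: taxi_def algebra_simps)
    then show "(?p ! i, ?p ! Suc i) \<in> G"
      using adj [of "?f i" "?f (Suc i)"] f [of i] f [of "Suc i"] i by (simp add: p nth_map_upt del: upt_Suc)
  qed
  then have path: "is_path G ?p" by (simp add: is_path_def p)
  have ends: "hd ?p = ?f 0" "last ?p = ?f n"
    by (simp_all add: p hd_conv_nth last_conv_nth nth_map_upt del: upt_Suc)
  have mapc: "map c ?p = map (\<lambda>i. (a + s * int i, b)) [0..<Suc n]"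
    using f by (simp add: p)
  show ?thesis
    unfolding straight_line_def
  proof (intro conjI allI impI path)
    fix q assume q: "is_path G q \<and> hd q = hd ?p \<and> last q = last ?p \<and> length q \<le> length ?p"
    then have "map c q = map c ?p"
      unfolding mapc using f [of 0] f [of n] ends s
      by (intro straight_unique) (auto simp: p)
    moreover have "set q \<subseteq> K" using q path_in [of q] f [of 0] ends by auto
    moreover have "set ?p \<subseteq> K" using f by (auto simp: p)
    ultimately show "q = ?p" using inj by (metis inj_on_map_eq_map inj_on_subset le_sup_iff)
  qed
qed

lemma straight_line_vseg:
  assumes on: "\<And>i. i \<le> n \<Longrightarrow> (a, b + s * int i) \<in> I \<times> J" and s: "s = 1 \<or> s = -1"
  shows "straight_line G (seg (a, b) (0, s) n)"
proof -
  interpret t: grid G K "prod.swap \<circ> c" J I by (rule transpose)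
  have eq: "t.pt (v, u) = pt (u, v)" if "(u, v) \<in> I \<times> J" for u v
    using pt [OF that] t.pt [of "(v, u)"] that inj by (auto simp: inj_on_def prod_eq_iff)
  have "straight_line G (t.seg (b, a) (s, 0) n)"
    using on s by (intro t.straight_line_hseg) auto
  also have "t.seg (b, a) (s, 0) n = seg (a, b) (0, s) n"
    by (auto simp: t.seg_def seg_def intro!: eq on)
  finally show ?thesis .
qed

text \<open>The row segment between the endpoints is a path of minimal length, so the uniqueness in
  \<open>straight_line\<close> makes it equal to \<open>p\<close>.\<close>

lemma straight_line_row:
  assumes p: "straight_line G p" "hd p \<in> K" and "snd (c (hd p)) = snd (c (last p))" "z \<in> set p"
  shows "snd (c z) = snd (c (hd p))"
proof -
  obtain a b where ab: "c (hd p) = (a, b)" by fastforce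
  then obtain a' where a': "c (last p) = (a', b)" using assms(3) by (cases "c (last p)") auto
  define n where "n = nat \<bar>a' - a\<bar>"
  define s :: int where "s = (if a' < a then -1 else 1)"
  have s: "s = 1 \<or> s = -1" "a' = a + s * int n" by (auto simp: s_def n_def)
  have path: "is_path G p" using p by (simp add: straight_line_def)
  have "last p \<in> K" using path_in [OF path, of "last p"] p path by (auto simp: is_path_def)
  then obtain q where q: "is_path G q" "c (hd q) = (a, b)" "hd q \<in> K" "c (last q) = (a', b)"
      "int (length q) = taxi (a, b) (a', b) + 1"
    using path_exists [of "(a, b)" "(a', b)"] c_in [OF p(2)] c_in [of "last p"] ab a' by auto
  have len: "length q = Suc n" using q by (auto simp: taxi_def n_def)
  have "hd q = hd p" "last q = last p"
  proof -
    have "last q \<in> K" using path_in [OF q(1), of "last q"] q(1,3) by (auto simp: is_path_def)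
    then show "hd q = hd p" "last q = last p"
      using q ab a' inj p(2) \<open>last p \<in> K\<close> by (metis inj_onD)+
  qed
  moreover have "length q \<le> length p"
    using path_length [OF path p(2)] ab a' len by (simp add: taxi_def n_def)
  ultimately have "q = p" using p q unfolding straight_line_def by blast
  then have "map c p = map (\<lambda>i. (a + s * int i, b)) [0..<Suc n]"
    using q s len by (intro straight_unique) auto
  moreover have "c z \<in> set (map c p)" using assms(4) by simp
  ultimately show ?thesis using ab by auto
qed

lemma straight_line_cases:
  assumes p: "straight_line G p" "hd p \<in> K" "x \<in> set p" "y \<in> set p"
  shows "fst (c x) = fst (c y) \<or> snd (c x) = snd (c y)"
proof (cases "snd (c (hd p)) = snd (c (last p))")
  case True
  then show ?thesis using straight_line_row assms by metis
next
  case False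
  interpret t: grid G K "prod.swap \<circ> c" J I by (rule transpose)
  have "fst (c (hd p)) = fst (c (last p))"
  proof (rule ccontr)
    \<comment> \<open>A shortest path may then start with a horizontal or with a vertical step. Both
      kinds would have to be \<open>p\<close>, whose second vertex cannot be in two places.\<close>
    assume ne: "fst (c (hd p)) \<noteq> fst (c (last p))"
    have path: "is_path G p" using p by (simp add: straight_line_def)
    then have lK: "last p \<in> K" using path_in [OF path, of "last p"] p by (auto simp: is_path_def)
    obtain a b where ab: "c (hd p) = (a, b)" by fastforce
    obtain a' b' where ab': "c (last p) = (a', b')" by fastforce
    have on: "(a, b) \<in> I \<times> J" "(a', b') \<in> I \<times> J"
      using c_in [OF p(2)] c_in [OF lK] ab ab' by auto
    have 1: "(a + sgn (a' - a), b) \<in> I \<times> J" "(a, b + sgn (b' - b)) \<in> I \<times> J"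
      using on convI [of a a' "a + 1"] convI [of a' a "a - 1"] convJ [of b b' "b + 1"] convJ [of b' b "b - 1"]
      by (auto simp: sgn_if)
    have ends: "hd q = hd p" "last q = last p"
      if "is_path G q" "hd q = pt (a, b)" "c (last q) = (a', b')" for q
    proof -
      show "hd q = hd p" using that pt_c [OF p(2)] ab by simp
      then have "last q \<in> K" using path_in [OF that(1), of "last q"] p(2) that(1) by (auto simp: is_path_def)
      then show "last q = last p" using that ab' inj lK by (metis inj_onD)
    qed
    have eq: "q = p" if "is_path G q" "hd q = pt (a, b)" "c (last q) = (a', b')"
      "int (length q) = taxi (a, b) (a', b') + 1" for q
    proof -
      have "length q \<le> length p" using path_length [OF path p(2)] ab ab' that(4) by simp
      with ends [OF that(1-3)] that(1) p(1) show ?thesis unfolding straight_line_def by blast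
    qed
    have "c (p ! 1) = (a + sgn (a' - a), b)"
      using path_exists_via [OF on 1(1)] eq ne ab ab' by (auto simp: taxi_def sgn_if split: if_splits)
    moreover have "c (p ! 1) = (a, b + sgn (b' - b))"
      using path_exists_via [OF on 1(2)] eq False ab ab' by (auto simp: taxi_def sgn_if split: if_splits)
    ultimately show False using ne ab ab' by (simp add: sgn_if split: if_splits)
  qed
  then show ?thesis using t.straight_line_row [OF p(1,2)] p(3,4) by auto
qed

lemma collinear_row:
  assumes "x \<in> K" "y \<in> K" "snd (c x) = snd (c y)"
  shows "collinear_in G x y"
proof -
  obtain a b where x: "c x = (a, b)" by fastforce
  then obtain a' where y: "c y = (a', b)" using assms by (cases "c y") auto
  have on: "(a, b) \<in> I \<times> J" "(a', b) \<in> I \<times> J" using c_in assms x y by metis+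
  define n where "n = nat \<bar>a' - a\<bar>"
  define s :: int where "s = (if a' < a then -1 else 1)"
  have s: "s = 1 \<or> s = -1" "a' = a + s * int n" by (auto simp: s_def n_def)
  have "(a + s * int i, b) \<in> I \<times> J" if "i \<le> n" for i
    using on that convI [of a a' "a + s * int i"] convI [of a' a "a + s * int i"]
    by (auto simp: s_def n_def split: if_splits)
  then have "straight_line G (seg (a, b) (s, 0) n)" using s by (intro straight_line_hseg) auto
  moreover have "x \<in> set (seg (a, b) (s, 0) n)"
    using pt_c [OF assms(1)] x by (auto simp: seg_def simp del: upt_Suc intro!: image_eqI [of _ _ 0])
  moreover have "y \<in> set (seg (a, b) (s, 0) n)"
    using pt_c [OF assms(2)] y s by (auto simp: seg_def simp del: upt_Suc intro!: image_eqI [of _ _ n])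
  ultimately show ?thesis by (auto simp: collinear_in_def)
qed

lemma collinear_iff:
  assumes "x \<in> K" "y \<in> K"
  shows "collinear_in G x y \<longleftrightarrow> fst (c x) = fst (c y) \<or> snd (c x) = snd (c y)"
proof
  assume "collinear_in G x y"
  then obtain p where p: "straight_line G p" "x \<in> set p" "y \<in> set p" by (auto simp: collinear_in_def)
  then have "hd p \<in> K" using path_in [of p x] assms by (auto simp: straight_line_def)
  with p show "fst (c x) = fst (c y) \<or> snd (c x) = snd (c y)" using straight_line_cases by blast
next
  interpret t: grid G K "prod.swap \<circ> c" J I by (rule transpose)
  assume "fst (c x) = fst (c y) \<or> snd (c x) = snd (c y)"
  then show "collinear_in G x y"
    using collinear_row [OF assms] t.collinear_row [OF assms] by auto
qed

lemma collinear_same: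
  assumes "x \<in> K" "collinear_in G x y"
  shows "y \<in> K"
  using assms path_in unfolding collinear_in_def straight_line_def by metis

end

section \<open>Parallel and perpendicular edges in the square lattice\<close>

lemma path_edges_map_upt:
  "path_edges (map f [0..<Suc n]) = {(f i, f (Suc i)) |i. i < n}"
proof -
  have "tl (map f [0..<Suc n]) = map (\<lambda>i. f (Suc i)) [0..<n]"
    by (rule nth_equalityI) (auto simp: nth_tl nth_map_upt simp del: upt_Suc)
  moreover have "zip (map f [0..<Suc n]) (map (\<lambda>i. f (Suc i)) [0..<n]) = map (\<lambda>i. (f i, f (Suc i))) [0..<n]"
    by (rule nth_equalityI) (auto simp: nth_map_upt simp del: upt_Suc)
  ultimately show ?thesis by (auto simp: path_edges_def)
qed

locale full_grid = grid G K c UNIV UNIV for G :: "'a rel" and K c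
begin

lemma pt_full [simp]: "pt P \<in> K" "c (pt P) = P"
  using pt [of P] by auto

lemma seg_edges:
  "path_edges (seg P d n) = {(pt (fst P + fst d * int i, snd P + snd d * int i),
     pt (fst P + fst d * int (Suc i), snd P + snd d * int (Suc i))) |i. i < n}"
  by (simp only: seg_def path_edges_map_upt)

lemma seg_ends:
  "hd (seg P d n) = pt P" "last (seg P d n) = pt (fst P + fst d * int n, snd P + snd d * int n)"
  "length (seg P d n) = Suc n"
  "map c (butlast (seg P d n)) = map (\<lambda>i. (fst P + fst d * int i, snd P + snd d * int i)) [0..<n]"
proof -
  show "hd (seg P d n) = pt P"
    by (simp add: seg_def hd_conv_nth nth_map_upt del: upt_Suc)
qed (auto simp: seg_def butlast_append)

lemma parallel_rows:
  assumes K: "x \<in> K" "y \<in> K" "x' \<in> K" "y' \<in> K" and s: "s = 1 \<or> s = (-1::int)"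
    and xy: "c x = (a, b)" "c y = (a + s, b)" "c x' = (a', b')" "c y' = (a' + s, b')"
  shows "parallel_edges G (x, y) (x', y')"
proof -
  \<comment> \<open>A common segment: starting at \<open>lo\<close> in direction \<open>s\<close>,
    with length \<open>n\<close>, it covers the first coordinates of both edges.\<close>
  have "\<exists>lo n i i'. a = lo + s * int i \<and> a' = lo + s * int i' \<and> i < n \<and> i' < n"
  proof (cases "s * a \<le> s * a'")
    case True
    then have "a = a + s * int 0 \<and> a' = a + s * int (nat (s * (a' - a)))"
      using s by auto
    then show ?thesis by (meson lessI max.strict_coboundedI1 max.strict_coboundedI2)
  next
    case False
    then have "a = a' + s * int (nat (s * (a - a'))) \<and> a' = a' + s * int 0"
      using s by auto
    then show ?thesis by (meson lessI max.strict_coboundedI1 max.strict_coboundedI2)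
  qed
  then obtain lo n i i' where i: "a = lo + s * int i" "a' = lo + s * int i'" "i < n" "i' < n"
    by blast
  have pts: "x = pt (a, b)" "y = pt (a + s, b)" "x' = pt (a', b')" "y' = pt (a' + s, b')"
    using pt_c K xy by metis+
  show ?thesis
  proof (cases "b = b'")
    case True
    have "straight_line G (seg (lo, b) (s, 0) n)" using s by (intro straight_line_hseg) auto
    moreover have "(x, y) \<in> path_edges (seg (lo, b) (s, 0) n)"
      unfolding seg_edges using i pts by (auto intro!: exI [of _ i] simp: algebra_simps)
    moreover have "(x', y') \<in> path_edges (seg (lo, b) (s, 0) n)"
      unfolding seg_edges using i pts True by (auto intro!: exI [of _ i'] simp: algebra_simps)
    ultimately show ?thesis by (auto simp: parallel_edges_def)
  next
    case False
    define m where "m = nat \<bar>b' - b\<bar>"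
    define t :: int where "t = (if b' < b then -1 else 1)"
    have t: "t = 1 \<or> t = -1" "b' = b + t * int m" "m > 0" using False by (auto simp: t_def m_def)
    have n: "n > 0" using i by simp
    \<comment> \<open>The sides follow the boundary of the rectangle, so \<open>?p0\<close> and
      \<open>?p2\<close> run in opposite directions. This fits the definition of parallel edges,
      which puts the reversed edge on one of the sides.\<close>
    let ?p0 = "seg (lo + s * int n, b) (-s, 0) n" and ?p1 = "seg (lo, b) (0, t) m"
      and ?p2 = "seg (lo, b') (s, 0) n" and ?p3 = "seg (lo + s * int n, b') (0, -t) m"
    have "straight_line G ?p0" "straight_line G ?p1" "straight_line G ?p2" "straight_line G ?p3"
      using s t by (auto intro!: straight_line_hseg straight_line_vseg)
    moreover have "distinct (butlast ?p0 @ butlast ?p1 @ butlast ?p2 @ butlast ?p3)"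
    proof -
      have "distinct (map c (butlast ?p0 @ butlast ?p1 @ butlast ?p2 @ butlast ?p3))"
        using s t(1) False n t(3) unfolding map_append seg_ends
        by (auto simp: distinct_map inj_on_def t(2))
      then show ?thesis unfolding distinct_map by blast
    qed
    ultimately have "rectangle G ?p0 ?p1 ?p2 ?p3"
      using n t by (auto simp: rectangle_def seg_ends)
    moreover have "(y, x) \<in> path_edges ?p0"
      unfolding seg_edges using i pts n
      by (auto intro!: exI [of _ "n - 1 - i"] simp: of_nat_diff algebra_simps)
    moreover have "(x', y') \<in> path_edges ?p2"
      unfolding seg_edges using i pts by (auto intro!: exI [of _ i'] simp: algebra_simps)
    ultimately have "opposite G (y, x) (x', y')" unfolding opposite_def by blast
    then show ?thesis by (simp add: parallel_edges_def)
  qed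
qed

lemma rows_not_perp:
  assumes K: "x \<in> K" "y \<in> K" "x' \<in> K" "y' \<in> K" and "(x, y) \<in> G" "(x', y') \<in> G"
    and "snd (c x) = snd (c y)" "snd (c x') = snd (c y')"
  shows "parallel_edges G (x, y) (x', y') \<or> antiparallel_edges G (x, y) (x', y')"
proof -
  obtain a b where x: "c x = (a, b)" by fastforce
  obtain a' b' where x': "c x' = (a', b')" by fastforce
  have "taxi (c x) (c y) = 1" "taxi (c x') (c y') = 1" using assms adj by blast+
  then obtain s s' :: int where s: "s = 1 \<or> s = -1" "c y = (a + s, b)" "s' = 1 \<or> s' = -1" "c y' = (a' + s', b')"
    using assms(7,8) x x' by (cases "c y"; cases "c y'") (auto simp: taxi_def, smt (verit))
  show ?thesis
  proof (cases "s = s'")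
    case True
    then show ?thesis using parallel_rows [OF K s(1) x s(2) x'] s by simp
  next
    case False
    then have "c x = (a + s + s', b)" "c y = (a + s, b)" using s x by auto
    then show ?thesis
      using parallel_rows [OF K(2,1,3,4) s(3) s(2) _ x' s(4)] by (simp add: antiparallel_edges_def)
  qed
qed

text \<open>Every edge runs along a row or a column, and two edges of the same kind are parallel or
  anti-parallel.\<close>

lemma perp_rows:
  assumes "((x, y), (x', y')) \<in> perp_graph G" "x \<in> K" "x' \<in> K"
  shows "(snd (c x) = snd (c y)) \<noteq> (snd (c x') = snd (c y'))"
proof
  interpret t: full_grid G K "prod.swap \<circ> c"
    using transpose by (simp add: full_grid_def)
  have G: "(x, y) \<in> G" "(x', y') \<in> G" using assms by (auto simp: perp_graph_def)
  then have K: "y \<in> K" "y' \<in> K" using closed assms by blast+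
  have "taxi (c x) (c y) = 1" "taxi (c x') (c y') = 1" using assms adj G K by blast+
  moreover assume "(snd (c x) = snd (c y)) = (snd (c x') = snd (c y'))"
  ultimately consider "snd (c x) = snd (c y)" "snd (c x') = snd (c y')"
    | "fst (c x) = fst (c y)" "fst (c x') = fst (c y')"
    by (auto simp: taxi_def)
  then have "parallel_edges G (x, y) (x', y') \<or> antiparallel_edges G (x, y) (x', y')"
    using rows_not_perp [OF assms(2) K(1) assms(3) K(2) G] t.rows_not_perp [OF assms(2) K(1) assms(3) K(2) G]
    by cases auto
  with assms(1) show False by (auto simp: perp_graph_def)
qed

end

section \<open>The Gray code and \<open>S\<^sub>0\<close>\<close>

text \<open>The \<open>L_graph\<close> is the Gray code: among the points with a common tail after the first \<open>n\<close>
  digits, it is a path on which \<open>gray n\<close> gives the position.\<close>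

primrec gray :: "nat \<Rightarrow> (nat \<Rightarrow> bool) \<Rightarrow> int" where
  "gray 0 a = 0"
| "gray (Suc n) a = (if a n then 2 ^ Suc n - 1 - gray n a else gray n a)"

lemma gray_range: "0 \<le> gray n a \<and> gray n a < 2 ^ n"
  by (induction n) auto

lemma gray_eq_0: "gray n a = 0 \<longleftrightarrow> (\<forall>i<n. \<not> a i)"
proof (induction n)
  case (Suc n)
  then show ?case using gray_range [of n a] by (auto simp: less_Suc_eq)
qed simp

text \<open>The word \<open>s_word n\<close> comes last on the path of \<open>n\<close> digits. The
  path of \<open>Suc n\<close> digits is this path followed by its mirror image, joined at this
  end.\<close>

lemma gray_top: "gray n a = 2 ^ n - 1 \<longleftrightarrow> (\<forall>i<n. a i \<longleftrightarrow> Suc i = n)"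
proof (cases n)
  case (Suc m)
  then have "gray n a = 2 ^ n - 1 \<longleftrightarrow> a m \<and> gray m a = 0"
    using gray_range [of m a] by auto
  then show ?thesis by (auto simp: Suc gray_eq_0 less_Suc_eq)
qed simp

definition same_from :: "nat \<Rightarrow> (nat \<Rightarrow> bool) \<Rightarrow> (nat \<Rightarrow> bool) \<Rightarrow> bool" where
  "same_from n a b \<longleftrightarrow> (\<forall>i\<ge>n. a i = b i)"

lemma same_from_Suc:
  assumes "same_from (Suc n) a b" "a n = b n"
  shows "same_from n a b"
  unfolding same_from_def
proof (intro allI impI)
  fix i assume "n \<le> i"
  then show "a i = b i" using assms by (cases "i = n") (auto simp: same_from_def)
qed

lemma gray_inj: "same_from n a b \<Longrightarrow> gray n a = gray n b \<Longrightarrow> a = b"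
proof (induction n)
  case (Suc n)
  have "a n = b n"
    using Suc.prems gray_range [of n a] gray_range [of n b] by (auto split: if_splits)
  with Suc same_from_Suc show ?case by (auto split: if_splits)
qed (auto simp: same_from_def)

lemma gray_surj: "0 \<le> r \<Longrightarrow> r < 2 ^ n \<Longrightarrow> \<exists>a. same_from n a x \<and> gray n a = r"
proof (induction n arbitrary: r x)
  case (Suc n)
  define r' where "r' = (if r < 2 ^ n then r else 2 ^ Suc n - 1 - r)"
  have "0 \<le> r'" "r' < 2 ^ n" using Suc.prems by (auto simp: r'_def)
  from Suc.IH [OF this]
  obtain a where a: "same_from n a (x(n := \<not> r < 2 ^ n))" "gray n a = r'" by blast
  then have "a n \<longleftrightarrow> \<not> r < 2 ^ n" by (auto simp: same_from_def)
  with a have "same_from (Suc n) a x" "gray (Suc n) a = r" by (auto simp: same_from_def r'_def)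
  then show ?case by blast
qed (auto simp: same_from_def)

lemma length_s_word: "length (s_word n) = n"
  by (cases n) auto

lemma s_word_nth: "i < n \<Longrightarrow> s_word n ! i \<longleftrightarrow> Suc i = n"
  by (cases n) (auto simp: nth_append)

lemma s_word_conc:
  "(s_word n \<frown> (c ## z)) i = (if i < n then Suc i = n else if i = n then c else z (i - Suc n))"
proof -
  consider "i < n" | "i = n" | m where "i = n + Suc m"
    by (metis add_Suc_right less_iff_Suc_add linorder_neqE_nat)
  then show ?thesis
    by cases (simp_all add: conc_def length_s_word s_word_nth)
qed

definition L_edge :: "nat \<Rightarrow> (nat \<Rightarrow> bool) \<Rightarrow> (nat \<Rightarrow> bool) \<Rightarrow> bool" where
  "L_edge j a b \<longleftrightarrow> (\<forall>i<j. a i \<longleftrightarrow> Suc i = j) \<and> a j \<noteq> b j \<and> (\<forall>i. i \<noteq> j \<longrightarrow> a i = b i)"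

lemma L_graph_iff: "(a, b) \<in> L_graph \<longleftrightarrow> (\<exists>j. L_edge j a b)"
proof
  assume "(a, b) \<in> L_graph"
  then obtain z n where ab: "{a, b} = {s_word n \<frown> [False] \<frown> z, s_word n \<frown> [True] \<frown> z}"
    by (auto simp: L_graph_def)
  then obtain c where "a = s_word n \<frown> (c ## z)" "b = s_word n \<frown> ((\<not> c) ## z)"
    by (auto simp: doubleton_eq_iff)
  then have "L_edge n a b" by (auto simp: L_edge_def s_word_conc)
  then show "\<exists>j. L_edge j a b" ..
next
  assume "\<exists>j. L_edge j a b"
  then obtain j where j: "L_edge j a b" ..
  define z where "z i = a (i + Suc j)" for i
  have *: "d i = (s_word j \<frown> (d j ## z)) i"
    if "\<And>i. i < j \<Longrightarrow> d i \<longleftrightarrow> Suc i = j" "\<And>i. i > j \<Longrightarrow> d i = a i" for d i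
  proof -
    consider "i < j" | "i = j" | "i > j" by linarith
    then show ?thesis
    proof cases
      case 1
      then show ?thesis using that(1) [OF 1] by (simp add: s_word_conc)
    next
      case 3
      then show ?thesis using that(2) [OF 3] by (simp add: s_word_conc z_def)
    qed (simp add: s_word_conc)
  qed
  have "a i = (s_word j \<frown> (a j ## z)) i" for i
    using j by (intro *) (auto simp: L_edge_def)
  moreover have "b i = (s_word j \<frown> (b j ## z)) i" for i
    using j by (intro *) (auto simp: L_edge_def)
  ultimately have "a = s_word j \<frown> (a j ## z)" "b = s_word j \<frown> (b j ## z)"
    unfolding fun_eq_iff by blast+
  moreover have "b j = (\<not> a j)" using j by (auto simp: L_edge_def)
  ultimately have "{a, b} = {s_word j \<frown> [False] \<frown> z, s_word j \<frown> [True] \<frown> z}"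
    by (cases "a j") auto
  then show "(a, b) \<in> L_graph" by (auto simp: L_graph_def)
qed

text \<open>An edge between the two halves changes the digit \<open>n\<close>, so the digits before
  it are \<open>s_word n\<close> on both sides: the ends at which the halves are joined. Within a
  half, reflection preserves distances.\<close>

lemma L_graph_gray:
  "same_from n a b \<Longrightarrow> (a, b) \<in> L_graph \<longleftrightarrow> \<bar>gray n a - gray n b\<bar> = 1"
proof (induction n)
  case 0
  then have "a = b" by (auto simp: same_from_def)
  then show ?case by (auto simp: L_graph_iff L_edge_def)
next
  case (Suc n)
  show ?case
  proof (cases "a n = b n")
    case True
    then show ?thesis using Suc same_from_Suc [OF Suc.prems True] by auto
  next
    case False
    have "(a, b) \<in> L_graph \<longleftrightarrow> (\<forall>i<n. a i \<longleftrightarrow> Suc i = n) \<and> (\<forall>i<n. b i \<longleftrightarrow> Suc i = n)"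
    proof
      assume "(a, b) \<in> L_graph"
      then obtain j where j: "L_edge j a b" unfolding L_graph_iff ..
      have "j = n"
      proof (rule ccontr)
        assume "j \<noteq> n"
        with j False show False by (auto simp: L_edge_def)
      qed
      with j show "(\<forall>i<n. a i \<longleftrightarrow> Suc i = n) \<and> (\<forall>i<n. b i \<longleftrightarrow> Suc i = n)"
        by (auto simp: L_edge_def)
    next
      assume r: "(\<forall>i<n. a i \<longleftrightarrow> Suc i = n) \<and> (\<forall>i<n. b i \<longleftrightarrow> Suc i = n)"
      have "a i = b i" if "i \<noteq> n" for i
        using r that Suc.prems by (cases "i < n") (auto simp: same_from_def)
      with r False have "L_edge n a b" by (simp add: L_edge_def)
      then show "(a, b) \<in> L_graph" unfolding L_graph_iff ..
    qed
    also have "\<dots> \<longleftrightarrow> gray n a = 2 ^ n - 1 \<and> gray n b = 2 ^ n - 1"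
      by (simp add: gray_top)
    also have "\<dots> \<longleftrightarrow> \<bar>gray (Suc n) a - gray (Suc n) b\<bar> = 1"
      using False gray_range [of n a] gray_range [of n b] by (cases "a n") (simp_all, linarith+)
    finally show ?thesis .
  qed
qed

text \<open>A set digit reflects the path built so far, so the sign is the orientation of that path
  within the component.\<close>

primrec gray_sign :: "nat \<Rightarrow> (nat \<Rightarrow> bool) \<Rightarrow> int" where
  "gray_sign 0 x = 1"
| "gray_sign (Suc n) x = (if x n then - gray_sign n x else gray_sign n x)"

lemma abs_gray_sign: "gray_sign n x = 1 \<or> gray_sign n x = -1"
  by (induction n) auto

definition tail_class :: "(nat \<Rightarrow> bool) \<Rightarrow> (nat \<Rightarrow> bool) set" where
  "tail_class x = {a. \<exists>n. same_from n a x}"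

text \<open>The position along the component of \<open>x\<close>, relative to \<open>x\<close>. The sign makes it independent of
  the number \<open>n\<close> of digits considered.\<close>

definition gray_pos :: "(nat \<Rightarrow> bool) \<Rightarrow> (nat \<Rightarrow> bool) \<Rightarrow> int" where
  "gray_pos x a = (let n = LEAST n. same_from n a x in gray_sign n x * (gray n a - gray n x))"

lemma same_from_mono: "same_from m a b \<Longrightarrow> m \<le> n \<Longrightarrow> same_from n a b"
  by (auto simp: same_from_def)

lemma gray_pos_eq:
  assumes "same_from n a x"
  shows "gray_pos x a = gray_sign n x * (gray n a - gray n x)"
proof -
  define m where "m = (LEAST n. same_from n a x)"
  have m: "same_from m a x" "m \<le> n"
    using assms by (auto simp: m_def intro: LeastI Least_le)
  have "gray_sign n x * (gray n a - gray n x) = gray_sign m x * (gray m a - gray m x)"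
    using m(2)
  proof (induction n rule: dec_induct)
    case (step k)
    \<comment> \<open>From \<open>m\<close> on the points share their digits; a set digit reflects
      both positions and changes the sign of their difference, as it does with
      \<open>gray_sign\<close>.\<close>
    then have "a k = x k" using m by (auto simp: same_from_def)
    with step show ?case by (auto simp: algebra_simps)
  qed simp
  then show ?thesis by (simp add: gray_pos_def m_def Let_def)
qed

lemma tail_class_common:
  assumes "a \<in> tail_class x" "b \<in> tail_class x"
  obtains n where "same_from n a x" "same_from n b x" "same_from n a b"
proof -
  obtain m n where "same_from m a x" "same_from n b x" using assms by (auto simp: tail_class_def)
  then have "same_from (max m n) a x" "same_from (max m n) b x"
    by (auto intro: same_from_mono)
  moreover from this have "same_from (max m n) a b" by (auto simp: same_from_def)
  ultimately show ?thesis by (rule that)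
qed

lemma gray_pos_diff:
  assumes "same_from n a x" "same_from n b x"
  shows "\<bar>gray_pos x a - gray_pos x b\<bar> = \<bar>gray n a - gray n b\<bar>"
  using gray_pos_eq [OF assms(1)] gray_pos_eq [OF assms(2)] abs_gray_sign [of n x] by auto

lemma gray_pos_inj:
  assumes "a \<in> tail_class x" "b \<in> tail_class x" "gray_pos x a = gray_pos x b"
  shows "a = b"
proof -
  obtain n where n: "same_from n a x" "same_from n b x" "same_from n a b"
    using tail_class_common [OF assms(1,2)] .
  then show ?thesis using gray_inj [OF n(3)] gray_pos_diff [OF n(1,2)] assms(3) by simp
qed

lemma L_graph_pos:
  assumes "a \<in> tail_class x" "b \<in> tail_class x"
  shows "(a, b) \<in> L_graph \<longleftrightarrow> \<bar>gray_pos x a - gray_pos x b\<bar> = 1"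
proof -
  obtain n where n: "same_from n a x" "same_from n b x" "same_from n a b"
    using tail_class_common [OF assms] .
  then show ?thesis using L_graph_gray [OF n(3)] gray_pos_diff [OF n(1,2)] by simp
qed

lemma gray_pos_convex:
  assumes "a \<in> tail_class x" "b \<in> tail_class x" "gray_pos x a \<le> t" "t \<le> gray_pos x b"
  shows "\<exists>d\<in>tail_class x. gray_pos x d = t"
proof -
  obtain n where n: "same_from n a x" "same_from n b x"
    using tail_class_common [OF assms(1,2)] .
  \<comment> \<open>The sign is its own inverse, so this is the Gray value that belongs to the
    position \<open>t\<close>; it lies between two admissible values.\<close>
  define r where "r = gray_sign n x * t + gray n x"
  have "(gray n a \<le> r \<and> r \<le> gray n b) \<or> (gray n b \<le> r \<and> r \<le> gray n a)"
    using gray_pos_eq [OF n(1)] gray_pos_eq [OF n(2)] assms(3,4) abs_gray_sign [of n x]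
    by (auto simp: r_def)
  then have "0 \<le> r" "r < 2 ^ n" using gray_range [of n a] gray_range [of n b] by linarith+
  then obtain d where d: "same_from n d x" "gray n d = r" using gray_surj by blast
  then have "gray_pos x d = t" using gray_pos_eq [OF d(1)] abs_gray_sign [of n x] by (auto simp: r_def)
  with d show ?thesis by (auto simp: tail_class_def)
qed

lemma L_graph_flip:
  assumes "(a, b) \<in> L_graph"
  obtains j where "a j \<noteq> b j" "\<And>i. i \<noteq> j \<Longrightarrow> a i = b i"
  using assms unfolding L_graph_iff L_edge_def by auto

lemma tail_class_change:
  assumes "\<And>i. i \<noteq> j \<Longrightarrow> a i = b i" "a \<in> tail_class x"
  shows "b \<in> tail_class x"
proof -
  obtain n where "same_from n a x" using assms(2) by (auto simp: tail_class_def)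
  with assms(1) have "same_from (max n (Suc j)) b x" by (auto simp: same_from_def)
  then show ?thesis by (auto simp: tail_class_def)
qed

lemma L_graph_tail_class:
  assumes "(a, b) \<in> L_graph"
  shows "a \<in> tail_class x \<longleftrightarrow> b \<in> tail_class x"
proof -
  obtain j where "\<And>i. i \<noteq> j \<Longrightarrow> a i = b i" using L_graph_flip [OF assms] by blast
  then show ?thesis using tail_class_change [of j a b x] tail_class_change [of j b a x] by auto
qed

lemma L_graph_relpow:
  "(a, b) \<in> L_graph ^^ n \<Longrightarrow> a \<in> tail_class x \<Longrightarrow>
    b \<in> tail_class x \<and> \<bar>gray_pos x a - gray_pos x b\<bar> \<le> int n"
proof (induction n arbitrary: b)
  case (Suc n)
  then obtain d where d: "(a, d) \<in> L_graph ^^ n" "(d, b) \<in> L_graph" by auto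
  with Suc have "d \<in> tail_class x" "\<bar>gray_pos x a - gray_pos x d\<bar> \<le> int n" by auto
  moreover from this d have "b \<in> tail_class x" using L_graph_tail_class by blast
  moreover have "\<bar>gray_pos x d - gray_pos x b\<bar> = 1"
    using L_graph_pos [OF \<open>d \<in> tail_class x\<close> \<open>b \<in> tail_class x\<close>] d by simp
  ultimately show ?case by auto
qed simp

lemma L_graph_walk:
  "a \<in> tail_class x \<Longrightarrow> b \<in> tail_class x \<Longrightarrow> \<bar>gray_pos x a - gray_pos x b\<bar> = int n \<Longrightarrow>
    (a, b) \<in> L_graph ^^ n"
proof (induction n arbitrary: b)
  case 0
  then show ?case using gray_pos_inj by auto
next
  case (Suc n)
  define t where "t = gray_pos x b + sgn (gray_pos x a - gray_pos x b)"
  have "\<exists>d\<in>tail_class x. gray_pos x d = t"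
    using Suc.prems gray_pos_convex [OF Suc.prems(1,2), of t] gray_pos_convex [OF Suc.prems(2,1), of t]
    by (auto simp: t_def sgn_if split: if_splits)
  then obtain d where d: "d \<in> tail_class x" "gray_pos x d = t" ..
  then have "\<bar>gray_pos x a - gray_pos x d\<bar> = int n" "\<bar>gray_pos x d - gray_pos x b\<bar> = 1"
    using Suc.prems(3) by (auto simp: t_def sgn_if split: if_splits)
  then have "(a, d) \<in> L_graph ^^ n" "(d, b) \<in> L_graph"
    using Suc.IH [OF Suc.prems(1) d(1)] L_graph_pos [OF d(1) Suc.prems(2)] by auto
  then show ?case by auto
qed

text \<open>Each edge changes the position by one, and every position in between is taken.\<close>

lemma L_graph_dist:
  assumes "a \<in> tail_class x"
  shows "graph_dist L_graph a b =
    (if b \<in> tail_class x then enat (nat \<bar>gray_pos x a - gray_pos x b\<bar>) else \<infinity>)"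
proof (cases "b \<in> tail_class x")
  case True
  have "(INF n\<in>{n. (a, b) \<in> L_graph ^^ n}. enat n) = enat (nat \<bar>gray_pos x a - gray_pos x b\<bar>)"
  proof (rule antisym)
    show "(INF n\<in>{n. (a, b) \<in> L_graph ^^ n}. enat n) \<le> enat (nat \<bar>gray_pos x a - gray_pos x b\<bar>)"
      using L_graph_walk [OF assms True, of "nat \<bar>gray_pos x a - gray_pos x b\<bar>"]
      by (intro INF_lower) auto
    show "enat (nat \<bar>gray_pos x a - gray_pos x b\<bar>) \<le> (INF n\<in>{n. (a, b) \<in> L_graph ^^ n}. enat n)"
      using L_graph_relpow [OF _ assms] by (intro INF_greatest) fastforce
  qed
  with True show ?thesis by (simp add: graph_dist_def)
next
  case False
  then have "{n. (a, b) \<in> L_graph ^^ n} = {}" using L_graph_relpow [OF _ assms] by blast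
  with False show ?thesis by (simp add: graph_dist_def top_enat_def)
qed

lemma odd_pairs_iff:
  assumes "a \<in> tail_class x"
  shows "(a, b) \<in> odd_pairs \<longleftrightarrow> b \<in> tail_class x \<and> odd (gray_pos x a - gray_pos x b)"
proof -
  have "odd (nat \<bar>t\<bar>) \<longleftrightarrow> odd t" for t :: int by (simp add: even_nat_iff)
  then show ?thesis unfolding odd_pairs_def by (auto simp: L_graph_dist [OF assms])
qed

lemma tail_class_refl [simp]: "x \<in> tail_class x"
  by (auto simp: tail_class_def same_from_def)

lemma odd_pairs_walk:
  assumes "(a, b) \<in> odd_pairs"
  shows "\<exists>n. odd n \<and> (a, b) \<in> L_graph ^^ n"
proof -
  have "b \<in> tail_class a" "odd (gray_pos a a - gray_pos a b)"
    using assms odd_pairs_iff [of a a b] by auto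
  then show ?thesis using L_graph_walk [of a a b "nat \<bar>gray_pos a a - gray_pos a b\<bar>"]
    by (intro exI [of _ "nat \<bar>gray_pos a a - gray_pos a b\<bar>"]) (auto simp: even_nat_iff)
qed

section \<open>Coordinates on the components of \<open>S0_graph\<close>\<close>

lemma unordered_eq_iff:
  "unordered (a, b) = unordered (a', b') \<longleftrightarrow> a = a' \<and> b = b' \<or> a = b' \<and> b = a'"
  by (auto simp: unordered_def doubleton_eq_iff)

text \<open>A point of a component of \<open>S0_graph\<close> is located by the halves of the positions of its
  element at an even position and its element at an odd position.\<close>

definition S0_component :: "(nat \<Rightarrow> bool) \<Rightarrow> S0_vertex set" where
  "S0_component x = {unordered (a, b) |a b. a \<in> tail_class x \<and> b \<in> tail_class x \<and>
     even (gray_pos x a) \<and> odd (gray_pos x b)}"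

definition S0_coord :: "(nat \<Rightarrow> bool) \<Rightarrow> S0_vertex \<Rightarrow> int \<times> int" where
  "S0_coord x v = (let p = THE p. p \<in> v \<and> even (gray_pos x (fst p))
     in (gray_pos x (fst p) div 2, gray_pos x (snd p) div 2))"

lemma S0_coord:
  assumes "even (gray_pos x a)" "odd (gray_pos x b)"
  shows "S0_coord x (unordered (a, b)) = (gray_pos x a div 2, gray_pos x b div 2)"
proof -
  have "(THE p. p \<in> unordered (a, b) \<and> even (gray_pos x (fst p))) = (a, b)"
    using assms by (intro the_equality) (auto simp: unordered_def)
  then show ?thesis by (simp add: S0_coord_def)
qed

lemma odd_pairs_S0_component:
  assumes "(a, b) \<in> odd_pairs"
  shows "unordered (a, b) \<in> S0_component x \<longleftrightarrow> a \<in> tail_class x"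
    "a \<in> tail_class x \<longleftrightarrow> b \<in> tail_class x"
proof -
  show ab: "a \<in> tail_class x \<longleftrightarrow> b \<in> tail_class x"
  proof -
    obtain n where "(a, b) \<in> L_graph ^^ n" using odd_pairs_walk assms by blast
    then show ?thesis
      by (induction n arbitrary: b) (auto dest: L_graph_tail_class [where x = x])
  qed
  show "unordered (a, b) \<in> S0_component x \<longleftrightarrow> a \<in> tail_class x"
  proof
    assume "unordered (a, b) \<in> S0_component x"
    then show "a \<in> tail_class x" by (auto simp: S0_component_def unordered_eq_iff)
  next
    assume a: "a \<in> tail_class x"
    then have b: "b \<in> tail_class x" "odd (gray_pos x a - gray_pos x b)"
      using assms odd_pairs_iff [OF a] by auto
    show "unordered (a, b) \<in> S0_component x"
    proof (cases "even (gray_pos x a)")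
      case True
      with a b show ?thesis by (auto simp: S0_component_def)
    next
      case False
      moreover have "unordered (a, b) = unordered (b, a)" by (auto simp: unordered_eq_iff)
      ultimately show ?thesis using a b by (auto simp: S0_component_def)
    qed
  qed
qed

text \<open>Even and odd positions serve as the two axes, and steps of length 2 become unit steps by
  halving. The sets of halves are intervals, but not always all of the integers, hence a general
  grid.\<close>

lemma S0_component_grid:
  "grid S0_graph (S0_component x) (S0_coord x)
     {i. \<exists>a\<in>tail_class x. gray_pos x a = 2 * i} {j. \<exists>b\<in>tail_class x. gray_pos x b = 2 * j + 1}"
    (is "grid _ _ _ ?I ?J")
proof
  show "inj_on (S0_coord x) (S0_component x)"
  proof (rule inj_onI)
    fix u v assume u: "u \<in> S0_component x" and v: "v \<in> S0_component x" and eq: "S0_coord x u = S0_coord x v"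
    obtain a b where ab: "u = unordered (a, b)" "a \<in> tail_class x" "b \<in> tail_class x"
      "even (gray_pos x a)" "odd (gray_pos x b)" using u by (auto simp: S0_component_def)
    obtain a' b' where ab': "v = unordered (a', b')" "a' \<in> tail_class x" "b' \<in> tail_class x"
      "even (gray_pos x a')" "odd (gray_pos x b')" using v by (auto simp: S0_component_def)
    have "gray_pos x a = gray_pos x a'" "gray_pos x b = gray_pos x b'"
      using eq S0_coord [OF ab(4,5)] S0_coord [OF ab'(4,5)] ab ab'
      by (auto elim!: evenE oddE)
    then show "u = v" using gray_pos_inj ab ab' by metis
  qed
  show "S0_coord x ` S0_component x = ?I \<times> ?J"
  proof (intro equalityI subsetI)
    fix P assume "P \<in> S0_coord x ` S0_component x"
    then obtain a b where ab: "P = S0_coord x (unordered (a, b))" "a \<in> tail_class x" "b \<in> tail_class x"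
      "even (gray_pos x a)" "odd (gray_pos x b)" by (auto simp: S0_component_def)
    moreover from this have "gray_pos x a = 2 * (gray_pos x a div 2)"
      "gray_pos x b = 2 * (gray_pos x b div 2) + 1" by simp_all
    ultimately show "P \<in> ?I \<times> ?J" unfolding S0_coord [OF ab(4,5)] by blast
  next
    fix P assume "P \<in> ?I \<times> ?J"
    then obtain i j a b where P: "P = (i, j)" "a \<in> tail_class x" "b \<in> tail_class x"
      "gray_pos x a = 2 * i" "gray_pos x b = 2 * j + 1" by auto
    then have "even (gray_pos x a)" "odd (gray_pos x b)" by simp_all
    moreover from this P have "unordered (a, b) \<in> S0_component x" unfolding S0_component_def by blast
    ultimately show "P \<in> S0_coord x ` S0_component x"
      using P by (intro image_eqI [of _ _ "unordered (a, b)"]) (simp_all add: S0_coord)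
  qed
  show "t \<in> ?I" if "p \<in> ?I" "q \<in> ?I" "p \<le> t" "t \<le> q" for p q t
    using that gray_pos_convex [of _ x _ "2 * t"] by fastforce
  show "t \<in> ?J" if "p \<in> ?J" "q \<in> ?J" "p \<le> t" "t \<le> q" for p q t
    using that gray_pos_convex [of _ x _ "2 * t + 1"] by fastforce
  show "u \<in> S0_component x \<longleftrightarrow> v \<in> S0_component x" if "(u, v) \<in> S0_graph" for u v
  proof -
    obtain a b a' b' where "u = unordered (a, b)" "v = unordered (a', b')"
      "(a, b) \<in> odd_pairs" "(a', b') \<in> odd_pairs" "a = a' \<or> b = b'"
      using \<open>(u, v) \<in> S0_graph\<close> by (auto simp: S0_graph_def)
    then show ?thesis
      using odd_pairs_S0_component [of a b x] odd_pairs_S0_component [of a' b' x] by auto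
  qed
  fix u v assume u: "u \<in> S0_component x" and v: "v \<in> S0_component x"
  obtain a b where ab: "u = unordered (a, b)" "a \<in> tail_class x" "b \<in> tail_class x"
    "even (gray_pos x a)" "odd (gray_pos x b)" using u by (auto simp: S0_component_def)
  obtain a' b' where ab': "v = unordered (a', b')" "a' \<in> tail_class x" "b' \<in> tail_class x"
    "even (gray_pos x a')" "odd (gray_pos x b')" using v by (auto simp: S0_component_def)
  have two: "graph_dist L_graph d e = 2 \<longleftrightarrow> \<bar>gray_pos x d - gray_pos x e\<bar> = 2"
    if "d \<in> tail_class x" "e \<in> tail_class x" for d e
    using that by (auto simp: L_graph_dist [OF that(1)] numeral_eq_enat)
  have odd: "(a, b) \<in> odd_pairs" "(a', b') \<in> odd_pairs"
    using odd_pairs_iff ab ab' by simp_all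
  have "(u, v) \<in> S0_graph \<longleftrightarrow> a = a' \<and> graph_dist L_graph b b' = 2 \<or> b = b' \<and> graph_dist L_graph a a' = 2"
  proof
    assume "(u, v) \<in> S0_graph"
    then obtain p q r s where *: "u = unordered (p, q)" "v = unordered (r, s)"
      "p = r \<and> graph_dist L_graph q s = 2 \<or> q = s \<and> graph_dist L_graph p r = 2"
      by (auto simp: S0_graph_def)
    then have "p = a \<and> q = b \<or> p = b \<and> q = a" "r = a' \<and> s = b' \<or> r = b' \<and> s = a'"
      using ab(1) ab'(1) by (auto simp: unordered_eq_iff)
    then show "a = a' \<and> graph_dist L_graph b b' = 2 \<or> b = b' \<and> graph_dist L_graph a a' = 2"
      using * ab(4,5) ab'(4,5) by auto
  next
    assume "a = a' \<and> graph_dist L_graph b b' = 2 \<or> b = b' \<and> graph_dist L_graph a a' = 2"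
    then show "(u, v) \<in> S0_graph"
      using odd ab(1) ab'(1) unfolding S0_graph_def by blast
  qed
  also have "\<dots> \<longleftrightarrow> gray_pos x a = gray_pos x a' \<and> \<bar>gray_pos x b - gray_pos x b'\<bar> = 2 \<or>
      gray_pos x b = gray_pos x b' \<and> \<bar>gray_pos x a - gray_pos x a'\<bar> = 2"
    using two ab ab' gray_pos_inj by metis
  also have "\<dots> \<longleftrightarrow> taxi (S0_coord x u) (S0_coord x v) = 1"
    unfolding ab(1) ab'(1) S0_coord [OF ab(4,5)] S0_coord [OF ab'(4,5)]
    using ab(4,5) ab'(4,5) by (auto simp: taxi_def elim!: evenE oddE) presburger+
  finally show "(u, v) \<in> S0_graph \<longleftrightarrow> taxi (S0_coord x u) (S0_coord x v) = 1" .
qed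

text \<open>Lying in a common column or row means sharing the element at an even or at an odd
  position; because of the parities an element cannot be shared crosswise.\<close>

lemma S0_collinear:
  assumes ab: "(a, b) \<in> odd_pairs" and ab': "(a', b') \<in> odd_pairs"
  shows "collinear_in S0_graph (unordered (a, b)) (unordered (a', b')) \<longleftrightarrow> {a, b} \<inter> {a', b'} \<noteq> {}"
proof -
  interpret grid S0_graph "S0_component a" "S0_coord a"
    "{i. \<exists>d\<in>tail_class a. gray_pos a d = 2 * i}" "{j. \<exists>d\<in>tail_class a. gray_pos a d = 2 * j + 1}"
    by (rule S0_component_grid)
  have u: "unordered (a, b) \<in> S0_component a"
    using odd_pairs_S0_component(1) [OF ab, of a] tail_class_refl by blast
  have b: "b \<in> tail_class a" using odd_pairs_iff [of a a b] ab by simp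
  show ?thesis
  proof (cases "a' \<in> tail_class a")
    case False
    then have "unordered (a', b') \<notin> S0_component a" "b' \<notin> tail_class a"
      using odd_pairs_S0_component [OF ab', of a] by simp_all
    with False b collinear_same [OF u] show ?thesis by auto
  next
    case True
    then have v: "unordered (a', b') \<in> S0_component a" using odd_pairs_S0_component [OF ab'] by simp
    obtain p q where pq: "unordered (a, b) = unordered (p, q)" "p \<in> tail_class a" "q \<in> tail_class a"
      "even (gray_pos a p)" "odd (gray_pos a q)" using u unfolding S0_component_def by blast
    obtain p' q' where pq': "unordered (a', b') = unordered (p', q')" "p' \<in> tail_class a" "q' \<in> tail_class a"
      "even (gray_pos a p')" "odd (gray_pos a q')" using v unfolding S0_component_def by blast
    have "collinear_in S0_graph (unordered (a, b)) (unordered (a', b')) \<longleftrightarrow>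
        gray_pos a p div 2 = gray_pos a p' div 2 \<or> gray_pos a q div 2 = gray_pos a q' div 2"
      using collinear_iff [OF u v] unfolding pq(1) pq'(1) S0_coord [OF pq(4,5)] S0_coord [OF pq'(4,5)]
      by simp
    also have "\<dots> \<longleftrightarrow> gray_pos a p = gray_pos a p' \<or> gray_pos a q = gray_pos a q'"
      using pq(4,5) pq'(4,5) by (auto elim!: evenE oddE)
    also have "\<dots> \<longleftrightarrow> p = p' \<or> q = q'"
      using gray_pos_inj pq pq' by metis
    also have "\<dots> \<longleftrightarrow> {a, b} \<inter> {a', b'} \<noteq> {}"
      using pq pq' by (auto simp: unordered_eq_iff)
    finally show ?thesis .
  qed
qed

section \<open>Borel frames\<close>

lemma abs_sum_eq_1:
  assumes "\<bar>a\<bar> + \<bar>b\<bar> = (1 :: int)"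
  shows "a = 1 \<and> b = 0 \<or> a = -1 \<and> b = 0 \<or> a = 0 \<and> b = 1 \<or> a = 0 \<and> b = -1"
proof -
  consider "\<bar>a\<bar> = 0" "\<bar>b\<bar> = 1" | "\<bar>a\<bar> = 1" "\<bar>b\<bar> = 0" using assms by linarith
  then show ?thesis by cases auto
qed

lemma square_lattice_iff: "(P, Q) \<in> square_lattice \<longleftrightarrow> taxi P Q = 1"
proof
  assume "(P, Q) \<in> square_lattice"
  then show "taxi P Q = 1" by (auto simp: square_lattice_def cayley_graph_def taxi_def)
next
  assume t: "taxi P Q = 1"
  define s where "s = Q - P"
  have "s \<in> {(1, 0), (-1, 0), (0, 1), (0, -1)}"
    using t by (cases s) (auto simp: taxi_def s_def prod_eq_iff)
  moreover have "(P, Q) = (P, P + s)" by (simp add: s_def)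
  ultimately show "(P, Q) \<in> square_lattice"
    unfolding square_lattice_def cayley_graph_def by blast
qed

locale lattice_graph =
  fixes M :: "'a measure" and G :: "'a rel" and k :: "'a \<Rightarrow> nat \<Rightarrow> nat"
  assumes code: "is_code M k" and graph: "borel_graph M G"
    and lattice: "locally_square_lattice (space M) G"
begin

lemma G_in: "(x, y) \<in> G \<Longrightarrow> x \<in> space M \<and> y \<in> space M"
  and G_sym: "(x, y) \<in> G \<Longrightarrow> (y, x) \<in> G"
  and G_sets [measurable]: "G \<in> sets (M \<Otimes>\<^sub>M M)"
  using graph by (auto simp: borel_graph_def graph_on_def sym_def)

text \<open>Chosen for the component as a set, so that all its vertices use the same chart. Nothing
  makes this choice depend on the component in a Borel way.\<close>

definition chart :: "'a set \<Rightarrow> 'a \<Rightarrow> int \<times> int" where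
  "chart C = (SOME \<phi>. bij_betw \<phi> C UNIV \<and> (\<forall>u\<in>C. \<forall>v\<in>C. (u, v) \<in> G \<longleftrightarrow> (\<phi> u, \<phi> v) \<in> square_lattice))"

definition c :: "'a \<Rightarrow> int \<times> int" where
  "c x = chart (component G x) x"

lemma component_eq: "y \<in> component G x \<longleftrightarrow> component G y = component G x"
proof
  have "sym (G\<^sup>*)" by (rule sym_rtrancl) (auto simp: sym_def G_sym)
  then have "(x, y) \<in> G\<^sup>* \<Longrightarrow> (y, x) \<in> G\<^sup>*" by (rule symD)
  moreover assume "y \<in> component G x"
  ultimately show "component G y = component G x"
    by (auto simp: component_def intro: rtrancl_trans)
next
  assume "component G y = component G x"
  moreover have "y \<in> component G y" by (simp add: component_def)
  ultimately show "y \<in> component G x" by simp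
qed

lemma component_subset:
  assumes "x \<in> space M"
  shows "component G x \<subseteq> space M"
proof
  fix y assume "y \<in> component G x"
  then have "(x, y) \<in> G\<^sup>*" by (simp add: component_def)
  then show "y \<in> space M" using assms by induction (auto dest: G_in)
qed

lemma component_edge: "(x, y) \<in> G \<Longrightarrow> component G x = component G y"
  using component_eq [of y x] by (auto simp: component_def)

lemma component_grid:
  assumes "x \<in> space M"
  shows "full_grid G (component G x) c"
proof -
  let ?C = "component G x"
  have "\<exists>\<phi> :: 'a \<Rightarrow> int \<times> int. bij_betw \<phi> ?C UNIV \<and> (\<forall>u\<in>?C. \<forall>v\<in>?C. (u, v) \<in> G \<longleftrightarrow> (\<phi> u, \<phi> v) \<in> square_lattice)"
    using lattice assms by (simp add: locally_square_lattice_def)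
  then have ch: "bij_betw (chart ?C) ?C UNIV \<and> (\<forall>u\<in>?C. \<forall>v\<in>?C. (u, v) \<in> G \<longleftrightarrow> (chart ?C u, chart ?C v) \<in> square_lattice)"
    unfolding chart_def by (rule someI_ex)
  have eq: "c u = chart ?C u" if "u \<in> ?C" for u
    using that by (simp add: c_def component_eq)
  have "bij_betw c ?C UNIV" using ch eq by (simp cong: bij_betw_cong)
  show ?thesis
  proof
    show "inj_on c ?C" "c ` ?C = UNIV \<times> UNIV" using \<open>bij_betw c ?C UNIV\<close> by (simp_all add: bij_betw_def)
    show "u \<in> ?C \<longleftrightarrow> v \<in> ?C" if "(u, v) \<in> G" for u v
      using component_edge [OF that] by (simp add: component_eq)
    show "(u, v) \<in> G \<longleftrightarrow> taxi (c u) (c v) = 1" if "u \<in> ?C" "v \<in> ?C" for u v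
      using ch that eq [OF that(1)] eq [OF that(2)] by (simp add: square_lattice_iff)
  qed auto
qed

lemma adj_iff:
  assumes "x \<in> space M" "y \<in> space M" "component G x = component G y"
  shows "(x, y) \<in> G \<longleftrightarrow> taxi (c x) (c y) = 1"
proof -
  interpret full_grid G "component G x" c by (rule component_grid [OF assms(1)])
  show ?thesis using adj [of x y] assms(3) by (simp add: component_eq)
qed

lemma c_inj:
  assumes "x \<in> space M" "y \<in> space M" "component G x = component G y" "c x = c y"
  shows "x = y"
proof -
  interpret full_grid G "component G x" c by (rule component_grid [OF assms(1)])
  show ?thesis using inj_onD [OF inj, of x y] assms(3,4) by (simp add: component_eq)
qed

lemma c_surj:
  assumes "x \<in> space M"
  obtains y where "y \<in> space M" "component G y = component G x" "c y = P"
proof -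
  interpret full_grid G "component G x" c by (rule component_grid [OF assms])
  have "pt P \<in> component G x" by simp
  then show ?thesis
    using component_subset [OF assms] component_eq [of "pt P" x] by (intro that [of "pt P"]) auto
qed

lemma degree:
  assumes "x \<in> space M"
  shows "finite {y. (x, y) \<in> G} \<and> card {y. (x, y) \<in> G} = 4"
proof -
  interpret full_grid G "component G x" c by (rule component_grid [OF assms])
  obtain a b where ab: "c x = (a, b)" by fastforce
  let ?D = "{(a + 1, b), (a - 1, b), (a, b + 1), (a, b - 1)}"
  have "{y. (x, y) \<in> G} = pt ` ?D"
  proof (intro equalityI subsetI)
    fix y assume "y \<in> {y. (x, y) \<in> G}"
    then have xy: "(x, y) \<in> G" by simp
    then have "component G x = component G y" "y \<in> space M" using component_edge G_in by auto
    then have "taxi (c x) (c y) = 1" using adj_iff [OF assms] xy by simp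
    then have "c y \<in> ?D" using ab by (cases "c y") (auto simp: taxi_def)
    moreover have "y = pt (c y)" using pt_c [of y] \<open>component G x = component G y\<close> by (simp add: component_eq)
    ultimately show "y \<in> pt ` ?D" by blast
  next
    fix y assume "y \<in> pt ` ?D"
    then obtain P where P: "y = pt P" "P \<in> ?D" by blast
    then have "taxi (c x) (c y) = 1" using ab by (auto simp: taxi_def)
    moreover have "x \<in> component G x" by (simp add: component_def)
    moreover have "y \<in> component G x" using P by simp
    ultimately show "y \<in> {y. (x, y) \<in> G}" using adj [of x y] by simp
  qed
  moreover have "inj_on pt ?D" by (rule inj_on_inverseI [where g = c]) simp
  moreover have "card ?D = 4" by auto
  ultimately show ?thesis by (simp add: card_image)
qed

text \<open>For neighbours \<open>x\<close> and \<open>z\<close> of \<open>y\<close>: opposite ones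
  have only \<open>y\<close> as a common neighbour, while those at a right angle also share the
  fourth corner of a square. The case \<open>z = x\<close> has to be excluded separately. Unlike the
  charts, this description is Borel.\<close>

definition straight :: "'a \<Rightarrow> 'a \<Rightarrow> 'a \<Rightarrow> bool" where
  "straight x y z \<longleftrightarrow> z \<noteq> x \<and> \<not> (\<exists>w. (x, w) \<in> G \<and> (z, w) \<in> G \<and> w \<noteq> y)"

lemma straight_iff:
  assumes xy: "(y, x) \<in> G" and yz: "(y, z) \<in> G"
  shows "straight x y z \<longleftrightarrow> fst (c z) = 2 * fst (c y) - fst (c x) \<and> snd (c z) = 2 * snd (c y) - snd (c x)"
proof -
  have X: "x \<in> space M" "y \<in> space M" "z \<in> space M" using xy yz G_in by auto
  have C: "component G x = component G y" "component G z = component G y"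
    using component_edge [OF xy] component_edge [OF yz] by auto
  obtain p q where x: "c x = (p, q)" by fastforce
  obtain a b where y: "c y = (a, b)" by fastforce
  obtain r s where z: "c z = (r, s)" by fastforce
  have txy: "\<bar>a - p\<bar> + \<bar>b - q\<bar> = 1" and tyz: "\<bar>a - r\<bar> + \<bar>b - s\<bar> = 1"
    using adj_iff [OF X(2,1)] adj_iff [OF X(2,3)] C xy yz x y z by (auto simp: taxi_def)
  have zx: "z = x \<longleftrightarrow> r = p \<and> s = q" using c_inj [OF X(3,1)] C x z by auto
  have "(\<exists>w. (x, w) \<in> G \<and> (z, w) \<in> G \<and> w \<noteq> y) \<longleftrightarrow>
      (\<exists>u v. \<bar>p - u\<bar> + \<bar>q - v\<bar> = 1 \<and> \<bar>r - u\<bar> + \<bar>s - v\<bar> = 1 \<and> (u, v) \<noteq> (a, b))" (is "?L \<longleftrightarrow> ?R")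
  proof
    assume ?L
    then obtain w where w: "(x, w) \<in> G" "(z, w) \<in> G" "w \<noteq> y" by blast
    obtain u v where uv: "c w = (u, v)" by fastforce
    have wX: "w \<in> space M" "component G w = component G y" using w component_edge C G_in by metis+
    then have "taxi (c x) (c w) = 1" "taxi (c z) (c w) = 1"
      using adj_iff [OF X(1) wX(1)] adj_iff [OF X(3) wX(1)] w C by auto
    moreover have "(u, v) \<noteq> (a, b)" using c_inj [OF wX(1) X(2) wX(2)] w y uv by auto
    ultimately show ?R using x z uv by (intro exI [of _ u] exI [of _ v]) (auto simp: taxi_def)
  next
    assume ?R
    then obtain u v where uv: "\<bar>p - u\<bar> + \<bar>q - v\<bar> = 1" "\<bar>r - u\<bar> + \<bar>s - v\<bar> = 1" "(u, v) \<noteq> (a, b)" by blast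
    obtain w where w: "w \<in> space M" "component G w = component G y" "c w = (u, v)"
      using c_surj [OF X(2)] .
    have "(x, w) \<in> G" "(z, w) \<in> G"
      using adj_iff [OF X(1) w(1)] adj_iff [OF X(3) w(1)] w C uv x z by (auto simp: taxi_def)
    moreover have "w \<noteq> y" using w uv y by auto
    ultimately show ?L by blast
  qed
  also have "\<dots> \<longleftrightarrow> \<not> (r = 2 * a - p \<and> s = 2 * b - q) \<and> \<not> (r = p \<and> s = q) \<or> (r = p \<and> s = q)"
  proof
    assume ?R
    then obtain u v where "\<bar>p - u\<bar> + \<bar>q - v\<bar> = 1" "\<bar>r - u\<bar> + \<bar>s - v\<bar> = 1" "u \<noteq> a \<or> v \<noteq> b" by auto
    moreover have "p = a + 1 \<and> q = b \<or> p = a - 1 \<and> q = b \<or> p = a \<and> q = b + 1 \<or> p = a \<and> q = b - 1"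
      using abs_sum_eq_1 [OF txy] by auto
    ultimately have "\<not> (r = 2 * a - p \<and> s = 2 * b - q)" by auto
    then show "\<not> (r = 2 * a - p \<and> s = 2 * b - q) \<and> \<not> (r = p \<and> s = q) \<or> (r = p \<and> s = q)"
      by blast
  next
    assume R: "\<not> (r = 2 * a - p \<and> s = 2 * b - q) \<and> \<not> (r = p \<and> s = q) \<or> (r = p \<and> s = q)"
    show ?R
    proof (cases "r = p \<and> s = q")
      case True
      \<comment> \<open>The neighbour of \<open>x\<close> on the side away from
        \<open>y\<close>.\<close>
      then show ?thesis using txy by (intro exI [of _ "2 * p - a"] exI [of _ "2 * q - b"]) auto
    next
      case False
      \<comment> \<open>The fourth corner of the square with corners \<open>x\<close>,
        \<open>y\<close> and \<open>z\<close>.\<close>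
      then show ?thesis using R txy tyz
        by (intro exI [of _ "p + r - a"] exI [of _ "q + s - b"]) (smt (verit) prod.inject)
    qed
  qed
  finally show ?thesis
    unfolding straight_def zx using txy x y z by auto
qed

section \<open>Borel choice of neighbours\<close>

definition nbr :: "nat \<Rightarrow> 'a \<Rightarrow> 'a" where
  "nbr = (SOME h. (\<forall>s. h s \<in> M \<rightarrow>\<^sub>M M) \<and> (\<forall>x y. (x, y) \<in> G \<longrightarrow> (\<exists>s. h s x = y)))"

lemma nbr_measurable [measurable]: "nbr s \<in> M \<rightarrow>\<^sub>M M"
  and nbr_surj: "(x, y) \<in> G \<Longrightarrow> \<exists>s. nbr s x = y"
proof -
  have "G \<subseteq> space M \<times> space M" using G_in by auto
  from regular_neighbour_functions [OF code G_sets this degree]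
  have "\<exists>h. (\<forall>s. h s \<in> M \<rightarrow>\<^sub>M M) \<and> (\<forall>x y. (x, y) \<in> G \<longrightarrow> (\<exists>s::nat. h s x = y))" by simp
  from someI_ex [OF this] have "(\<forall>s. nbr s \<in> M \<rightarrow>\<^sub>M M) \<and> (\<forall>x y. (x, y) \<in> G \<longrightarrow> (\<exists>s. nbr s x = y))"
    unfolding nbr_def .
  then show "nbr s \<in> M \<rightarrow>\<^sub>M M" "(x, y) \<in> G \<Longrightarrow> \<exists>s. nbr s x = y" by blast+
qed

lemma edge_measurable [measurable]:
  assumes [measurable]: "f \<in> M \<rightarrow>\<^sub>M M" "g \<in> M \<rightarrow>\<^sub>M M"
  shows "Measurable.pred M (\<lambda>x. (f x, g x) \<in> G)"
proof -
  have "(\<lambda>x. (f x, g x)) -` G \<inter> space M \<in> sets M"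
    by (rule measurable_sets [OF _ G_sets]) measurable
  moreover have "(\<lambda>x. (f x, g x)) -` G \<inter> space M = {x \<in> space M. (f x, g x) \<in> G}" by auto
  ultimately show ?thesis by (simp add: pred_def)
qed

lemma eq_measurable [measurable]:
  assumes "f \<in> M \<rightarrow>\<^sub>M M" "g \<in> M \<rightarrow>\<^sub>M M"
  shows "Measurable.pred M (\<lambda>x. f x = g x)"
  by (rule code_measurable_eq [OF code assms])

text \<open>A common neighbour can be sought among the countably many \<open>nbr s x\<close>, which
  makes the quantifier in \<open>straight\<close> countable.\<close>

lemma straight_measurable [measurable]:
  assumes [measurable]: "f \<in> M \<rightarrow>\<^sub>M M" "g \<in> M \<rightarrow>\<^sub>M M" "h \<in> M \<rightarrow>\<^sub>M M"
  shows "Measurable.pred M (\<lambda>x. straight (f x) (g x) (h x))"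
proof -
  have "(\<exists>w. (x, w) \<in> G \<and> (z, w) \<in> G \<and> w \<noteq> y) \<longleftrightarrow>
      (\<exists>s. (x, nbr s x) \<in> G \<and> (z, nbr s x) \<in> G \<and> nbr s x \<noteq> y)" for x y z
    using nbr_surj by metis
  then have "(\<lambda>x. straight (f x) (g x) (h x)) = (\<lambda>x. h x \<noteq> f x \<and> \<not> (\<exists>s. (f x, nbr s (f x)) \<in> G \<and>
      (h x, nbr s (f x)) \<in> G \<and> nbr s (f x) \<noteq> g x))"
    by (simp add: straight_def fun_eq_iff)
  moreover have "Measurable.pred M (\<lambda>x. h x \<noteq> f x \<and> \<not> (\<exists>s. (f x, nbr s (f x)) \<in> G \<and>
      (h x, nbr s (f x)) \<in> G \<and> nbr s (f x) \<noteq> g x))"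
    by measurable
  ultimately show ?thesis by simp
qed

text \<open>Uniformization by the least index: among the Borel maps that list the neighbours, the
  first one to satisfy \<open>R\<close> is taken.\<close>

lemma select_neighbour:
  assumes f [measurable]: "f \<in> M \<rightarrow>\<^sub>M M"
    and R [measurable]: "\<And>g. g \<in> M \<rightarrow>\<^sub>M M \<Longrightarrow> Measurable.pred M (\<lambda>x. R x (g x))"
    and ex: "\<And>x. x \<in> space M \<Longrightarrow> \<exists>z. (f x, z) \<in> G \<and> R x z"
  shows "\<exists>g\<in>M \<rightarrow>\<^sub>M M. \<forall>x\<in>space M. (f x, g x) \<in> G \<and> R x (g x)"
proof (intro bexI ballI)
  let ?Q = "\<lambda>x s. (f x, nbr s (f x)) \<in> G \<and> R x (nbr s (f x))"
  let ?g = "\<lambda>x. nbr (LEAST s. ?Q x s) (f x)"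
  have [measurable]: "Measurable.pred M (\<lambda>x. R x (nbr s (f x)))" for s
    by (rule R) measurable
  have L: "(\<lambda>x. LEAST s. ?Q x s) \<in> M \<rightarrow>\<^sub>M count_space UNIV" by measurable
  show "?g \<in> M \<rightarrow>\<^sub>M M"
    by (rule measurable_compose_countable [OF _ L]) measurable
  fix x assume "x \<in> space M"
  then obtain z where z: "(f x, z) \<in> G" "R x z" using ex by blast
  then obtain s where "nbr s (f x) = z" using nbr_surj by blast
  with z have "?Q x s" by simp
  then show "(f x, ?g x) \<in> G \<and> R x (?g x)" by (rule LeastI)
qed

end

text \<open>The induction behind \<open>ex_good\<close>: two consecutive moves on a line can be
  continued in both directions.\<close>

lemma int_two_step:
  assumes "Q 0" "Q 1" and up: "\<And>a. Q a \<Longrightarrow> Q (a + 1) \<Longrightarrow> Q (a + 2)"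
    and down: "\<And>a. Q a \<Longrightarrow> Q (a + 1) \<Longrightarrow> Q (a - 1)"
  shows "Q (a :: int)"
proof -
  have "Q a \<and> Q (a + 1)"
  proof (induction a rule: int_induct [of _ 0])
    case (step1 i)
    then show ?case using up [of i] by (simp add: add.assoc)
  next
    case (step2 i)
    then show ?case using down [of i] by simp
  qed (use assms in simp)
  then show ?thesis ..
qed

context lattice_graph
begin

definition hmove :: "'a \<Rightarrow> 'a" where
  "hmove = (SOME g. g \<in> M \<rightarrow>\<^sub>M M \<and> (\<forall>x\<in>space M. (x, g x) \<in> G))"

lemma hmove_measurable [measurable]: "hmove \<in> M \<rightarrow>\<^sub>M M"
  and hmove_edge: "x \<in> space M \<Longrightarrow> (x, hmove x) \<in> G"
proof -
  have "\<exists>g\<in>M \<rightarrow>\<^sub>M M. \<forall>x\<in>space M. (x, g x) \<in> G \<and> True"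
  proof (rule select_neighbour)
    fix x assume "x \<in> space M"
    from degree [OF this] have "card {y. (x, y) \<in> G} \<noteq> 0" by simp
    then have "{y. (x, y) \<in> G} \<noteq> {}" by (metis card.empty)
    then show "\<exists>z. (x, z) \<in> G \<and> True" by blast
  qed simp_all
  then have "\<exists>g. g \<in> M \<rightarrow>\<^sub>M M \<and> (\<forall>x\<in>space M. (x, g x) \<in> G)" by blast
  from someI_ex [OF this] show "hmove \<in> M \<rightarrow>\<^sub>M M" "x \<in> space M \<Longrightarrow> (x, hmove x) \<in> G"
    unfolding hmove_def by blast+
qed

text \<open>A neighbour of \<open>x\<close> that is neither \<open>hmove x\<close> nor opposite to
  it is at a right angle to it. This condition is Borel, so a Borel map can meet it.\<close>

definition vmove :: "'a \<Rightarrow> 'a" where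
  "vmove = (SOME g. g \<in> M \<rightarrow>\<^sub>M M \<and>
     (\<forall>x\<in>space M. (x, g x) \<in> G \<and> g x \<noteq> hmove x \<and> \<not> straight (hmove x) x (g x)))"

lemma vmove_measurable [measurable]: "vmove \<in> M \<rightarrow>\<^sub>M M"
  and vmove_edge: "x \<in> space M \<Longrightarrow> (x, vmove x) \<in> G"
  and vmove_perp: "x \<in> space M \<Longrightarrow> vmove x \<noteq> hmove x \<and> \<not> straight (hmove x) x (vmove x)"
proof -
  have "\<exists>g\<in>M \<rightarrow>\<^sub>M M. \<forall>x\<in>space M. (x, g x) \<in> G \<and> (g x \<noteq> hmove x \<and> \<not> straight (hmove x) x (g x))"
  proof (rule select_neighbour)
    show "Measurable.pred M (\<lambda>x. g x \<noteq> hmove x \<and> \<not> straight (hmove x) x (g x))"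
      if [measurable]: "g \<in> M \<rightarrow>\<^sub>M M" for g
      by measurable
    fix x assume x: "x \<in> space M"
    let ?h = "hmove x"
    have h: "(x, ?h) \<in> G" "?h \<in> space M" using hmove_edge [OF x] G_in by auto
    \<comment> \<open>Exchanging the coordinates of the step to \<open>hmove x\<close> gives a step
      at a right angle to it.\<close>
    define P where "P = (fst (c x) + (snd (c ?h) - snd (c x)), snd (c x) + (fst (c ?h) - fst (c x)))"
    obtain z where z: "z \<in> space M" "component G z = component G x" "c z = P" using c_surj [OF x] .
    have t: "\<bar>fst (c x) - fst (c ?h)\<bar> + \<bar>snd (c x) - snd (c ?h)\<bar> = 1"
      using adj_iff [OF x h(2)] component_edge [OF h(1)] h by (simp add: taxi_def)
    have xz: "(x, z) \<in> G" using adj_iff [OF x z(1)] z t by (simp add: taxi_def P_def)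
    moreover have "z \<noteq> ?h"
    proof
      assume "z = ?h"
      then have "fst (c ?h) = fst P" using z(3) by simp
      then have e: "fst (c x) - fst (c ?h) = snd (c x) - snd (c ?h)" unfolding P_def by simp
      have "u \<noteq> w" if "\<bar>u\<bar> + \<bar>w\<bar> = 1" for u w :: int using abs_sum_eq_1 [OF that] by auto
      from this [OF t] e show False by simp
    qed
    moreover have "\<not> straight ?h x z"
      using straight_iff [OF h(1) xz] z(3) abs_sum_eq_1 [OF t] by (auto simp: P_def)
    ultimately show "\<exists>z. (x, z) \<in> G \<and> (z \<noteq> ?h \<and> \<not> straight ?h x z)" by blast
  qed simp
  then have "\<exists>g. g \<in> M \<rightarrow>\<^sub>M M \<and>
     (\<forall>x\<in>space M. (x, g x) \<in> G \<and> g x \<noteq> hmove x \<and> \<not> straight (hmove x) x (g x))" by blast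
  from someI_ex [OF this]
  show "vmove \<in> M \<rightarrow>\<^sub>M M" "x \<in> space M \<Longrightarrow> (x, vmove x) \<in> G"
    "x \<in> space M \<Longrightarrow> vmove x \<noteq> hmove x \<and> \<not> straight (hmove x) x (vmove x)"
    unfolding vmove_def by blast+
qed

definition hz :: "'a \<Rightarrow> bool" where
  "hz x \<longleftrightarrow> snd (c (hmove x)) = snd (c x)"

definition sigma_sign :: "'a \<Rightarrow> int" where
  "sigma_sign x = (if hz x then fst (c (hmove x)) - fst (c x) else snd (c (hmove x)) - snd (c x))"

definition tau_sign :: "'a \<Rightarrow> int" where
  "tau_sign x = (if hz x then snd (c (vmove x)) - snd (c x) else fst (c (vmove x)) - fst (c x))"

definition loc :: "'a \<Rightarrow> int \<times> int \<Rightarrow> int \<times> int" where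
  "loc x p = (if hz x then (fst (c x) + sigma_sign x * fst p, snd (c x) + tau_sign x * snd p)
     else (fst (c x) + tau_sign x * snd p, snd (c x) + sigma_sign x * fst p))"

lemma frame:
  assumes x: "x \<in> space M"
  shows "sigma_sign x \<in> {1, -1}" "tau_sign x \<in> {1, -1}" "c (hmove x) = loc x (1, 0)" "c (vmove x) = loc x (0, 1)"
proof -
  have h: "(x, hmove x) \<in> G" "hmove x \<in> space M" and v: "(x, vmove x) \<in> G" "vmove x \<in> space M"
    using hmove_edge [OF x] vmove_edge [OF x] G_in by auto
  have th: "\<bar>fst (c x) - fst (c (hmove x))\<bar> + \<bar>snd (c x) - snd (c (hmove x))\<bar> = 1"
    using adj_iff [OF x h(2)] component_edge [OF h(1)] h by (simp add: taxi_def)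
  have tv: "\<bar>fst (c x) - fst (c (vmove x))\<bar> + \<bar>snd (c x) - snd (c (vmove x))\<bar> = 1"
    using adj_iff [OF x v(2)] component_edge [OF v(1)] v by (simp add: taxi_def)
  have "component G (vmove x) = component G (hmove x)"
    using component_edge [OF h(1)] component_edge [OF v(1)] by simp
  then have "c (vmove x) \<noteq> c (hmove x)" using vmove_perp [OF x] c_inj [OF v(2) h(2)] by blast
  then have ne: "fst (c (vmove x)) \<noteq> fst (c (hmove x)) \<or> snd (c (vmove x)) \<noteq> snd (c (hmove x))"
    by (simp add: prod_eq_iff)
  have ns: "\<not> (fst (c (vmove x)) = 2 * fst (c x) - fst (c (hmove x)) \<and>
      snd (c (vmove x)) = 2 * snd (c x) - snd (c (hmove x)))"
    using vmove_perp [OF x] straight_iff [OF h(1) v(1)] by simp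
  \<comment> \<open>Two unit steps that are neither equal nor opposite are perpendicular.\<close>
  have units: "(d = x1 \<longleftrightarrow> b = x2) \<and> (e = x2 \<longleftrightarrow> b \<noteq> x2) \<and> (a = x1 \<longleftrightarrow> b \<noteq> x2)"
    if "\<bar>x1 - a\<bar> + \<bar>x2 - b\<bar> = 1" "\<bar>x1 - d\<bar> + \<bar>x2 - e\<bar> = 1" "d \<noteq> a \<or> e \<noteq> b"
      "\<not> (d = 2 * x1 - a \<and> e = 2 * x2 - b)" for a b d e x1 x2 :: int
    using abs_sum_eq_1 [OF that(1)] abs_sum_eq_1 [OF that(2)] that(3,4) by auto
  have hv: "fst (c (vmove x)) = fst (c x) \<longleftrightarrow> hz x" "snd (c (vmove x)) = snd (c x) \<longleftrightarrow> \<not> hz x"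
    "fst (c (hmove x)) = fst (c x) \<longleftrightarrow> \<not> hz x"
    using units [OF th tv ne ns] unfolding hz_def by blast+
  show "sigma_sign x \<in> {1, -1}" "tau_sign x \<in> {1, -1}"
    using th tv hv by (auto simp: sigma_sign_def tau_sign_def hz_def split: if_splits)
  show "c (hmove x) = loc x (1, 0)" "c (vmove x) = loc x (0, 1)"
    using hv by (auto simp: loc_def sigma_sign_def tau_sign_def hz_def prod_eq_iff split: if_splits)
qed

lemma taxi_loc:
  assumes "x \<in> space M"
  shows "taxi (loc x p) (loc x q) = taxi p q"
  using frame(1,2) [OF assms] by (auto simp: loc_def taxi_def algebra_simps)

definition good :: "int \<times> int \<Rightarrow> ('a \<Rightarrow> 'a) \<Rightarrow> bool" where
  "good p f \<longleftrightarrow> f \<in> M \<rightarrow>\<^sub>M M \<and> (\<forall>x\<in>space M. component G (f x) = component G x \<and> c (f x) = loc x p)"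

lemma goodD:
  assumes "good p f"
  shows "f \<in> M \<rightarrow>\<^sub>M M" "x \<in> space M \<Longrightarrow> f x \<in> space M"
    "x \<in> space M \<Longrightarrow> component G (f x) = component G x" "x \<in> space M \<Longrightarrow> c (f x) = loc x p"
  using assms measurable_space [of f M M x] by (auto simp: good_def)

lemma good_edge:
  assumes "good p f" "good q g" "taxi p q = 1" "x \<in> space M"
  shows "(f x, g x) \<in> G"
  using adj_iff [of "f x" "g x"] goodD [OF assms(1)] goodD [OF assms(2)] assms(3,4) by (simp add: taxi_loc)

text \<open>The reflection of \<open>p\<close> in \<open>q\<close> is the point opposite to
  \<open>f x\<close> across \<open>g x\<close>, which \<open>straight\<close> singles out in a Borel
  way.\<close>

lemma good_straight:
  assumes f: "good p f" and g: "good q g" and t: "taxi q p = 1"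
  shows "\<exists>h. good (2 * fst q - fst p, 2 * snd q - snd p) h"
proof -
  let ?r = "(2 * fst q - fst p, 2 * snd q - snd p)"
  note [measurable] = goodD(1) [OF f] goodD(1) [OF g]
  have loc_r: "loc x ?r = (2 * fst (loc x q) - fst (loc x p), 2 * snd (loc x q) - snd (loc x p))" for x
    by (auto simp: loc_def algebra_simps)
  have "\<exists>h\<in>M \<rightarrow>\<^sub>M M. \<forall>x\<in>space M. (g x, h x) \<in> G \<and> straight (f x) (g x) (h x)"
  proof (rule select_neighbour)
    show "Measurable.pred M (\<lambda>x. straight (f x) (g x) (h x))" if [measurable]: "h \<in> M \<rightarrow>\<^sub>M M" for h
      by measurable
    fix x assume x: "x \<in> space M"
    obtain z where z: "z \<in> space M" "component G z = component G x" "c z = loc x ?r" using c_surj [OF x] .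
    have "taxi q ?r = 1" using t by (auto simp: taxi_def)
    then have gz: "(g x, z) \<in> G"
      using adj_iff [OF goodD(2) [OF g x] z(1)] goodD [OF g] z x by (simp add: taxi_loc)
    moreover have "straight (f x) (g x) z"
      using straight_iff [OF good_edge [OF g f t x] gz] z goodD(4) [OF g x] goodD(4) [OF f x] by (simp add: loc_r)
    ultimately show "\<exists>z. (g x, z) \<in> G \<and> straight (f x) (g x) z" by blast
  qed simp
  then obtain h where h: "h \<in> M \<rightarrow>\<^sub>M M" "\<And>x. x \<in> space M \<Longrightarrow> (g x, h x) \<in> G \<and> straight (f x) (g x) (h x)"
    by blast
  have "component G (h x) = component G x \<and> c (h x) = loc x ?r" if x: "x \<in> space M" for x
    using straight_iff [OF good_edge [OF g f t x], of "h x"] h(2) [OF x] component_edge [of "g x" "h x"]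
      goodD [OF g] goodD(4) [OF f x] x by (auto simp: loc_r prod_eq_iff)
  then have "good ?r h" using h(1) by (simp add: good_def)
  then show ?thesis by blast
qed

lemma good_moves: "good (1, 0) hmove" "good (0, 1) vmove"
proof -
  have "component G (hmove x) = component G x" "component G (vmove x) = component G x"
    if "x \<in> space M" for x
    using component_edge [OF hmove_edge [OF that]] component_edge [OF vmove_edge [OF that]] by simp_all
  then show "good (1, 0) hmove" "good (0, 1) vmove"
    using frame(3,4) by (simp_all add: good_def)
qed

text \<open>Continuing straight on from \<open>x\<close>, \<open>hmove x\<close> and
  \<open>vmove x\<close> reaches only the axes. The corner is the other common neighbour of
  \<open>hmove x\<close> and \<open>vmove x\<close>.\<close>

lemma good_corner: "\<exists>h. good (1, 1) h"
proof -
  note h = good_moves(1) and v = good_moves(2)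
  have "\<exists>g\<in>M \<rightarrow>\<^sub>M M. \<forall>x\<in>space M. (hmove x, g x) \<in> G \<and> ((vmove x, g x) \<in> G \<and> g x \<noteq> x)"
  proof (rule select_neighbour)
    show "Measurable.pred M (\<lambda>x. (vmove x, g x) \<in> G \<and> g x \<noteq> x)" if [measurable]: "g \<in> M \<rightarrow>\<^sub>M M" for g
      by measurable
    fix x assume x: "x \<in> space M"
    obtain z where z: "z \<in> space M" "component G z = component G x" "c z = loc x (1, 1)" using c_surj [OF x] .
    have "(hmove x, z) \<in> G"
      using adj_iff [OF goodD(2) [OF h x] z(1)] goodD [OF h] z x by (simp add: taxi_loc) (simp add: taxi_def)
    moreover have "(vmove x, z) \<in> G"
      using adj_iff [OF goodD(2) [OF v x] z(1)] goodD [OF v] z x by (simp add: taxi_loc) (simp add: taxi_def)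
    moreover have "z \<noteq> x" using z frame(1,2) [OF x] by (auto simp: loc_def prod_eq_iff split: if_splits)
    ultimately show "\<exists>z. (hmove x, z) \<in> G \<and> ((vmove x, z) \<in> G \<and> z \<noteq> x)" by blast
  qed simp
  then obtain g where g: "g \<in> M \<rightarrow>\<^sub>M M"
    "\<And>x. x \<in> space M \<Longrightarrow> (hmove x, g x) \<in> G \<and> (vmove x, g x) \<in> G \<and> g x \<noteq> x" by blast
  have "component G (g x) = component G x \<and> c (g x) = loc x (1, 1)" if x: "x \<in> space M" for x
  proof -
    have gx: "(hmove x, g x) \<in> G" "(vmove x, g x) \<in> G" "g x \<noteq> x" using g(2) [OF x] by auto
    have C: "component G (g x) = component G x" using component_edge [OF gx(1)] goodD(3) [OF h x] by simp
    have gX: "g x \<in> space M" using G_in gx by blast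
    have 1: "taxi (loc x (1, 0)) (c (g x)) = 1"
      using adj_iff [OF goodD(2) [OF h x] gX] gx(1) C goodD [OF h] x by simp
    have 2: "taxi (loc x (0, 1)) (c (g x)) = 1"
      using adj_iff [OF goodD(2) [OF v x] gX] gx(2) C goodD [OF v] x by simp
    have 3: "fst (c (g x)) \<noteq> fst (c x) \<or> snd (c (g x)) \<noteq> snd (c x)"
      using c_inj [OF gX x C] gx(3) by (auto simp: prod_eq_iff)
    have corner: "u = \<sigma> \<and> v = \<tau>"
      if s: "\<sigma> \<in> {1, -1}" "\<tau> \<in> {1, -1}" and t: "\<bar>\<sigma> - u\<bar> + \<bar>v\<bar> = 1" "\<bar>u\<bar> + \<bar>\<tau> - v\<bar> = 1"
        and ne: "u \<noteq> 0 \<or> v \<noteq> 0" for u v \<sigma> \<tau> :: int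
      using abs_sum_eq_1 [OF t(1)] abs_sum_eq_1 [OF t(2)] s ne by auto
    have "fst (c (g x)) = fst (loc x (1, 1)) \<and> snd (c (g x)) = snd (loc x (1, 1))"
    proof (cases "hz x")
      case True
      have "fst (c (g x)) - fst (c x) = sigma_sign x \<and> snd (c (g x)) - snd (c x) = tau_sign x"
        by (rule corner [OF frame(1,2) [OF x]])
          (use 1 2 3 True in \<open>simp_all add: loc_def taxi_def algebra_simps abs_minus_commute\<close>)
      with True show ?thesis by (simp add: loc_def)
    next
      case False
      have "snd (c (g x)) - snd (c x) = sigma_sign x \<and> fst (c (g x)) - fst (c x) = tau_sign x"
        by (rule corner [OF frame(1,2) [OF x]])
          (use 1 2 3 False in \<open>simp_all add: loc_def taxi_def algebra_simps abs_minus_commute disj_commute\<close>)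
      with False show ?thesis by (simp add: loc_def)
    qed
    with C show ?thesis by (simp add: prod_eq_iff)
  qed
  then have "good (1, 1) g" using g(1) by (simp add: good_def)
  then show ?thesis by blast
qed

text \<open>The four corners of a unit square suffice: continued straight on they fill the rows 0
  and 1, and these fill every column.\<close>

lemma ex_good: "\<exists>f. good p f"
proof -
  have 00: "\<exists>f. good (0, 0) f" by (intro exI [of _ "\<lambda>x. x"]) (auto simp: good_def loc_def)
  have 10: "\<exists>f. good (1, 0) f" and 01: "\<exists>f. good (0, 1) f" using good_moves by blast+
  have hor: "\<exists>f. good (a, b) f" if "\<exists>f. good (0, b) f" "\<exists>f. good (1, b) f" for a b
  proof (rule int_two_step [where Q = "\<lambda>a. \<exists>f. good (a, b) f", OF that])
    fix a assume "\<exists>f. good (a, b) f" "\<exists>f. good (a + 1, b) f"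
    then obtain f g where "good (a, b) f" "good (a + 1, b) g" by blast
    then show "\<exists>f. good (a + 2, b) f" "\<exists>f. good (a - 1, b) f"
      using good_straight [of "(a, b)" f "(a + 1, b)" g] good_straight [of "(a + 1, b)" g "(a, b)" f]
      by (simp_all add: taxi_def algebra_simps)
  qed
  have ver: "\<exists>f. good (a, b) f" if "\<exists>f. good (a, 0) f" "\<exists>f. good (a, 1) f" for a b
  proof (rule int_two_step [where Q = "\<lambda>b. \<exists>f. good (a, b) f", OF that])
    fix b assume "\<exists>f. good (a, b) f" "\<exists>f. good (a, b + 1) f"
    then obtain f g where "good (a, b) f" "good (a, b + 1) g" by blast
    then show "\<exists>f. good (a, b + 2) f" "\<exists>f. good (a, b - 1) f"
      using good_straight [of "(a, b)" f "(a, b + 1)" g] good_straight [of "(a, b + 1)" g "(a, b)" f]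
      by (simp_all add: taxi_def algebra_simps)
  qed
  have "\<exists>f. good (fst p, snd p) f"
    by (rule ver [OF hor [OF 00 10] hor [OF 01 good_corner]])
  then show ?thesis by simp
qed

definition mv :: "int \<times> int \<Rightarrow> 'a \<Rightarrow> 'a" where
  "mv p = (SOME f. good p f)"

lemma mv_good: "good p (mv p)"
  unfolding mv_def by (rule someI_ex [OF ex_good])

sublocale borel_frames M k "component G" c hz mv
proof
  show "is_code M k" by (rule code)
  show "mv p \<in> M \<rightarrow>\<^sub>M M" for p by (rule goodD(1) [OF mv_good])
  show "component G (mv p x) = component G x" if "x \<in> space M" for p x by (rule goodD(3) [OF mv_good that])
  show "x = y" if "x \<in> space M" "y \<in> space M" "component G x = component G y" "c x = c y" for x y
    by (rule c_inj [OF that])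
  show "\<exists>\<sigma>\<in>{1, -1}. \<exists>\<tau>\<in>{1, -1}. \<forall>p. c (mv p x) =
      (if hz x then (fst (c x) + \<sigma> * fst p, snd (c x) + \<tau> * snd p)
       else (fst (c x) + \<tau> * snd p, snd (c x) + \<sigma> * fst p))" if x: "x \<in> space M" for x
    using frame(1,2) [OF x] goodD(4) [OF mv_good x]
    by (intro bexI [of _ "sigma_sign x"] bexI [of _ "tau_sign x"]) (auto simp: loc_def)
qed

end

section \<open>The dichotomy\<close>

context lattice_graph
begin

definition on_line :: "'a \<Rightarrow> 'a \<Rightarrow> bool" where
  "on_line x z \<longleftrightarrow> component G z = component G x \<and>
     (if hz x then snd (c z) = snd (c x) else fst (c z) = fst (c x))"

lemma on_line_mv:
  assumes "x \<in> space M" "z \<in> space M"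
  shows "on_line x z \<longleftrightarrow> (\<exists>t. z = mv (t, 0) x)"
proof
  assume z: "on_line x z"
  then obtain p where p: "z = mv p x" using ex_mv [OF assms] by (auto simp: on_line_def)
  then have "snd p = 0" using z mv_diff [OF assms(1), of p] by (auto simp: on_line_def split: if_splits)
  then have "p = (fst p, 0)" by (simp add: prod_eq_iff)
  with p show "\<exists>t. z = mv (t, 0) x" by metis
next
  assume "\<exists>t. z = mv (t, 0) x"
  then obtain t where t: "z = mv (t, 0) x" ..
  then show "on_line x z"
    using mv_diff [OF assms(1), of "(t, 0)"] cl_mv [OF assms(1), of "(t, 0)"] by (auto simp: on_line_def)
qed

lemma collinear_in_G:
  assumes "x \<in> space M"
  shows "collinear_in G x y \<longleftrightarrow> component G y = component G x \<and> (fst (c x) = fst (c y) \<or> snd (c x) = snd (c y))"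
proof -
  interpret full_grid G "component G x" c by (rule component_grid [OF assms])
  have x: "x \<in> component G x" by (simp add: component_eq)
  show ?thesis
    using collinear_iff [OF x, of y] collinear_same [OF x, of y] by (auto simp: component_eq)
qed

text \<open>An edge is colored by whether it has the selected direction. Whether it follows the
  frame at its starting point \<open>x\<close>, and whether \<open>x\<close> is in \<open>B\<close>,
  are both Borel; the unknown direction \<open>hz x\<close> enters both and cancels.\<close>

lemma small_two_coloring:
  assumes "small (space M)"
  shows "\<exists>col. borel_two_coloring (restrict_space (M \<Otimes>\<^sub>M M) G) (perp_graph G) col"
proof -
  obtain B where B [measurable]: "B \<in> sets M" and sel: "\<And>x. x \<in> space M \<Longrightarrow> \<exists>b. selects B b x"
    using assms unfolding small_def by blast
  define col :: "'a \<times> 'a \<Rightarrow> nat" where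
    "col e = (if fst e \<in> B \<longleftrightarrow> snd e = mv (1, 0) (fst e) \<or> snd e = mv (-1, 0) (fst e) then 0 else 1)" for e
  have [measurable]: "Measurable.pred (M \<Otimes>\<^sub>M M) (\<lambda>e. snd e = mv p (fst e))" for p
    by (rule code_measurable_eq [OF code]) measurable
  have "Measurable.pred (M \<Otimes>\<^sub>M M) (\<lambda>e. fst e \<in> B \<longleftrightarrow> snd e = mv (1, 0) (fst e) \<or> snd e = mv (-1, 0) (fst e))"
    by measurable
  then have "col \<in> M \<Otimes>\<^sub>M M \<rightarrow>\<^sub>M count_space {0, 1}"
    unfolding col_def by (intro measurable_If) auto
  then have meas: "col \<in> restrict_space (M \<Otimes>\<^sub>M M) G \<rightarrow>\<^sub>M count_space {0, 1}"
    by (rule measurable_restrict_space1)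
  have col: "col (x, y) = 0 \<longleftrightarrow> ((snd (c x) = snd (c y)) = b)" if "selects B b x" "(x, y) \<in> G" for x y b
  proof -
    have X: "x \<in> space M" "y \<in> space M" using G_in that by auto
    have Cxy: "component G y = component G x" using component_edge [OF that(2)] by simp
    have t: "\<bar>fst (c x) - fst (c y)\<bar> + \<bar>snd (c x) - snd (c y)\<bar> = 1"
      using adj_iff [OF X] Cxy that(2) by (simp add: taxi_def)
    have "y = mv (1, 0) x \<or> y = mv (-1, 0) x \<longleftrightarrow> on_line x y"
    proof
      assume "y = mv (1, 0) x \<or> y = mv (-1, 0) x"
      then show "on_line x y" using on_line_mv [OF X] by blast
    next
      assume "on_line x y"
      then obtain s where s: "y = mv (s, 0) x" using on_line_mv [OF X] by blast
      then have "\<bar>s\<bar> = 1" using mv_diff [OF X(1), of "(s, 0)"] t by (auto split: if_splits)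
      then have "s = 1 \<or> s = -1" by linarith
      then show "y = mv (1, 0) x \<or> y = mv (-1, 0) x" using s by blast
    qed
    also have "on_line x y \<longleftrightarrow> ((snd (c x) = snd (c y)) = hz x)"
      using Cxy abs_sum_eq_1 [OF t] by (auto simp: on_line_def)
    finally have "col (x, y) = 0 \<longleftrightarrow> (x \<in> B \<longleftrightarrow> ((snd (c x) = snd (c y)) = hz x))" by (simp add: col_def)
    moreover have "x \<in> B \<longleftrightarrow> hz x = b" using that(1) X(1) by (simp add: selects_def)
    ultimately show ?thesis by blast
  qed
  have "col (x, y) \<noteq> col (x', y')" if perp: "((x, y), (x', y')) \<in> perp_graph G" for x y x' y'
  proof -
    have e: "(x, y) \<in> G" "(x', y') \<in> G" "x' \<in> component G x" using perp by (auto simp: perp_graph_def)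
    then have X: "x \<in> space M" using G_in by blast
    obtain b where b: "selects B b x" using sel [OF X] by blast
    then have b': "selects B b x'" using e(3) by (simp add: selects_def component_eq)
    interpret full_grid G "component G x" c by (rule component_grid [OF X])
    have "(snd (c x) = snd (c y)) \<noteq> (snd (c x') = snd (c y'))"
      using perp_rows [OF perp] e(3) by (simp add: component_eq)
    then show ?thesis using col [OF b e(1)] col [OF b' e(2)] by metis
  qed
  then have "borel_two_coloring (restrict_space (M \<Otimes>\<^sub>M M) G) (perp_graph G) col"
    using meas by (auto simp: borel_two_coloring_def)
  then show ?thesis by blast
qed

lemma embedding_conformal:
  fixes f :: "(nat \<Rightarrow> bool) \<Rightarrow> 'a"
  assumes f [measurable]: "f \<in> borel \<rightarrow>\<^sub>M M"
    and flip: "\<forall>a b j. a j \<noteq> b j \<and> (\<forall>i. i \<noteq> j \<longrightarrow> a i = b i) \<longrightarrow>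
      component G (f a) = component G (f b) \<and> hz (f a) \<noteq> hz (f b)"
    and lines: "\<forall>a b t. a \<noteq> b \<longrightarrow> f b \<noteq> mv (t, 0) (f a)"
  shows "\<exists>F \<in> S0_space \<rightarrow>\<^sub>M M. conformal_map S0_vertices S0_graph (space M) G F"
proof -
  have fX: "f a \<in> space M" for a using measurable_space [OF f, of a] by simp
  have walk: "component G (f a) = component G (f b) \<and> (hz (f a) = hz (f b) \<longleftrightarrow> even n)"
    if "(a, b) \<in> L_graph ^^ n" for a b n
    using that
  proof (induction n arbitrary: b)
    case (Suc n)
    then obtain d where d: "(a, d) \<in> L_graph ^^ n" "(d, b) \<in> L_graph" by auto
    obtain j where "d j \<noteq> b j" "\<And>i. i \<noteq> j \<Longrightarrow> d i = b i" using L_graph_flip [OF d(2)] by blast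
    then have "component G (f d) = component G (f b) \<and> hz (f d) \<noteq> hz (f b)" using flip by blast
    with Suc.IH [OF d(1)] show ?case by auto
  qed simp
  have odd: "component G (f a) = component G (f b)" "hz (f a) \<noteq> hz (f b)" if "(a, b) \<in> odd_pairs" for a b
    using odd_pairs_walk [OF that] walk by blast+
  define meet where "meet v z \<longleftrightarrow> z \<in> space M \<and> (\<forall>p\<in>v. on_line (f (fst p)) z)" for v :: S0_vertex and z
  define F where "F v = (THE z. meet v z)" for v
  have meet_iff: "meet (unordered (a, b)) z \<longleftrightarrow> z \<in> space M \<and> on_line (f a) z \<and> on_line (f b) z" for a b z
    by (auto simp: meet_def unordered_def)
  have ex1: "\<exists>!z. meet (unordered (a, b)) z" if ab: "(a, b) \<in> odd_pairs" for a b
  proof -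
    note ab' = odd [OF ab]
    define P where "P = (if hz (f a) then (fst (c (f b)), snd (c (f a))) else (fst (c (f a)), snd (c (f b))))"
    obtain z where z: "z \<in> space M" "component G z = component G (f a)" "c z = P" using c_surj [OF fX] .
    have "meet (unordered (a, b)) z"
      using z ab' by (auto simp: meet_iff on_line_def P_def)
    moreover have "w = z" if w: "meet (unordered (a, b)) w" for w
    proof (rule c_inj)
      show "c w = c z" using w z ab' by (auto simp: meet_iff on_line_def P_def prod_eq_iff split: if_splits)
    qed (use w z in \<open>auto simp: meet_iff on_line_def\<close>)
    ultimately show ?thesis by blast
  qed
  have F: "F (unordered (a, b)) \<in> space M" "on_line (f a) (F (unordered (a, b)))" "on_line (f b) (F (unordered (a, b)))"
    if "(a, b) \<in> odd_pairs" for a b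
    using theI' [OF ex1 [OF that]] unfolding F_def meet_iff by blast+
  \<comment> \<open>Seen from \<open>f a\<close>, the crossing is the part along the first axis of
    the move to \<open>f b\<close>. This expresses \<open>F\<close> by countably many Borel
    maps.\<close>
  have F_eq: "F (unordered (a, b)) = mv (fst p, 0) (f a)" if ab: "(a, b) \<in> odd_pairs" and p: "f b = mv p (f a)" for a b p
  proof -
    obtain \<sigma> \<tau> :: int where s: "\<And>p. c (mv p (f a)) =
      (if hz (f a) then (fst (c (f a)) + \<sigma> * fst p, snd (c (f a)) + \<tau> * snd p)
       else (fst (c (f a)) + \<tau> * snd p, snd (c (f a)) + \<sigma> * fst p))"
      using c_mv [OF fX] by blast
    have "meet (unordered (a, b)) (mv (fst p, 0) (f a))"
      using odd [OF ab] s [of p] s [of "(fst p, 0)"] mv_in [OF fX] cl_mv [OF fX]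
      by (auto simp: meet_iff on_line_def simp flip: p)
    then show ?thesis unfolding F_def by (rule the1_equality [OF ex1 [OF ab]])
  qed
  have "F \<in> S0_space \<rightarrow>\<^sub>M M"
  proof (rule measurableI)
    show "F v \<in> space M" if "v \<in> space S0_space" for v
      using that F(1) by (auto simp: S0_vertices_def)
    fix U assume U [measurable]: "U \<in> sets M"
    let ?N = "borel :: ((nat \<Rightarrow> bool) \<times> (nat \<Rightarrow> bool)) measure"
    have "fst \<in> ?N \<rightarrow>\<^sub>M borel" "snd \<in> ?N \<rightarrow>\<^sub>M borel"
      by (intro borel_measurable_continuous_onI continuous_on_fst continuous_on_snd continuous_on_id)+
    then have [measurable]: "(\<lambda>q. f (fst q)) \<in> ?N \<rightarrow>\<^sub>M M" "(\<lambda>q. f (snd q)) \<in> ?N \<rightarrow>\<^sub>M M"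
      using measurable_compose [OF _ f] by blast+
    define W where "W = {q \<in> space ?N. \<exists>p. f (snd q) = mv p (f (fst q)) \<and> mv (fst p, 0) (f (fst q)) \<in> U}"
    have [measurable]: "Measurable.pred ?N (\<lambda>q. f (snd q) = mv p (f (fst q)))" for p
      by (rule code_measurable_eq [OF code]) measurable
    have W: "W \<in> sets ?N" unfolding W_def by measurable
    have "unordered -` (F -` U \<inter> S0_vertices) \<inter> odd_pairs = odd_pairs \<inter> W"
    proof (intro set_eqI iffI)
      fix q assume q: "q \<in> unordered -` (F -` U \<inter> S0_vertices) \<inter> odd_pairs"
      obtain a b where ab: "q = (a, b)" by fastforce
      obtain p where p: "f b = mv p (f a)"
        using ex_mv [OF fX fX] odd(1) [of a b] q ab by blast
      have "f (snd q) = mv p (f (fst q)) \<and> mv (fst p, 0) (f (fst q)) \<in> U"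
        using q ab p F_eq [OF _ p] by simp
      then have "q \<in> W" unfolding W_def space_borel by blast
      then show "q \<in> odd_pairs \<inter> W" using q by simp
    next
      fix q assume q: "q \<in> odd_pairs \<inter> W"
      obtain a b where ab: "q = (a, b)" by fastforce
      obtain p where p: "f b = mv p (f a)" "mv (fst p, 0) (f a) \<in> U" using q ab by (auto simp: W_def)
      show "q \<in> unordered -` (F -` U \<inter> S0_vertices) \<inter> odd_pairs"
        using q ab p F_eq [OF _ p(1)] by (auto simp: S0_vertices_def)
    qed
    then have "unordered -` (F -` U \<inter> S0_vertices) \<inter> odd_pairs \<in> sets (restrict_space borel odd_pairs)"
      using W by (auto simp: sets_restrict_space)
    then show "F -` U \<inter> space S0_space \<in> sets S0_space"
      by (simp add: sets_S0_space)
  qed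
  moreover have "conformal_map S0_vertices S0_graph (space M) G F"
    unfolding conformal_map_def
  proof (intro conjI ballI)
    show "F \<in> S0_vertices \<rightarrow> space M" using F(1) by (auto simp: S0_vertices_def)
    fix u v assume "u \<in> S0_vertices" "v \<in> S0_vertices"
    then obtain a b a' b' where u: "u = unordered (a, b)" "(a, b) \<in> odd_pairs"
      and v: "v = unordered (a', b')" "(a', b') \<in> odd_pairs" by (auto simp: S0_vertices_def)
    note Fu = F [OF u(2), folded u(1)] and Fv = F [OF v(2), folded v(1)]
    have "collinear_in G (F u) (F v) \<longleftrightarrow> {a, b} \<inter> {a', b'} \<noteq> {}"
    proof
      assume "{a, b} \<inter> {a', b'} \<noteq> {}"
      then obtain d where "on_line (f d) (F u)" "on_line (f d) (F v)" using Fu Fv by blast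
      then show "collinear_in G (F u) (F v)"
        unfolding collinear_in_G [OF Fu(1)] by (auto simp: on_line_def split: if_splits)
    next
      assume "collinear_in G (F u) (F v)"
      then have C: "component G (F v) = component G (F u)"
        and eq: "fst (c (F u)) = fst (c (F v)) \<or> snd (c (F u)) = snd (c (F v))"
        unfolding collinear_in_G [OF Fu(1)] by auto
      \<comment> \<open>The direction of a line joining \<open>F u\<close> and \<open>F v\<close>.
        Since an odd pair has a line of each direction, one of those through \<open>F u\<close> and
        one of those through \<open>F v\<close> have this direction, and then they coincide.\<close>
      define h where "h \<longleftrightarrow> snd (c (F u)) = snd (c (F v))"
      obtain d where d: "d \<in> {a, b}" "hz (f d) = h"
        using odd(2) [OF u(2)] by (cases "hz (f a) = h") auto
      obtain d' where d': "d' \<in> {a', b'}" "hz (f d') = h"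
        using odd(2) [OF v(2)] by (cases "hz (f a') = h") auto
      have l: "on_line (f d) (F u)" "on_line (f d') (F v)" using d(1) d'(1) Fu Fv by auto
      have "on_line (f d) (f d')"
        using l C eq d(2) d'(2) by (auto simp: on_line_def h_def split: if_splits)
      then obtain t where "f d' = mv (t, 0) (f d)" using on_line_mv [OF fX fX] by blast
      then have "d = d'" using lines by blast
      with d(1) d'(1) show "{a, b} \<inter> {a', b'} \<noteq> {}" by blast
    qed
    then show "collinear_in S0_graph u v \<longleftrightarrow> collinear_in G (F u) (F v)"
      unfolding u(1) v(1) S0_collinear [OF u(2) v(2)] by simp
  qed
  ultimately show ?thesis by blast
qed

end

theorem theorem5p14:
  fixes M :: "'a measure" and G :: "'a rel"
  assumes "standard_borel M"
    and "borel_graph M G"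
    and "locally_square_lattice (space M) G"
  shows "(\<exists>c. borel_two_coloring (restrict_space (M \<Otimes>\<^sub>M M) G) (perp_graph G) c) \<or>
    (\<exists>f \<in> S0_space \<rightarrow>\<^sub>M M. conformal_map S0_vertices S0_graph (space M) G f)"
proof -
  obtain k :: "'a \<Rightarrow> nat \<Rightarrow> nat" where "is_code M k" using standard_borel_code [OF assms(1)] ..
  then interpret lattice_graph M G k using assms(2,3) by unfold_locales
  show ?thesis
  proof (cases "small (space M)")
    case True
    then show ?thesis using small_two_coloring by blast
  next
    case False
    from not_small_embedding [OF this] show ?thesis
      by (elim exE conjE) (intro disjI2 embedding_conformal)
  qed
qed

end
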